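(* Let $k$ be a field of characteristic $0$ and let $\Theta$ be the variety of all representations of groups over linear spaces over $k$. Let $\mathfrak{A}$ be the group of all automorphisms of the category $\Theta^0$ and $\mathfrak{Y}$ its normal subgroup of all inner automorphisms. Then $\mathfrak{A}/\mathfrak{Y}\cong\mathrm{Aut}\,k$, where $\mathrm{Aut}\,k$ is the group of all automorphisms of the field $k$.
   Context: A representation of a group over a $k$-linear space is a two-sorted algebra $H$ with sorts $\Gamma=\{1,2\}$: $H^{(1)}$ is a group, $H^{(2)}$ is a $k$-linear space, and there is an operation $\circ$ of type $(1,2;2)$ such that $v\mapsto g\circ v$ is $k$-linear for each $g\in H^{(1)}$, $1\circ v=v$ and $(g_1g_2)\circ v=g_1\circ(g_2\circ v)$. The signature consists of the unit, inverse and multiplication in the group; zero, negation, addition and, for each $\lambda\in k$, the unary operation of multiplication by the scalar $\lambda$ in the linear space; and $\circ$. A homomorphism is a sort-preserving map commuting with all these operations, i.e. a pair consisting of a group homomorphism and a $k$-linear map compatible with the actions. $\Theta$ is the variety of all such algebras. Let $X_0$ be a two-sorted set with countably infinitely many elements of each sort. The objects of $\Theta^0$ are the free algebras $F(X)$ of $\Theta$ with $X\subset X_0$ finite, the morphisms are all homomorphisms. Explicitly, if $X^{(i)}$ is the set of elements of $X$ of sort $i$, then $F(X)^{(1)}=G(X^{(1)})$ is the free group on $X^{(1)}$ and $F(X)^{(2)}$ is the free $kG(X^{(1)})$-module with basis $X^{(2)}$. An automorphism $\Upsilon$ of a category $\mathfrak{K}$ is inner if it is isomorphic, as a functor, to the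 identity automorphism of $\mathfrak{K}$; that is, there are isomorphisms $s_A:A\to\Upsilon(A)$ ($A\in\mathrm{Ob}\,\mathfrak{K}$) such that $\Upsilon(\mu)s_A=s_B\mu$ for every morphism $\mu:A\to B$. *)

theory Defs
  imports "HOL-Algebra.Algebra" "HOL-Library.Poly_Mapping"
begin

section \<open>Categories and their automorphisms\<close>

record ('o, 'm) category =
  Ob :: "'o set"
  Arr :: "'m set"
  Dom :: "'m \<Rightarrow> 'o"
  Cod :: "'m \<Rightarrow> 'o"
  Id :: "'o \<Rightarrow> 'm"
  Comp :: "'m \<Rightarrow> 'm \<Rightarrow> 'm"

text \<open>\<open>Comp C g f\<close> is the composite ``first \<open>f\<close>, then \<open>g\<close>''; it is meaningful only if
  \<open>Cod C f = Dom C g\<close>.\<close>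

definition is_category :: "('o, 'm) category \<Rightarrow> bool" where
  "is_category C \<longleftrightarrow>
     (\<forall>f\<in>Arr C. Dom C f \<in> Ob C \<and> Cod C f \<in> Ob C) \<and>
     (\<forall>A\<in>Ob C. Id C A \<in> Arr C \<and> Dom C (Id C A) = A \<and> Cod C (Id C A) = A) \<and>
     (\<forall>f\<in>Arr C. Comp C f (Id C (Dom C f)) = f \<and> Comp C (Id C (Cod C f)) f = f) \<and>
     (\<forall>f\<in>Arr C. \<forall>g\<in>Arr C. Cod C f = Dom C g \<longrightarrow>
        Comp C g f \<in> Arr C \<and> Dom C (Comp C g f) = Dom C f \<and> Cod C (Comp C g f) = Cod C g) \<and>
     (\<forall>f\<in>Arr C. \<forall>g\<in>Arr C. \<forall>h\<in>Arr C. Cod C f = Dom C g \<and> Cod C g = Dom C h \<longrightarrow>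
        Comp C h (Comp C g f) = Comp C (Comp C h g) f)"

text \<open>An automorphism of a category is an invertible functor to itself, that is, a functor that is
  bijective on objects and on arrows.  The maps are extensional, so that every automorphism is
  represented by exactly one pair.\<close>

definition cat_auto :: "('o, 'm) category \<Rightarrow> (('o \<Rightarrow> 'o) \<times> ('m \<Rightarrow> 'm)) set" where
  "cat_auto C = {(F, \<Phi>). F \<in> Bij (Ob C) \<and> \<Phi> \<in> Bij (Arr C) \<and>
     (\<forall>f\<in>Arr C. Dom C (\<Phi> f) = F (Dom C f) \<and> Cod C (\<Phi> f) = F (Cod C f)) \<and>
     (\<forall>A\<in>Ob C. \<Phi> (Id C A) = Id C (F A)) \<and>
     (\<forall>f\<in>Arr C. \<forall>g\<in>Arr C. Cod C f = Dom C g \<longrightarrow> \<Phi> (Comp C g f) = Comp C (\<Phi> g) (\<Phi> f))}"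

definition Cat_Auto :: "('o, 'm) category \<Rightarrow> (('o \<Rightarrow> 'o) \<times> ('m \<Rightarrow> 'm)) monoid" where
  "Cat_Auto C = (BijGroup (Ob C) \<times>\<times> BijGroup (Arr C)) \<lparr>carrier := cat_auto C\<rparr>"

definition cat_isos :: "('o, 'm) category \<Rightarrow> 'o \<Rightarrow> 'o \<Rightarrow> 'm set" where
  "cat_isos C A B = {f \<in> Arr C. Dom C f = A \<and> Cod C f = B \<and>
     (\<exists>g\<in>Arr C. Dom C g = B \<and> Cod C g = A \<and> Comp C g f = Id C A \<and> Comp C f g = Id C B)}"

definition inner_autos :: "('o, 'm) category \<Rightarrow> (('o \<Rightarrow> 'o) \<times> ('m \<Rightarrow> 'm)) set" where
  "inner_autos C = {(F, \<Phi>) \<in> cat_auto C.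
     \<exists>s. (\<forall>A\<in>Ob C. s A \<in> cat_isos C A (F A)) \<and>
         (\<forall>\<mu>\<in>Arr C. Comp C (\<Phi> \<mu>) (s (Dom C \<mu>)) = Comp C (s (Cod C \<mu>)) \<mu>)}"


section \<open>Fields and their automorphism groups\<close>

definition field_ring :: "'k::field ring" where
  "field_ring = \<lparr>carrier = UNIV, monoid.mult = (*), one = 1, ring.zero = 0, ring.add = (+)\<rparr>"

definition Ring_Auto :: "'r ring \<Rightarrow> ('r \<Rightarrow> 'r) monoid" where
  "Ring_Auto R = BijGroup (carrier R) \<lparr>carrier := ring_hom R R \<inter> Bij (carrier R)\<rparr>"


section \<open>Representations of groups over linear spaces\<close>

text \<open>A linear space over \<open>'k\<close> is a module over \<^term>\<open>field_ring\<close>.  The \<open>mult\<close> and \<open>one\<close>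
  fields of the library record for modules play no role.\<close>

record ('g, 'v, 'k) rep =
  grp :: "'g monoid"
  lin :: "('k, 'v) module"
  act :: "'g \<Rightarrow> 'v \<Rightarrow> 'v"

definition lin_hom :: "('k::field, 'v) module \<Rightarrow> ('k, 'w) module \<Rightarrow> ('v \<Rightarrow> 'w) set" where
  "lin_hom V W = {\<psi> \<in> carrier V \<rightarrow> carrier W.
     (\<forall>u\<in>carrier V. \<forall>v\<in>carrier V. \<psi> (u \<oplus>\<^bsub>V\<^esub> v) = \<psi> u \<oplus>\<^bsub>W\<^esub> \<psi> v) \<and>
     (\<forall>c. \<forall>v\<in>carrier V. \<psi> (c \<odot>\<^bsub>V\<^esub> v) = c \<odot>\<^bsub>W\<^esub> \<psi> v)}"

definition is_representation :: "('g, 'v, 'k::field) rep \<Rightarrow> bool" where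
  "is_representation H \<longleftrightarrow> group (grp H) \<and> module field_ring (lin H) \<and>
     (\<forall>g\<in>carrier (grp H). act H g \<in> lin_hom (lin H) (lin H)) \<and>
     (\<forall>v\<in>carrier (lin H). act H \<one>\<^bsub>grp H\<^esub> v = v) \<and>
     (\<forall>g\<in>carrier (grp H). \<forall>h\<in>carrier (grp H). \<forall>v\<in>carrier (lin H).
        act H (g \<otimes>\<^bsub>grp H\<^esub> h) v = act H g (act H h v))"

text \<open>Homomorphisms of representations; compatibility with the unit and inverses of the group and
  with zero and negation of the linear space is automatic.\<close>

definition rep_hom ::
  "('g, 'v, 'k::field) rep \<Rightarrow> ('h, 'w, 'k) rep \<Rightarrow> (('g \<Rightarrow> 'h) \<times> ('v \<Rightarrow> 'w)) set" where
  "rep_hom H H' = {(\<phi>, \<psi>).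
     \<phi> \<in> hom (grp H) (grp H') \<inter> extensional (carrier (grp H)) \<and>
     \<psi> \<in> lin_hom (lin H) (lin H') \<inter> extensional (carrier (lin H)) \<and>
     (\<forall>g\<in>carrier (grp H). \<forall>v\<in>carrier (lin H). \<psi> (act H g v) = act H' (\<phi> g) (\<psi> v))}"


section \<open>Free groups\<close>

text \<open>The letters \<open>(x, True)\<close> and \<open>(x, False)\<close> stand for \<open>x\<close> and its inverse.\<close>

type_synonym 'x word = "('x \<times> bool) list"

definition inv_letter :: "'x \<times> bool \<Rightarrow> 'x \<times> bool" where
  "inv_letter a = (fst a, \<not> snd a)"

definition reduced :: "'x word \<Rightarrow> bool" where
  "reduced w \<longleftrightarrow> successively (\<lambda>a b. b \<noteq> inv_letter a) w"

fun lmult :: "'x \<times> bool \<Rightarrow> 'x word \<Rightarrow> 'x word" where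
  "lmult a [] = [a]"
| "lmult a (b # w) = (if b = inv_letter a then w else a # b # w)"

definition wmult :: "'x word \<Rightarrow> 'x word \<Rightarrow> 'x word" where
  "wmult u v = foldr lmult u v"

definition free_grp :: "'x set \<Rightarrow> 'x word monoid" where
  "free_grp A = \<lparr>carrier = {w. reduced w \<and> fst ` set w \<subseteq> A}, monoid.mult = wmult, one = []\<rparr>"


section \<open>Free representations\<close>

text \<open>The free module with basis \<open>B\<close> over the group algebra of the free group \<open>G\<close> on \<open>A\<close> is the
  linear space with basis \<open>G \<times> B\<close>, where \<open>(h, y)\<close> stands for \<open>h \<circ> y\<close>.\<close>

definition pushforward :: "('a \<Rightarrow> 'b) \<Rightarrow> ('a \<Rightarrow>\<^sub>0 'k) \<Rightarrow> ('b \<Rightarrow>\<^sub>0 'k::comm_monoid_add)" where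
  "pushforward f v = (\<Sum>x\<in>Poly_Mapping.keys v. Poly_Mapping.single (f x) (Poly_Mapping.lookup v x))"

definition span_space :: "'a set \<Rightarrow> ('k::field, 'a \<Rightarrow>\<^sub>0 'k) module" where
  "span_space S = \<lparr>carrier = {v. Poly_Mapping.keys v \<subseteq> S}, monoid.mult = undefined, one = undefined,
     ring.zero = 0, ring.add = (+), smult = (\<lambda>c. Poly_Mapping.map ((*) c))\<rparr>"

definition free_rep ::
  "'x set \<Rightarrow> 'y set \<Rightarrow> ('x word, ('x word \<times> 'y) \<Rightarrow>\<^sub>0 'k, 'k::field) rep" where
  "free_rep A B = \<lparr>grp = free_grp A, lin = span_space (carrier (free_grp A) \<times> B),
     act = (\<lambda>g. pushforward (\<lambda>(h, y). (wmult g h, y)))\<rparr>"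


section \<open>The category of finitely generated free representations\<close>

text \<open>The elements of each sort of the two-sorted set of variables are the natural numbers, so that
  a finite subset of it is a pair of finite sets of natural numbers.  An arrow carries its source
  and target along with the two components of the homomorphism.\<close>

type_synonym 'k frep = "(nat word, (nat word \<times> nat) \<Rightarrow>\<^sub>0 'k, 'k) rep"
type_synonym 'k farr = "'k frep \<times> 'k frep \<times>
  (nat word \<Rightarrow> nat word) \<times> (((nat word \<times> nat) \<Rightarrow>\<^sub>0 'k) \<Rightarrow> ((nat word \<times> nat) \<Rightarrow>\<^sub>0 'k))"

definition Theta0_objects :: "'k::field frep set" where
  "Theta0_objects = {free_rep A B |A B. finite A \<and> finite B}"

definition Theta0 :: "'k::field itself \<Rightarrow> ('k frep, 'k farr) category" where
  "Theta0 _ = \<lparr>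
     Ob = Theta0_objects,
     Arr = {(H, H', h). H \<in> Theta0_objects \<and> H' \<in> Theta0_objects \<and> h \<in> rep_hom H H'},
     Dom = (\<lambda>(H, H', h). H),
     Cod = (\<lambda>(H, H', h). H'),
     Id = (\<lambda>H. (H, H, (\<lambda>g\<in>carrier (grp H). g), (\<lambda>v\<in>carrier (lin H). v))),
     Comp = (\<lambda>(H', H'', \<phi>', \<psi>') (H, _, \<phi>, \<psi>).
       (H, H'', compose (carrier (grp H)) \<phi>' \<phi>, compose (carrier (lin H)) \<psi>' \<psi>))\<rparr>"


section \<open>Free representations are free, and they form a category\<close>

lemma field_field_ring: "field (field_ring :: 'k::field ring)"
proof -
  have "cring (field_ring :: 'k ring)"
  proof (rule cringI)
    show "abelian_group (field_ring :: 'k ring)"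
      by (rule abelian_groupI) (auto simp: field_ring_def algebra_simps intro: exI[of _ "- _"])
  qed (auto simp: field_ring_def algebra_simps intro!: comm_monoidI)
  then interpret cring "field_ring :: 'k ring" .
  show ?thesis
  proof (rule cring_fieldI2)
    fix a :: 'k assume "a \<noteq> \<zero>\<^bsub>field_ring\<^esub>"
    then show "\<exists>b\<in>carrier field_ring. a \<otimes>\<^bsub>field_ring\<^esub> b = \<one>\<^bsub>field_ring\<^esub>"
      by (auto simp: field_ring_def intro!: exI[of _ "inverse a"])
  qed (simp add: field_ring_def)
qed

lemma inv_letter_inv [simp]: "inv_letter (inv_letter a) = a"
  by (simp add: inv_letter_def)

lemma reduced_Nil [simp]: "reduced []" by (simp add: reduced_def)

lemma reduced_Cons: "reduced (a # w) \<longleftrightarrow> reduced w \<and> (w \<noteq> [] \<longrightarrow> hd w \<noteq> inv_letter a)"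
  by (auto simp: reduced_def successively_Cons)

lemma reduced_lmult: "reduced w \<Longrightarrow> reduced (lmult a w)"
  by (cases w) (auto simp: reduced_Cons)

lemma lmult_inv: "reduced w \<Longrightarrow> lmult (inv_letter a) (lmult a w) = w"
  by (cases w rule: remdups_adj.cases) (auto simp: reduced_Cons)

lemma wmult_simps [simp]: "wmult [] v = v" "wmult (a # u) v = lmult a (wmult u v)"
  by (simp_all add: wmult_def)

lemma reduced_wmult: "reduced v \<Longrightarrow> reduced (wmult u v)"
  by (induction u) (auto simp: reduced_lmult)

lemma wmult_lmult: "reduced v \<Longrightarrow> wmult (lmult a u) v = lmult a (wmult u v)"
  by (cases u) (auto simp: lmult_inv[of "wmult _ v" "inv_letter a", simplified] reduced_wmult)

lemma wmult_assoc: "reduced w \<Longrightarrow> wmult (wmult u v) w = wmult u (wmult v w)"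
  by (induction u) (auto simp: wmult_lmult)

lemma lmult_reduced: "reduced (a # w) \<Longrightarrow> lmult a w = a # w"
  by (cases w) (auto simp: reduced_Cons)

lemma wmult_Nil2: "reduced u \<Longrightarrow> wmult u [] = u"
  by (induction u) (auto simp: lmult_reduced reduced_Cons)

lemma wmult_append: "wmult (u @ v) w = wmult u (wmult v w)"
  by (simp add: wmult_def)

lemma wmult_inverse: "wmult (rev (map inv_letter u)) u = []"
  by (induction u) (auto simp: wmult_append)

lemma letters_lmult: "set (lmult a w) \<subseteq> insert a (set w)"
  by (cases w) auto

lemma letters_wmult: "set (wmult u v) \<subseteq> set u \<union> set v"
  by (induction u) (use letters_lmult in fastforce)+

lemma reduced_inverse: "reduced u \<Longrightarrow> reduced (rev (map inv_letter u))"
  unfolding reduced_def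
  apply (simp add: successively_map)
  apply (erule successively_mono)
  by (auto simp: inv_letter_def)

lemma fst_inv_letter [simp]: "fst (inv_letter a) = fst a" by (simp add: inv_letter_def)

lemma group_free_grp: "group (free_grp A)"
proof (rule groupI)
  fix u assume u: "u \<in> carrier (free_grp A)"
  have "rev (map inv_letter u) \<in> carrier (free_grp A)"
    using u by (auto simp: free_grp_def reduced_inverse)
  then show "\<exists>v\<in>carrier (free_grp A). v \<otimes>\<^bsub>free_grp A\<^esub> u = \<one>\<^bsub>free_grp A\<^esub>"
    by (rule rev_bexI) (simp add: free_grp_def wmult_inverse)
next
  fix u v assume "u \<in> carrier (free_grp A)" "v \<in> carrier (free_grp A)"
  then show "u \<otimes>\<^bsub>free_grp A\<^esub> v \<in> carrier (free_grp A)"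
    using letters_wmult[of u v] by (fastforce simp: free_grp_def reduced_wmult)
qed (auto simp: free_grp_def wmult_assoc)

definition wordval :: "('g, 'm) monoid_scheme \<Rightarrow> ('x \<Rightarrow> 'g) \<Rightarrow> 'x word \<Rightarrow> 'g" where
  "wordval G a w = foldr (\<lambda>(x, e) g. (if e then a x else inv\<^bsub>G\<^esub> a x) \<otimes>\<^bsub>G\<^esub> g) w \<one>\<^bsub>G\<^esub>"

lemma wordval_simps [simp]: "wordval G a [] = \<one>\<^bsub>G\<^esub>"
  "wordval G a (l # w) = (if snd l then a (fst l) else inv\<^bsub>G\<^esub> a (fst l)) \<otimes>\<^bsub>G\<^esub> wordval G a w"
  by (auto simp: wordval_def split: prod.splits)

lemma (in group) wordval_closed: "fst ` set w \<subseteq> A \<Longrightarrow> a \<in> A \<rightarrow> carrier G \<Longrightarrow> wordval G a w \<in> carrier G"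
  by (induction w) auto

lemma (in group) wordval_lmult:
  assumes a: "a \<in> A \<rightarrow> carrier G" and "fst l \<in> A" "fst ` set w \<subseteq> A"
  shows "wordval G a (lmult l w) = wordval G a (l # w)"
proof (cases w)
  case (Cons b v)
  have "a (fst l) \<in> carrier G" "wordval G a v \<in> carrier G" using assms Cons by (auto intro: wordval_closed)
  then have "a (fst l) \<otimes> (inv a (fst l) \<otimes> wordval G a v) = wordval G a v"
    "inv a (fst l) \<otimes> (a (fst l) \<otimes> wordval G a v) = wordval G a v"
    by (simp_all flip: m_assoc)
  then show ?thesis using Cons by (simp add: inv_letter_def)
qed auto

lemma (in group) wordval_wmult:
  assumes a: "a \<in> A \<rightarrow> carrier G" and "fst ` set u \<subseteq> A" "fst ` set v \<subseteq> A"
  shows "wordval G a (wmult u v) = wordval G a u \<otimes> wordval G a v"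
  using assms(2)
proof (induction u)
  case Nil
  then show ?case using wordval_closed[OF assms(3) a] by simp
next
  case (Cons l u)
  have 1: "fst ` set (wmult u v) \<subseteq> A" using letters_wmult[of u v] Cons.prems assms(3) by fastforce
  have "a (fst l) \<in> carrier G" "wordval G a u \<in> carrier G" "wordval G a v \<in> carrier G"
    using assms Cons.prems by (auto intro!: wordval_closed[OF _ a])
  moreover have "wordval G a (lmult l (wmult u v)) = wordval G a (l # wmult u v)"
    by (rule wordval_lmult[OF a _ 1]) (use Cons in auto)
  moreover have "wordval G a (wmult u v) = wordval G a u \<otimes> wordval G a v"
    by (rule Cons.IH) (use Cons in auto)
  ultimately show ?case by (simp add: m_assoc)
qed

lemma lookup_map_times: "Poly_Mapping.lookup (Poly_Mapping.map ((*) c) v) x = (c::'k::field) * Poly_Mapping.lookup v x"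
  by (simp add: Poly_Mapping.map.rep_eq when_def)

lemma keys_map_times: "Poly_Mapping.keys (Poly_Mapping.map ((*) (c::'k::field)) v) \<subseteq> Poly_Mapping.keys v"
  by (auto simp: in_keys_iff lookup_map_times)

lemma map_times_single: "Poly_Mapping.map ((*) (c::'k::field)) (Poly_Mapping.single x d) = Poly_Mapping.single x (c * d)"
  by (rule poly_mapping_eqI) (simp add: lookup_map_times lookup_single when_def)

lemma keys_add_subset: "Poly_Mapping.keys u \<subseteq> S \<Longrightarrow> Poly_Mapping.keys v \<subseteq> S \<Longrightarrow> Poly_Mapping.keys (u + v) \<subseteq> S"
  using Poly_Mapping.keys_add[of u v] by blast

lemma module_span_space: "module (field_ring :: 'k::field ring) (span_space S)"
proof (rule moduleI)
  show "cring (field_ring :: 'k ring)" by (rule fieldE(1)[OF field_field_ring])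
  show "abelian_group (span_space S :: ('k, _) module)"
    apply (rule abelian_groupI)
    apply (auto simp: span_space_def algebra_simps intro: keys_add_subset dest: subsetD[OF keys_add_subset])[5]
    subgoal for v by (rule bexI[of _ "- v"]) (auto simp: span_space_def in_keys_iff)
    done
qed (use keys_map_times in \<open>fastforce simp: span_space_def field_ring_def lookup_map_times lookup_add algebra_simps intro!: poly_mapping_eqI\<close>)+

lemma pushforward_superset:
  "finite S \<Longrightarrow> Poly_Mapping.keys v \<subseteq> S \<Longrightarrow>
   pushforward f v = (\<Sum>x\<in>S. Poly_Mapping.single (f x) (Poly_Mapping.lookup v x))"
  unfolding pushforward_def by (rule sum.mono_neutral_left) (auto simp: in_keys_iff)

lemma pushforward_add: "pushforward f (u + v) = pushforward f u + pushforward f v"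
proof -
  let ?S = "Poly_Mapping.keys u \<union> Poly_Mapping.keys v"
  have *: "Poly_Mapping.keys (u + v) \<subseteq> ?S" by (rule Poly_Mapping.keys_add)
  show ?thesis
    by (subst (1 2 3) pushforward_superset[where S = ?S])
       (use * in \<open>auto simp: lookup_add single_add sum.distrib\<close>)
qed

lemma pushforward_zero [simp]: "pushforward f 0 = 0" by (simp add: pushforward_def)

lemma pushforward_single: "pushforward f (Poly_Mapping.single x c) = Poly_Mapping.single (f x) c"
  by (subst pushforward_superset[where S = "{x}"]) auto

lemma pushforward_sum: "pushforward f (sum g I) = (\<Sum>i\<in>I. pushforward f (g i))"
  by (induction I rule: infinite_finite_induct) (auto simp: pushforward_add)

lemma map_times_add: "Poly_Mapping.map ((*) (c::'k::field)) (u + v) = Poly_Mapping.map ((*) c) u + Poly_Mapping.map ((*) c) v"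
  by (rule poly_mapping_eqI) (simp add: lookup_map_times lookup_add algebra_simps)

lemma map_times_zero [simp]: "Poly_Mapping.map ((*) (c::'k::field)) 0 = 0"
  by (rule poly_mapping_eqI) (simp add: lookup_map_times)

lemma map_times_sum: "Poly_Mapping.map ((*) (c::'k::field)) (sum g I) = (\<Sum>i\<in>I. Poly_Mapping.map ((*) c) (g i))"
  by (induction I rule: infinite_finite_induct) (auto simp: map_times_add)

lemma pushforward_scale: "pushforward f (Poly_Mapping.map ((*) (c::'k::field)) v) = Poly_Mapping.map ((*) c) (pushforward f v)"
  by (subst pushforward_superset[OF _ keys_map_times])
     (auto simp: pushforward_def map_times_sum map_times_single lookup_map_times)

lemma pushforward_pushforward: "pushforward f (pushforward g v) = pushforward (\<lambda>x. f (g x)) v"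
  by (simp add: pushforward_def[of g] pushforward_sum pushforward_single) (simp add: pushforward_def)

lemma keys_sum_subset: "(\<And>i. i \<in> I \<Longrightarrow> Poly_Mapping.keys (g i) \<subseteq> S) \<Longrightarrow> Poly_Mapping.keys (sum g I) \<subseteq> S"
  by (induction I rule: infinite_finite_induct) (auto dest: subsetD[OF keys_add_subset])

lemma keys_pushforward: "Poly_Mapping.keys (pushforward f v) \<subseteq> f ` Poly_Mapping.keys v"
  unfolding pushforward_def by (rule keys_sum_subset) auto

lemma pm_decompose: "v = (\<Sum>x\<in>Poly_Mapping.keys v. Poly_Mapping.single x (Poly_Mapping.lookup v x))"
  by (rule poly_mapping_eqI) (auto simp: lookup_sum lookup_single when_def in_keys_iff)

lemma pushforward_cong: "(\<And>x. x \<in> Poly_Mapping.keys v \<Longrightarrow> f x = g x) \<Longrightarrow> pushforward f v = pushforward g v"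
  by (simp add: pushforward_def)

lemma pushforward_id: "(\<And>x. x \<in> Poly_Mapping.keys v \<Longrightarrow> f x = x) \<Longrightarrow> pushforward f v = v"
  by (subst (2) pm_decompose) (simp add: pushforward_def)


lemma free_act_closed:
  assumes "g \<in> carrier (free_grp A)" "Poly_Mapping.keys v \<subseteq> carrier (free_grp A) \<times> B"
  shows "Poly_Mapping.keys (pushforward (\<lambda>(h, y). (wmult g h, y)) v) \<subseteq> carrier (free_grp A) \<times> B"
proof -
  interpret group "free_grp A" by (rule group_free_grp)
  have "wmult g h \<in> carrier (free_grp A)" if "h \<in> carrier (free_grp A)" for h
    using m_closed[OF assms(1) that] by (simp add: free_grp_def)
  then have "(\<lambda>(h, y). (wmult g h, y)) ` (carrier (free_grp A) \<times> B) \<subseteq> carrier (free_grp A) \<times> B"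
    by auto
  then show ?thesis
    by (rule order_trans[OF keys_pushforward order_trans[OF image_mono[OF assms(2)]]])
qed

lemma representation_free_rep: "is_representation (free_rep A B :: ('a word, ('a word \<times> 'b) \<Rightarrow>\<^sub>0 'k, 'k::field) rep)"
proof -
  let ?S = "carrier (free_grp A) \<times> B"
  have 1: "pushforward (\<lambda>(h, y). (wmult g h, y)) \<in> lin_hom (span_space ?S :: ('k, _) module) (span_space ?S)"
    if "g \<in> carrier (free_grp A)" for g
  proof -
    have "pushforward (\<lambda>(h, y). (wmult g h, y)) v \<in> carrier (span_space ?S)"
      if "v \<in> carrier (span_space ?S)" for v :: "('a word \<times> 'b) \<Rightarrow>\<^sub>0 'k"
      using free_act_closed[OF \<open>g \<in> _\<close>, of v B] that by (simp add: span_space_def)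
    then show ?thesis
      by (simp add: lin_hom_def) (simp add: span_space_def pushforward_add pushforward_scale)
  qed
  have 2: "pushforward (\<lambda>(h, y). (wmult [] h, y)) v = v" for v :: "('a word \<times> 'b) \<Rightarrow>\<^sub>0 'k"
    by (rule pushforward_id) auto
  have 3: "pushforward (\<lambda>(h, y). (wmult (wmult g g') h, y)) v =
      pushforward (\<lambda>(h, y). (wmult g h, y)) (pushforward (\<lambda>(h, y). (wmult g' h, y)) v)"
    if "Poly_Mapping.keys v \<subseteq> ?S" for g g' and v :: "('a word \<times> 'b) \<Rightarrow>\<^sub>0 'k"
    unfolding pushforward_pushforward
  proof (rule pushforward_cong)
    fix x assume "x \<in> Poly_Mapping.keys v"
    then have "reduced (fst x)" using that by (auto simp: free_grp_def)
    then show "(case x of (h, y) \<Rightarrow> (wmult (wmult g g') h, y)) =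
       (case case x of (h, y) \<Rightarrow> (wmult g' h, y) of (h, y) \<Rightarrow> (wmult g h, y))"
      by (cases x) (simp add: wmult_assoc)
  qed
  have sel: "grp (free_rep A B :: (_, _, 'k) rep) = free_grp A"
    "lin (free_rep A B :: (_, _, 'k) rep) = span_space ?S"
    "act (free_rep A B :: (_, _, 'k) rep) = (\<lambda>g. pushforward (\<lambda>(h, y). (wmult g h, y)))"
    "\<one>\<^bsub>free_grp A\<^esub> = []" "monoid.mult (free_grp A) = wmult"
    by (simp_all add: free_rep_def free_grp_def)
  have 4: "v \<in> carrier (span_space ?S) \<longleftrightarrow> Poly_Mapping.keys v \<subseteq> ?S" for v :: "('a word \<times> 'b) \<Rightarrow>\<^sub>0 'k"
    by (simp add: span_space_def)
  show ?thesis
    unfolding is_representation_def sel 4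
  proof (intro conjI ballI)
    fix g assume "g \<in> carrier (free_grp A)"
    then show "pushforward (\<lambda>(h, y). (wmult g h, y)) \<in> lin_hom (span_space ?S :: ('k, _) module) (span_space ?S)"
      by (rule 1)
  next
    fix g h and v :: "('a word \<times> 'b) \<Rightarrow>\<^sub>0 'k" assume "v \<in> carrier (span_space ?S)"
    then have "Poly_Mapping.keys v \<subseteq> ?S" by (simp only: 4)
    then show "pushforward (\<lambda>(ha, y). (wmult (wmult g h) ha, y)) v =
        pushforward (\<lambda>(h, y). (wmult g h, y)) (pushforward (\<lambda>(ha, y). (wmult h ha, y)) v)"
      by (rule 3)
  qed (rule group_free_grp module_span_space 2)+
qed

lemma lin_hom_eqI:
  assumes V: "module (field_ring :: 'k::field ring) V"
    and f: "f \<in> lin_hom (span_space S) V" and g: "g \<in> lin_hom (span_space S) V"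
    and eq: "\<And>x. x \<in> S \<Longrightarrow> f (Poly_Mapping.single x 1) = g (Poly_Mapping.single x 1)"
    and v: "v \<in> carrier (span_space S)"
  shows "f v = g v"
proof -
  interpret V: module field_ring V by (rule V)
  note fd = f[unfolded lin_hom_def] g[unfolded lin_hom_def]
  have sg: "f (Poly_Mapping.single x c) = g (Poly_Mapping.single x c)" if "x \<in> S" for x c
  proof -
    have 1: "Poly_Mapping.single x c = c \<odot>\<^bsub>span_space S\<^esub> Poly_Mapping.single x 1"
      by (simp add: span_space_def map_times_single)
    have 2: "Poly_Mapping.single x 1 \<in> carrier (span_space S)"
      using that by (simp add: span_space_def)
    have "f (c \<odot>\<^bsub>span_space S\<^esub> Poly_Mapping.single x 1) = c \<odot>\<^bsub>V\<^esub> f (Poly_Mapping.single x 1)"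
      "g (c \<odot>\<^bsub>span_space S\<^esub> Poly_Mapping.single x 1) = c \<odot>\<^bsub>V\<^esub> g (Poly_Mapping.single x 1)"
      using fd 2 by blast+
    then show ?thesis unfolding 1 eq[OF that] by simp
  qed
  have z: "f 0 = \<zero>\<^bsub>V\<^esub>" if "f \<in> lin_hom (span_space S) V" for f
  proof -
    have "f (0 + 0) = f 0 \<oplus>\<^bsub>V\<^esub> f 0" "f 0 \<in> carrier V"
      using that unfolding lin_hom_def span_space_def
       by (simp del: add_0 add_0_right add.right_neutral, auto simp: Pi_iff)
    then show ?thesis by (metis V.add.l_cancel_one add_0)
  qed
  have "f (\<Sum>x\<in>I. Poly_Mapping.single x (Poly_Mapping.lookup v x)) = g (\<Sum>x\<in>I. Poly_Mapping.single x (Poly_Mapping.lookup v x))"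
    if "finite I" "I \<subseteq> S" for I
    using that
  proof induction
    case empty
    then show ?case by (simp add: z f g)
  next
    case (insert x I)
    let ?s = "\<Sum>x\<in>I. Poly_Mapping.single x (Poly_Mapping.lookup v x)"
    let ?t = "Poly_Mapping.single x (Poly_Mapping.lookup v x)"
    have c: "?t \<in> carrier (span_space S)" "?s \<in> carrier (span_space S)"
      using insert by (auto simp: span_space_def intro!: keys_sum_subset split: if_splits)
    have add: "h (u + w) = h u \<oplus>\<^bsub>V\<^esub> h w" if "h \<in> lin_hom (span_space S) V"
      "u \<in> carrier (span_space S)" "w \<in> carrier (span_space S)"
      for h and u w :: "_ \<Rightarrow>\<^sub>0 'k"
      using that by (auto simp: lin_hom_def span_space_def)
    have "f ?s = g ?s" using insert.IH insert.prems by blast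
    moreover have "f ?t = g ?t" by (rule sg) (use insert.prems in blast)
    ultimately have "f (?t + ?s) = g (?t + ?s)" by (simp only: add[OF f c] add[OF g c])
    then show ?case unfolding sum.insert[OF insert(1,2)] .
  qed
  from this[of "Poly_Mapping.keys v"] v show ?thesis
    unfolding pm_decompose[of v, symmetric] by (simp add: span_space_def)
qed

lemma lin_hom_extend:
  assumes V: "module (field_ring :: 'k::field ring) V" and c: "c \<in> (S :: 'b set) \<rightarrow> carrier V"
  obtains f where "f \<in> lin_hom (span_space S) V" "\<And>x. x \<in> S \<Longrightarrow> f (Poly_Mapping.single x 1) = c x"
proof -
  interpret V: module field_ring V by (rule V)
  have K [simp]: "carrier field_ring = UNIV" by (simp add: field_ring_def)
  have smc: "a \<odot>\<^bsub>V\<^esub> x \<in> carrier V" if "x \<in> carrier V" for a x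
    using V.smult_closed[of a x] that by simp
  have cS: "c x \<in> carrier V" if "x \<in> S" for x using c that by auto
  define f where "f v = (\<Oplus>\<^bsub>V\<^esub>x\<in>Poly_Mapping.keys v. Poly_Mapping.lookup v x \<odot>\<^bsub>V\<^esub> c x)" for v
  have sup: "f v = (\<Oplus>\<^bsub>V\<^esub>x\<in>T. Poly_Mapping.lookup v x \<odot>\<^bsub>V\<^esub> c x)"
    if "finite T" "Poly_Mapping.keys v \<subseteq> T" "T \<subseteq> S" for v T
  proof -
    have "Poly_Mapping.lookup v x \<odot>\<^bsub>V\<^esub> c x = \<zero>\<^bsub>V\<^esub>" if "x \<in> T - Poly_Mapping.keys v" for x
      using V.smult_l_null[of "c x"] c that \<open>T \<subseteq> S\<close> by (auto simp: field_ring_def in_keys_iff)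
    then show ?thesis unfolding f_def
      by (intro V.add.finprod_mono_neutral_cong_left) (use c that in \<open>auto simp: Pi_iff subset_iff intro!: smc\<close>)
  qed
  have smult_l: "(a + b) \<odot>\<^bsub>V\<^esub> x = a \<odot>\<^bsub>V\<^esub> x \<oplus>\<^bsub>V\<^esub> b \<odot>\<^bsub>V\<^esub> x"
    "(a * b) \<odot>\<^bsub>V\<^esub> x = a \<odot>\<^bsub>V\<^esub> (b \<odot>\<^bsub>V\<^esub> x)" "1 \<odot>\<^bsub>V\<^esub> x = x"
    if "x \<in> carrier V" for a b x
    using V.smult_l_distr[of a b x] V.smult_assoc1[of a b x] V.smult_one[of x] that
    by (auto simp: field_ring_def)
  have "f \<in> lin_hom (span_space S) V"
    unfolding lin_hom_def
  proof (intro CollectI conjI ballI allI)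
    show "f \<in> carrier (span_space S) \<rightarrow> carrier V"
      using c by (auto simp: f_def span_space_def Pi_iff subset_iff intro!: V.finsum_closed smc)
  next
    fix u v :: "'b \<Rightarrow>\<^sub>0 'k" assume uv: "u \<in> carrier (span_space S)" "v \<in> carrier (span_space S)"
    let ?T = "Poly_Mapping.keys u \<union> Poly_Mapping.keys v"
    have T: "finite ?T" "?T \<subseteq> S" using uv by (auto simp: span_space_def)
    show "f (u \<oplus>\<^bsub>span_space S\<^esub> v) = f u \<oplus>\<^bsub>V\<^esub> f v"
    proof -
      have cl: "(\<lambda>x. Poly_Mapping.lookup w x \<odot>\<^bsub>V\<^esub> c x) \<in> ?T \<rightarrow> carrier V" for w
        using T(2) c by (auto intro!: smc)
      have "f (u + v) = (\<Oplus>\<^bsub>V\<^esub>x\<in>?T. Poly_Mapping.lookup u x \<odot>\<^bsub>V\<^esub> c x \<oplus>\<^bsub>V\<^esub> Poly_Mapping.lookup v x \<odot>\<^bsub>V\<^esub> c x)"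
        unfolding sup[OF T(1) Poly_Mapping.keys_add T(2)]
        by (intro V.finsum_cong' funcsetI V.add.m_closed refl)
          (use T(2) in \<open>auto simp: lookup_add smult_l(1)[OF cS] subset_iff intro!: smc cS\<close>)
      also have "\<dots> = f u \<oplus>\<^bsub>V\<^esub> f v"
        unfolding V.finsum_addf[OF cl cl]
        using sup[OF T(1) _ T(2), of u] sup[OF T(1) _ T(2), of v] by simp
      finally show ?thesis by (simp add: span_space_def)
    qed
  next
    fix a and v :: "'b \<Rightarrow>\<^sub>0 'k" assume v: "v \<in> carrier (span_space S)"
    let ?T = "Poly_Mapping.keys v"
    have T: "finite ?T" "?T \<subseteq> S" using v by (auto simp: span_space_def)
    show "f (a \<odot>\<^bsub>span_space S\<^esub> v) = a \<odot>\<^bsub>V\<^esub> f v"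
    proof -
      have cl: "(\<lambda>x. Poly_Mapping.lookup v x \<odot>\<^bsub>V\<^esub> c x) \<in> ?T \<rightarrow> carrier V"
        using T(2) c by (auto intro!: smc)
      have "f (Poly_Mapping.map ((*) a) v) = (\<Oplus>\<^bsub>V\<^esub>x\<in>?T. a \<odot>\<^bsub>V\<^esub> (Poly_Mapping.lookup v x \<odot>\<^bsub>V\<^esub> c x))"
        unfolding sup[OF T(1) keys_map_times T(2)]
        by (intro V.finsum_cong' smc funcsetI refl)
          (use T(2) in \<open>auto simp: lookup_map_times smult_l(2)[OF cS] subset_iff intro!: cS\<close>)
      also have "\<dots> = a \<odot>\<^bsub>V\<^esub> f v"
        unfolding f_def by (rule V.finsum_smult_ldistr[symmetric]) (use T cl in auto)
      finally show ?thesis by (simp add: span_space_def)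
    qed
  qed
  moreover have "f (Poly_Mapping.single x 1) = c x" if "x \<in> S" for x
    using c that by (auto simp: f_def Pi_iff smult_l)
  ultimately show thesis by (rule that)
qed

lemma lin_hom_comp: "f \<in> lin_hom U V \<Longrightarrow> g \<in> lin_hom V W \<Longrightarrow> (\<lambda>x. g (f x)) \<in> lin_hom U W"
  by (auto simp: lin_hom_def Pi_iff)

lemma lin_hom_restrict:
  assumes "module (field_ring :: 'k::field ring) U"
  shows "restrict f (carrier U) \<in> lin_hom U V \<longleftrightarrow> f \<in> lin_hom U V"
proof -
  interpret U: module field_ring U by (rule assms)
  have "c \<odot>\<^bsub>U\<^esub> u \<in> carrier U" if "u \<in> carrier U" for c u
    using U.smult_closed that by (simp add: field_ring_def)
  then show ?thesis by (auto simp: lin_hom_def Pi_iff)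
qed

lemma wordval_unique:
  assumes H: "group H" and f: "f \<in> hom (free_grp A) H" and w: "w \<in> carrier (free_grp A)"
    and a: "\<And>x. x \<in> A \<Longrightarrow> f [(x, True)] = a x"
  shows "f w = wordval H a w"
  using w
proof (induction w)
  interpret F: group "free_grp A" by (rule group_free_grp)
  interpret H: group H by (rule H)
  interpret f: group_hom "free_grp A" H f using f by unfold_locales
  {
    case Nil
    show ?case using f.hom_one by (simp add: free_grp_def)
  next
    case (Cons l w)
    have l: "[l] \<in> carrier (free_grp A)" and w: "w \<in> carrier (free_grp A)" and lA: "fst l \<in> A"
      using Cons(2) by (auto simp: free_grp_def reduced_Cons)
    have t: "[(fst l, True)] \<in> carrier (free_grp A)" using lA by (auto simp: free_grp_def reduced_Cons)
    have "l # w = [l] \<otimes>\<^bsub>free_grp A\<^esub> w"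
      using Cons(2) by (auto simp: free_grp_def lmult_reduced)
    then have 1: "f (l # w) = f [l] \<otimes>\<^bsub>H\<^esub> wordval H a w" using l w Cons(1) by simp
    have "f [l] = (if snd l then a (fst l) else inv\<^bsub>H\<^esub> a (fst l))"
    proof (cases "snd l")
      case True
      then show ?thesis using a[OF lA] by (metis prod.collapse)
    next
      case False
      have "[l] \<otimes>\<^bsub>free_grp A\<^esub> [(fst l, True)] = \<one>\<^bsub>free_grp A\<^esub>"
        using False by (auto simp: free_grp_def inv_letter_def)
      then have "inv\<^bsub>free_grp A\<^esub> [(fst l, True)] = [l]" by (rule F.inv_equality) (use l t in auto)
      then show ?thesis using f.hom_inv[OF t] a[OF lA] False by simp
    qed
    then show ?case using 1 by simp
  }
qed

theorem free_rep_universal: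
  fixes H :: "('g, 'v, 'k::field) rep"
  assumes H: "is_representation H"
    and a: "a \<in> A \<rightarrow> carrier (grp H)" and b: "b \<in> B \<rightarrow> carrier (lin H)"
  shows "\<exists>!h. h \<in> rep_hom (free_rep A B) H \<and> (\<forall>x\<in>A. fst h [(x, True)] = a x) \<and>
    (\<forall>y\<in>B. snd h (Poly_Mapping.single ([], y) 1) = b y)"
proof -
  let ?F = "free_rep A B :: ('a word, ('a word \<times> 'b) \<Rightarrow>\<^sub>0 'k, 'k) rep"
  let ?G = "carrier (free_grp A)" and ?S = "carrier (free_grp A) \<times> B"
  let ?U = "span_space ?S :: ('k, _) module"
  have sel: "grp ?F = free_grp A" "lin ?F = ?U" by (simp_all add: free_rep_def)
  have gH: "group (grp H)" and mH: "module field_ring (lin H)"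
    and lH: "\<And>g. g \<in> carrier (grp H) \<Longrightarrow> act H g \<in> lin_hom (lin H) (lin H)"
    and oneH: "\<And>v. v \<in> carrier (lin H) \<Longrightarrow> act H \<one>\<^bsub>grp H\<^esub> v = v"
    and multH: "\<And>g h v. g \<in> carrier (grp H) \<Longrightarrow> h \<in> carrier (grp H) \<Longrightarrow> v \<in> carrier (lin H) \<Longrightarrow>
        act H (g \<otimes>\<^bsub>grp H\<^esub> h) v = act H g (act H h v)"
    using H by (auto simp: is_representation_def)
  interpret G: group "grp H" by (rule gH)
  interpret F: group "free_grp A" by (rule group_free_grp)
  have lF: "act ?F g \<in> lin_hom ?U ?U" if "g \<in> ?G" for g
    using representation_free_rep[of A B, where 'k = 'k, unfolded is_representation_def sel] that by blast
  have mult: "wmult g h \<in> ?G" if "g \<in> ?G" "h \<in> ?G" for g h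
    using F.m_closed[OF that] by (simp add: free_grp_def)
  have act_single: "act ?F g (Poly_Mapping.single (h, y) 1) = Poly_Mapping.single (wmult g h, y) 1" for g h y
    by (simp add: free_rep_def pushforward_single)
  have base: "Poly_Mapping.single x 1 \<in> carrier ?U" if "x \<in> ?S" for x
    using that by (simp add: span_space_def)
  have nil: "[] \<in> ?G" using F.one_closed by (simp add: free_grp_def)
  define \<phi> where "\<phi> = restrict (wordval (grp H) a) ?G"
  have \<phi>in: "\<phi> g \<in> carrier (grp H)" if "g \<in> ?G" for g
    using that G.wordval_closed[OF _ a] by (auto simp: \<phi>_def free_grp_def)
  have \<phi>m: "\<phi> (wmult g h) = \<phi> g \<otimes>\<^bsub>grp H\<^esub> \<phi> h" if "g \<in> ?G" "h \<in> ?G" for g h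
    using that mult[OF that] G.wordval_wmult[OF a] by (auto simp: \<phi>_def free_grp_def)
  have \<phi>: "\<phi> \<in> hom (free_grp A) (grp H)"
    using \<phi>in \<phi>m by (auto simp: hom_def free_grp_def)
  have \<phi>a: "\<phi> [(x, True)] = a x" if "x \<in> A" for x
    using that funcset_mem[OF a that] by (auto simp: \<phi>_def free_grp_def reduced_Cons)
  have \<phi>1: "\<phi> [] = \<one>\<^bsub>grp H\<^esub>" using nil by (simp add: \<phi>_def)
  define c where "c = (\<lambda>(h, y). act H (\<phi> h) (b y))"
  have cin: "c \<in> ?S \<rightarrow> carrier (lin H)"
    using lH[OF \<phi>in] b by (auto simp: c_def lin_hom_def Pi_iff)
  obtain f where f: "f \<in> lin_hom ?U (lin H)" "\<And>x. x \<in> ?S \<Longrightarrow> f (Poly_Mapping.single x 1) = c x"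
    using lin_hom_extend[OF mH cin] by blast
  define \<psi> where "\<psi> = restrict f (carrier ?U)"
  have \<psi>: "\<psi> \<in> lin_hom ?U (lin H)"
    unfolding \<psi>_def lin_hom_restrict[OF module_span_space] by (rule f)
  have \<psi>x: "\<psi> (Poly_Mapping.single x 1) = c x" if "x \<in> ?S" for x
    using that f(2) base by (simp add: \<psi>_def)
  have compat: "\<psi> (act ?F g v) = act H (\<phi> g) (\<psi> v)" if g: "g \<in> ?G" and v: "v \<in> carrier ?U" for g v
  proof (rule lin_hom_eqI[OF mH _ _ _ v, where f = "\<lambda>v. \<psi> (act ?F g v)" and g = "\<lambda>v. act H (\<phi> g) (\<psi> v)"])
    show "(\<lambda>v. \<psi> (act ?F g v)) \<in> lin_hom ?U (lin H)" by (rule lin_hom_comp[OF lF[OF g] \<psi>])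
    show "(\<lambda>v. act H (\<phi> g) (\<psi> v)) \<in> lin_hom ?U (lin H)" by (rule lin_hom_comp[OF \<psi> lH[OF \<phi>in[OF g]]])
    fix x assume x: "x \<in> ?S"
    then obtain h y where hy: "x = (h, y)" "h \<in> ?G" "y \<in> B" by auto
    show "\<psi> (act ?F g (Poly_Mapping.single x 1)) = act H (\<phi> g) (\<psi> (Poly_Mapping.single x 1))"
      using hy g x mult[OF g hy(2)] multH[OF \<phi>in[OF g] \<phi>in[OF hy(2)]] b
      by (auto simp: act_single \<psi>x c_def \<phi>m)
  qed
  show ?thesis
  proof (rule ex1I[of _ "(\<phi>, \<psi>)"], intro conjI ballI)
    show "(\<phi>, \<psi>) \<in> rep_hom ?F H"
      using \<phi> \<psi> compat unfolding rep_hom_def sel by (auto simp: \<phi>_def \<psi>_def)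
    show "fst (\<phi>, \<psi>) [(x, True)] = a x" if "x \<in> A" for x using that \<phi>a by simp
    show "snd (\<phi>, \<psi>) (Poly_Mapping.single ([], y) 1) = b y" if "y \<in> B" for y
      using that nil \<psi>x[of "([], y)"] funcset_mem[OF b that] by (auto simp: c_def \<phi>1 oneH)
  next
    fix h assume h: "h \<in> rep_hom ?F H \<and> (\<forall>x\<in>A. fst h [(x, True)] = a x) \<and>
      (\<forall>y\<in>B. snd h (Poly_Mapping.single ([], y) 1) = b y)"
    obtain \<phi>' \<psi>' where hh: "h = (\<phi>', \<psi>')" by (cases h)
    have \<phi>': "\<phi>' \<in> hom (free_grp A) (grp H)" "\<phi>' \<in> extensional ?G"
      and \<psi>': "\<psi>' \<in> lin_hom ?U (lin H)" "\<psi>' \<in> extensional (carrier ?U)"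
      and c': "\<And>g v. g \<in> ?G \<Longrightarrow> v \<in> carrier ?U \<Longrightarrow> \<psi>' (act ?F g v) = act H (\<phi>' g) (\<psi>' v)"
      and a': "\<And>x. x \<in> A \<Longrightarrow> \<phi>' [(x, True)] = a x"
      and b': "\<And>y. y \<in> B \<Longrightarrow> \<psi>' (Poly_Mapping.single ([], y) 1) = b y"
      using h unfolding hh rep_hom_def sel by auto
    have p: "\<phi>' = \<phi>"
      by (rule extensionalityI[OF \<phi>'(2)])
        (auto simp: \<phi>_def wordval_unique[OF gH \<phi>'(1) _ a'])
    have "\<psi>' v = \<psi> v" if v: "v \<in> carrier ?U" for v
    proof (rule lin_hom_eqI[OF mH \<psi>'(1) \<psi> _ v])
      fix x assume x: "x \<in> ?S"
      then obtain h y where hy: "x = (h, y)" "h \<in> ?G" "y \<in> B" by auto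
      have "act ?F h (Poly_Mapping.single ([], y) 1) = Poly_Mapping.single x 1"
        using hy by (simp add: act_single free_grp_def wmult_Nil2)
      then show "\<psi>' (Poly_Mapping.single x 1) = \<psi> (Poly_Mapping.single x 1)"
        using c'[OF hy(2) base[of "([], y)"]] hy nil b'[OF hy(3)] \<psi>x[OF x] by (auto simp: p c_def)
    qed
    then have "\<psi>' = \<psi>"
      by (intro extensionalityI[OF \<psi>'(2)]) (auto simp: \<psi>_def)
    then show "h = (\<phi>, \<psi>)" using hh p by simp
  qed
qed

lemma rep_hom_id: 
  assumes "is_representation H"
  shows "(\<lambda>g\<in>carrier (grp H). g, \<lambda>v\<in>carrier (lin H). v) \<in> rep_hom H H"
proof -
  interpret group "grp H" using assms by (simp add: is_representation_def)
  have m: "module field_ring (lin H)" using assms by (simp add: is_representation_def)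
  have "(\<lambda>v. v) \<in> lin_hom (lin H) (lin H)" by (simp add: lin_hom_def)
  then have "(\<lambda>v\<in>carrier (lin H). v) \<in> lin_hom (lin H) (lin H)" by (simp add: lin_hom_restrict[OF m])
  moreover have "act H g v \<in> carrier (lin H)" if "g \<in> carrier (grp H)" "v \<in> carrier (lin H)" for g v
    using assms that by (auto simp: is_representation_def lin_hom_def)
  ultimately show ?thesis by (auto simp: rep_hom_def hom_def)
qed

lemma rep_hom_compose:
  assumes H: "is_representation H" and f: "(\<phi>, \<psi>) \<in> rep_hom H H'" and g: "(\<phi>', \<psi>') \<in> rep_hom H' H''"
  shows "(compose (carrier (grp H)) \<phi>' \<phi>, compose (carrier (lin H)) \<psi>' \<psi>) \<in> rep_hom H H''"
proof -
  interpret group "grp H" using H by (simp add: is_representation_def)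
  have m: "module field_ring (lin H)" using H by (simp add: is_representation_def)
  have "(\<lambda>v. \<psi>' (\<psi> v)) \<in> lin_hom (lin H) (lin H'')" using f g by (auto simp: rep_hom_def intro: lin_hom_comp)
  then have "compose (carrier (lin H)) \<psi>' \<psi> \<in> lin_hom (lin H) (lin H'')"
    by (simp add: compose_def lin_hom_restrict[OF m])
  moreover have "act H g v \<in> carrier (lin H)" if "g \<in> carrier (grp H)" "v \<in> carrier (lin H)" for g v
    using H that by (auto simp: is_representation_def lin_hom_def)
  moreover have "\<psi> v \<in> carrier (lin H')" if "v \<in> carrier (lin H)" for v
    using f that by (auto simp: rep_hom_def lin_hom_def)
  ultimately show ?thesis using f g by (auto simp: rep_hom_def hom_def compose_eq Pi_iff)
qed

theorem category_Theta0: "is_category (Theta0 TYPE('k::field))"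
proof -
  have rep: "is_representation H" if "H \<in> Theta0_objects" for H :: "'k frep"
    using that by (auto simp: Theta0_objects_def representation_free_rep)
  have fs: "\<phi> \<in> carrier (grp H) \<rightarrow> carrier (grp H')" "\<psi> \<in> carrier (lin H) \<rightarrow> carrier (lin H')"
    "\<phi> \<in> extensional (carrier (grp H))" "\<psi> \<in> extensional (carrier (lin H))"
    if "(\<phi>, \<psi>) \<in> rep_hom H H'" for \<phi> \<psi> and H H' :: "'k frep"
    using that by (auto simp: rep_hom_def hom_def lin_hom_def)
  let ?C = "Theta0 TYPE('k)"
  have Arr: "f \<in> Arr ?C \<longleftrightarrow> (\<exists>H H' \<phi> \<psi>. f = (H, H', \<phi>, \<psi>) \<and>
      H \<in> Theta0_objects \<and> H' \<in> Theta0_objects \<and> (\<phi>, \<psi>) \<in> rep_hom H H')" for f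
    by (auto simp: Theta0_def)
  have sel: "Ob ?C = Theta0_objects" "Dom ?C (H, h) = H" "Cod ?C (H, H', k) = H'"
    "Id ?C H = (H, H, (\<lambda>g\<in>carrier (grp H). g), (\<lambda>v\<in>carrier (lin H). v))"
    "Comp ?C (H1, H2, \<phi>', \<psi>') (H, H', \<phi>, \<psi>) =
       (H, H2, compose (carrier (grp H)) \<phi>' \<phi>, compose (carrier (lin H)) \<psi>' \<psi>)"
    for H H' H1 H2 h k \<phi>' \<psi>' \<phi> \<psi>
    by (simp_all add: Theta0_def)
  show ?thesis
    unfolding is_category_def
  proof (intro conjI ballI impI)
    fix f assume "f \<in> Arr ?C"
    then obtain H H' \<phi> \<psi> where f: "f = (H, H', \<phi>, \<psi>)"
      "H \<in> Theta0_objects" "H' \<in> Theta0_objects" "(\<phi>, \<psi>) \<in> rep_hom H H'"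
      unfolding Arr by blast
    note fs = fs[OF f(4)]
    show "Dom ?C f \<in> Ob ?C" "Cod ?C f \<in> Ob ?C" using f by (simp_all add: sel)
    show "Comp ?C f (Id ?C (Dom ?C f)) = f" "Comp ?C (Id ?C (Cod ?C f)) f = f"
      using fs unfolding f(1) sel by (simp_all add: compose_Id Id_compose)
    fix g assume "g \<in> Arr ?C" and fg: "Cod ?C f = Dom ?C g"
    then obtain H'' \<phi>' \<psi>' where g: "g = (H', H'', \<phi>', \<psi>')"
      "H'' \<in> Theta0_objects" "(\<phi>', \<psi>') \<in> rep_hom H' H''"
      unfolding Arr f(1) by (auto simp: sel)
    show "Comp ?C g f \<in> Arr ?C"
      using rep_hom_compose[OF rep[OF f(2)] f(4) g(3)] f g unfolding Arr by (simp add: sel)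
    show "Dom ?C (Comp ?C g f) = Dom ?C f" "Cod ?C (Comp ?C g f) = Cod ?C g"
      using f g by (simp_all add: sel)
  next
    fix f g h assume *: "f \<in> Arr ?C" "g \<in> Arr ?C" "h \<in> Arr ?C"
      "Cod ?C f = Dom ?C g \<and> Cod ?C g = Dom ?C h"
    obtain H H' \<phi> \<psi> where f: "f = (H, H', \<phi>, \<psi>)" "(\<phi>, \<psi>) \<in> rep_hom H H'"
      using *(1) unfolding Arr by blast
    obtain H'' \<phi>' \<psi>' where g: "g = (H', H'', \<phi>', \<psi>')"
      using *(2,4) unfolding Arr f(1) by (auto simp: sel)
    obtain H3 \<phi>'' \<psi>'' where h: "h = (H'', H3, \<phi>'', \<psi>'')"
      using *(3,4) unfolding Arr g(1) by (auto simp: sel)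
    show "Comp ?C h (Comp ?C g f) = Comp ?C (Comp ?C h g) f"
      unfolding f g h sel using fs[OF f(2)] by (auto simp: compose_def Pi_iff fun_eq_iff)
  next
    fix A assume A: "A \<in> Ob ?C"
    show "Id ?C A \<in> Arr ?C"
      using A rep_hom_id[OF rep] unfolding Arr sel by blast
    show "Dom ?C (Id ?C A) = A" "Cod ?C (Id ?C A) = A" by (simp_all add: sel)
  qed
qed

end

theory Submission
  imports Defs
begin

text \<open>An automorphism \<open>\<Phi>\<close> of the category preserves \<open>P = F({x}, {})\<close> and \<open>Q = F({}, {y})\<close> up to isomorphism:
  up to isomorphism \<open>Q\<close> is the only nonzero object all of whose endomorphisms are zero or invertible, and \<open>P\<close>
  is the only nonzero object with commuting endomorphisms that receives no nonzero map from \<open>Q\<close>.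
  Since \<open>P\<close> and \<open>Q\<close> represent the two sorts, \<open>\<Phi>\<close> induces natural
  bijections \<open>s : H\<^sup>1 \<rightarrow> (\<Phi>H)\<^sup>1\<close> and \<open>t : H\<^sup>2 \<rightarrow> (\<Phi>H)\<^sup>2\<close>, and by the Yoneda argument the operations transported
  along them are given by elements of free representations.  For addition and scalars this makes \<open>t\<close>
  semilinear with respect to some field automorphism.  The action becomes \<open>t (g v) = u(s g) t v\<close> with \<open>u\<close> in the
  group algebra of an infinite cyclic group; comparing the supports in \<open>u(w) = u(x\<^sub>0) u(x\<^sub>1)\<close>, where \<open>w\<close>
  expresses the transported product, shows that \<open>u\<close> is a single word \<open>r\<close>.  Then \<open>g \<mapsto> r(s g)\<close> is an
  isomorphism of groups and, with \<open>t\<close>, a semilinear natural isomorphism \<open>H \<cong> \<Phi>H\<close>.  So \<open>\<Phi>\<close> is inner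
  iff its field automorphism is trivial, and every field automorphism occurs by twisting coefficients.\<close>

section \<open>Automorphism groups\<close>

text \<open>Two obstacles shape the argument. First, \<open>s\<close> need not respect
  multiplication: take isomorphisms that invert the generator of \<open>PP\<close> and are
  identities on all other objects. The inner automorphism they define makes \<open>s H\<close> the
  inversion for every \<open>H\<close> other than \<open>PP\<close>, and inversion reverses
  products. Instead of classifying the group operations that could arise, the proof lets the action
  decide: distinct words give linearly independent vectors in a free module, so (gh)v = g(hv) forces
  a single word \<open>r\<close>, and composing \<open>s\<close> with it repairs the multiplication.
  Second, \<open>F H\<close> is an unknown object. Since \<open>F\<close> is onto, every standard
  free object is \<open>F K\<close> for some \<open>K\<close>. Its free generators are pulled back
  to \<open>K\<close>, identities are read off in \<open>F K\<close>, and homomorphisms out of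
  \<open>F K\<close> spread them to every \<open>F H\<close>. The field automorphism is finally read
  off from the scalar endomorphisms of the objects, which makes it independent of all choices and
  visibly multiplicative in the category automorphism.\<close>

lemma carrier_BijGroup: "carrier (BijGroup S) = Bij S"
  by (simp add: BijGroup_def)

lemma mult_BijGroup: "f \<in> Bij S \<Longrightarrow> g \<in> Bij S \<Longrightarrow> f \<otimes>\<^bsub>BijGroup S\<^esub> g = compose S f g"
  by (simp add: BijGroup_def)

text \<open>The automorphisms lie in a product of two permutation groups, so only closure is at
  stake. The inverse of a functor that is bijective on objects and arrows is a functor because each
  law can be tested after applying \<open>F\<close> or \<open>\<Phi>\<close>.\<close>

lemma group_Cat_Auto:
  assumes C: "is_category C"
  shows "group (Cat_Auto C)"
proof -
  let ?G = "BijGroup (Ob C) \<times>\<times> BijGroup (Arr C)"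
  interpret G: group ?G by (intro DirProd_group group_BijGroup)
  have arr: "Dom C f \<in> Ob C" "Cod C f \<in> Ob C" if "f \<in> Arr C" for f
    using C that by (auto simp: is_category_def)
  have ide: "Id C A \<in> Arr C" "Dom C (Id C A) = A" "Cod C (Id C A) = A" if "A \<in> Ob C" for A
    using C that by (auto simp: is_category_def)
  have comp: "Comp C g f \<in> Arr C" "Dom C (Comp C g f) = Dom C f" "Cod C (Comp C g f) = Cod C g"
    if "f \<in> Arr C" "g \<in> Arr C" "Cod C f = Dom C g" for f g
    using C that by (auto simp: is_category_def)
  have "subgroup (cat_auto C) ?G"
  proof (rule G.subgroupI)
    show "cat_auto C \<subseteq> carrier ?G"
      by (auto simp: cat_auto_def BijGroup_def)
    have "((\<lambda>x\<in>Ob C. x), (\<lambda>x\<in>Arr C. x)) \<in> cat_auto C"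
      using arr ide comp by (auto simp: cat_auto_def id_Bij)
    then show "cat_auto C \<noteq> {}" by blast
  next
    fix a assume "a \<in> cat_auto C"
    then obtain F \<Phi> where a: "a = (F, \<Phi>)" "F \<in> Bij (Ob C)" "\<Phi> \<in> Bij (Arr C)"
      and dc: "\<And>f. f \<in> Arr C \<Longrightarrow> Dom C (\<Phi> f) = F (Dom C f) \<and> Cod C (\<Phi> f) = F (Cod C f)"
      and id: "\<And>A. A \<in> Ob C \<Longrightarrow> \<Phi> (Id C A) = Id C (F A)"
      and cm: "\<And>f g. f \<in> Arr C \<Longrightarrow> g \<in> Arr C \<Longrightarrow> Cod C f = Dom C g \<Longrightarrow>
        \<Phi> (Comp C g f) = Comp C (\<Phi> g) (\<Phi> f)"
      by (auto simp: cat_auto_def)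
    let ?F = "inv_into (Ob C) F" and ?P = "inv_into (Arr C) \<Phi>"
    have inv: "inv\<^bsub>?G\<^esub> a = (restrict ?F (Ob C), restrict ?P (Arr C))"
      using a by (simp add: carrier_BijGroup group_BijGroup inv_BijGroup)
    have bF: "bij_betw F (Ob C) (Ob C)" and bP: "bij_betw \<Phi> (Arr C) (Arr C)"
      using a by (auto simp: Bij_def)
    have Fi: "F (?F A) = A" "?F A \<in> Ob C" if "A \<in> Ob C" for A
      using bF that by (auto simp: bij_betw_inv_into_right bij_betw_def inv_into_into)
    have Pi: "\<Phi> (?P f) = f" "?P f \<in> Arr C" if "f \<in> Arr C" for f
      using bP that by (auto simp: bij_betw_inv_into_right bij_betw_def inv_into_into)
    have Fl: "?F A = B" if "B \<in> Ob C" "A = F B" for A B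
      using bij_betw_inv_into_left[OF bF that(1)] that by simp
    have Pl: "?P f = g" if "g \<in> Arr C" "f = \<Phi> g" for f g
      using bij_betw_inv_into_left[OF bP that(1)] that by simp
    have dci: "Dom C (?P f) = ?F (Dom C f)" "Cod C (?P f) = ?F (Cod C f)" if "f \<in> Arr C" for f
      using dc[OF Pi(2)[OF that]] Pi[OF that] arr that by (auto intro!: Fl[symmetric])
    have idi: "?P (Id C A) = Id C (?F A)" if "A \<in> Ob C" for A
      by (rule Pl) (use that Fi ide id in auto)
    have cmi: "?P (Comp C g f) = Comp C (?P g) (?P f)"
      if "f \<in> Arr C" "g \<in> Arr C" "Cod C f = Dom C g" for f g
      by (rule Pl) (use that Pi comp cm dci in auto)
    show "inv\<^bsub>?G\<^esub> a \<in> cat_auto C"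
      unfolding inv using a restrict_inv_into_Bij[of F "Ob C"] restrict_inv_into_Bij[of \<Phi> "Arr C"]
      by (auto simp: cat_auto_def dci idi cmi arr ide comp Pi)
  next
    fix a b assume "a \<in> cat_auto C" "b \<in> cat_auto C"
    then obtain F \<Phi> F' \<Phi>' where a: "a = (F, \<Phi>)" "(F, \<Phi>) \<in> cat_auto C"
      and b: "b = (F', \<Phi>')" "(F', \<Phi>') \<in> cat_auto C"
      by (metis surj_pair)
    have B: "F \<in> Bij (Ob C)" "\<Phi> \<in> Bij (Arr C)" "F' \<in> Bij (Ob C)" "\<Phi>' \<in> Bij (Arr C)"
      using a b by (auto simp: cat_auto_def)
    have m: "a \<otimes>\<^bsub>?G\<^esub> b = (compose (Ob C) F F', compose (Arr C) \<Phi> \<Phi>')"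
      using a b B by (simp add: BijGroup_def)
    show "a \<otimes>\<^bsub>?G\<^esub> b \<in> cat_auto C"
      unfolding m using a b compose_Bij[OF B(1,3)] compose_Bij[OF B(2,4)] Bij_imp_funcset[OF B(4)] Bij_imp_funcset[OF B(3)]
      by (auto simp: cat_auto_def compose_eq arr ide comp Pi_iff)
  qed
  then show ?thesis unfolding Cat_Auto_def by (rule G.subgroup_imp_group)
qed

lemma group_Ring_Auto:
  assumes "ring R"
  shows "group (Ring_Auto R)"
proof -
  interpret R: ring R by fact
  interpret G: group "BijGroup (carrier R)" by (rule group_BijGroup)
  have "subgroup (ring_hom R R \<inter> Bij (carrier R)) (BijGroup (carrier R))"
  proof (rule G.subgroupI)
    show "ring_hom R R \<inter> Bij (carrier R) \<subseteq> carrier (BijGroup (carrier R))"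
      by (auto simp: BijGroup_def)
    have "(\<lambda>x\<in>carrier R. x) \<in> ring_hom R R \<inter> Bij (carrier R)"
      by (auto simp: ring_hom_def id_Bij)
    then show "ring_hom R R \<inter> Bij (carrier R) \<noteq> {}" by blast
  next
    fix f assume f: "f \<in> ring_hom R R \<inter> Bij (carrier R)"
    then have b: "bij_betw f (carrier R) (carrier R)" by (auto simp: Bij_def)
    let ?f = "inv_into (carrier R) f"
    have i: "f (?f x) = x" "?f x \<in> carrier R" if "x \<in> carrier R" for x
      using b that by (auto simp: bij_betw_inv_into_right bij_betw_def inv_into_into)
    have l: "?f x = y" if "y \<in> carrier R" "x = f y" for x y
      using bij_betw_inv_into_left[OF b that(1)] that by simp
    have "restrict ?f (carrier R) \<in> ring_hom R R"
      using f by (auto simp: ring_hom_def i intro!: l)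
    then show "inv\<^bsub>BijGroup (carrier R)\<^esub> f \<in> ring_hom R R \<inter> Bij (carrier R)"
      using f by (simp add: inv_BijGroup restrict_inv_into_Bij)
  next
    fix f g assume f: "f \<in> ring_hom R R \<inter> Bij (carrier R)" and g: "g \<in> ring_hom R R \<inter> Bij (carrier R)"
    then have "f \<otimes>\<^bsub>BijGroup (carrier R)\<^esub> g = compose (carrier R) f g" by (simp add: BijGroup_def)
    moreover have "compose (carrier R) f g \<in> ring_hom R R"
      using f g by (auto simp: ring_hom_def compose_eq Pi_iff)
    ultimately show "f \<otimes>\<^bsub>BijGroup (carrier R)\<^esub> g \<in> ring_hom R R \<inter> Bij (carrier R)"
      using f g by (simp add: compose_Bij)
  qed
  then show ?thesis unfolding Ring_Auto_def by (rule G.subgroup_imp_group)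
qed

section \<open>Words\<close>

abbreviation gen :: "'x \<Rightarrow> 'x word" where
  "gen x \<equiv> [(x, True)]"

abbreviation bas :: "'y \<Rightarrow> ('x word \<times> 'y) \<Rightarrow>\<^sub>0 'k::field" where
  "bas y \<equiv> Poly_Mapping.single ([], y) 1"

abbreviation smul :: "'k \<Rightarrow> ('b \<Rightarrow>\<^sub>0 'k) \<Rightarrow> ('b \<Rightarrow>\<^sub>0 'k::field)" where
  "smul c \<equiv> Poly_Mapping.map ((*) c)"

abbreviation gact :: "'x word \<Rightarrow> (('x word \<times> 'y) \<Rightarrow>\<^sub>0 'k) \<Rightarrow> (('x word \<times> 'y) \<Rightarrow>\<^sub>0 'k::field)" where
  "gact g \<equiv> pushforward (\<lambda>(h, y). (wmult g h, y))"

lemma free_grp_simps: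
  "w \<in> carrier (free_grp A) \<longleftrightarrow> reduced w \<and> fst ` set w \<subseteq> A"
  "monoid.mult (free_grp A) = wmult" "\<one>\<^bsub>free_grp A\<^esub> = []"
  by (simp_all add: free_grp_def)

lemma inv_free_grp:
  assumes "w \<in> carrier (free_grp A)"
  shows "inv\<^bsub>free_grp A\<^esub> w = rev (map inv_letter w)"
proof -
  interpret group "free_grp A" by (rule group_free_grp)
  show ?thesis
    by (rule inv_equality)
      (use assms in \<open>auto simp: free_grp_simps wmult_inverse reduced_inverse\<close>)
qed

lemma wmult_eq_append: "reduced (u @ v) \<Longrightarrow> wmult u v = u @ v"
  by (induction u) (auto simp: reduced_Cons lmult_reduced)

text \<open>Cancellation removes letters in pairs. The parity is the invariant that keeps a single
  generator out of the image of an endomorphism sending every generator to a square.\<close>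

lemma even_length_wmult: "even (length (wmult u v)) \<longleftrightarrow> even (length u + length v)"
proof (induction u)
  case (Cons a u)
  have "even (length (lmult a w)) \<longleftrightarrow> odd (length w)" for w :: "'a word"
    by (cases w) auto
  then show ?case using Cons by simp
qed simp

lemma hom_wordval:
  assumes G: "group G" and H: "group H" and f: "f \<in> hom G H"
    and a: "a \<in> A \<rightarrow> carrier G" and w: "fst ` set w \<subseteq> A"
  shows "f (wordval G a w) = wordval H (\<lambda>x. f (a x)) w"
proof -
  interpret f: group_hom G H f using G H f by (intro group_hom.intro group_hom_axioms.intro)
  show ?thesis using w
  proof (induction w)
    case (Cons l w)
    have "a (fst l) \<in> carrier G" using Cons a by auto
    moreover have "wordval G a w \<in> carrier G"
      by (rule f.G.wordval_closed[OF _ a]) (use Cons in auto)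
    ultimately show ?case using Cons by simp
  qed simp
qed

lemma free_grp_singleton_int_pow:
  assumes "w \<in> carrier (free_grp {x})"
  shows "\<exists>n::int. w = gen x [^]\<^bsub>free_grp {x}\<^esub> n"
  using assms
proof (induction w)
  case Nil
  show ?case by (rule exI[of _ 0]) (simp add: free_grp_simps)
next
  case (Cons l w)
  interpret group "free_grp {x}" by (rule group_free_grp)
  have g: "gen x \<in> carrier (free_grp {x})" by (simp add: free_grp_simps reduced_def)
  have "w \<in> carrier (free_grp {x})" using Cons.prems by (simp add: free_grp_simps reduced_Cons)
  then obtain n :: int where n: "w = gen x [^]\<^bsub>free_grp {x}\<^esub> n" using Cons.IH by blast
  have "[l] = gen x [^]\<^bsub>free_grp {x}\<^esub> (if snd l then 1 else -1 :: int)"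
    using Cons.prems g by (cases l) (auto simp: free_grp_simps int_pow_neg inv_free_grp inv_letter_def)
  moreover have "l # w = [l] \<otimes>\<^bsub>free_grp {x}\<^esub> w"
    using Cons.prems by (simp add: free_grp_simps lmult_reduced)
  ultimately show ?case using n int_pow_mult[OF g] by metis
qed

text \<open>Endomorphisms of an infinite cyclic group are power maps, and their exponents
  multiply.\<close>

lemma free_grp_singleton_end_commute:
  assumes f: "f \<in> hom (free_grp {x}) (free_grp {x})" and g: "g \<in> hom (free_grp {x}) (free_grp {x})"
    and w: "w \<in> carrier (free_grp {x})"
  shows "f (g w) = g (f w)"
proof -
  interpret group "free_grp {x}" by (rule group_free_grp)
  have x: "gen x \<in> carrier (free_grp {x})" by (simp add: free_grp_simps reduced_def)
  have "f (gen x) \<in> carrier (free_grp {x})" "g (gen x) \<in> carrier (free_grp {x})"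
    using f g x by (auto simp: hom_def)
  then obtain m n :: int where m: "f (gen x) = gen x [^]\<^bsub>free_grp {x}\<^esub> m"
    and n: "g (gen x) = gen x [^]\<^bsub>free_grp {x}\<^esub> n"
    using free_grp_singleton_int_pow by metis
  obtain k :: int where k: "w = gen x [^]\<^bsub>free_grp {x}\<^esub> k" using free_grp_singleton_int_pow[OF w] by blast
  have p: "f (gen x [^]\<^bsub>free_grp {x}\<^esub> i) = gen x [^]\<^bsub>free_grp {x}\<^esub> (m * i)"
    "g (gen x [^]\<^bsub>free_grp {x}\<^esub> i) = gen x [^]\<^bsub>free_grp {x}\<^esub> (n * i)" for i :: int
    using group_hom.hom_int_pow[OF group_hom.intro[OF is_group is_group group_hom_axioms.intro[OF f]] x, of i]
      group_hom.hom_int_pow[OF group_hom.intro[OF is_group is_group group_hom_axioms.intro[OF g]] x, of i]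
    by (simp_all add: m n int_pow_pow x)
  show ?thesis by (simp add: k p algebra_simps)
qed

lemma reduced_relabel:
  "reduced w \<Longrightarrow> fst ` set w \<subseteq> {x} \<Longrightarrow> reduced (map (\<lambda>l. (a, snd l)) w)"
proof (induction w)
  case (Cons l w)
  then show ?case by (cases w) (auto simp: reduced_Cons inv_letter_def prod_eq_iff)
qed simp

text \<open>Substituting another generator causes no cancellation, so the value can be read off
  letter by letter. This makes supports computable in the study of the action.\<close>

lemma wordval_gen:
  assumes "w \<in> carrier (free_grp {x})" "a \<in> A"
  shows "wordval (free_grp A) (\<lambda>_. gen a) w = map (\<lambda>l. (a, snd l)) w"
  using assms(1)
proof (induction w)
  case (Cons l w)
  have "inv\<^bsub>free_grp A\<^esub> gen a = [(a, False)]"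
    using assms(2) by (subst inv_free_grp) (auto simp: free_grp_simps reduced_def inv_letter_def)
  moreover have "reduced (map (\<lambda>l. (a, snd l)) (l # w))"
    using Cons.prems reduced_relabel[of "l # w" x a] by (simp add: free_grp_simps)
  ultimately show ?case using Cons assms(2)
    by (auto simp: free_grp_simps reduced_Cons[of l] lmult_reduced)
qed (simp add: free_grp_simps)

lemma wordval_carrier_cong:
  assumes "\<And>x. x \<in> fst ` set w \<Longrightarrow> a x = b x"
  shows "wordval G a w = wordval G b w"
  using assms by (induction w) auto

section \<open>Homomorphisms of free representations\<close>

type_synonym 'k fpair = "(nat word \<Rightarrow> nat word) \<times> (((nat word \<times> nat) \<Rightarrow>\<^sub>0 'k) \<Rightarrow> ((nat word \<times> nat) \<Rightarrow>\<^sub>0 'k))"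

abbreviation gcar :: "('g, 'v, 'k) rep \<Rightarrow> 'g set" where "gcar H \<equiv> carrier (grp H)"
abbreviation vcar :: "('g, 'v, 'k) rep \<Rightarrow> 'v set" where "vcar H \<equiv> carrier (lin H)"

definition id_hom :: "('g, 'v, 'k) rep \<Rightarrow> ('g \<Rightarrow> 'g) \<times> ('v \<Rightarrow> 'v)" where
  "id_hom H = ((\<lambda>g\<in>gcar H. g), (\<lambda>v\<in>vcar H. v))"

text \<open>Composition in \<open>Theta0\<close> without the tags for source and target; the source
  \<open>H\<close> stays as an argument because the components must be extensional on it.\<close>

definition comp_hom :: "('g, 'v, 'k) rep \<Rightarrow> ('h \<Rightarrow> 'h') \<times> ('w \<Rightarrow> 'w') \<Rightarrow> ('g \<Rightarrow> 'h) \<times> ('v \<Rightarrow> 'w) \<Rightarrow> ('g \<Rightarrow> 'h') \<times> ('v \<Rightarrow> 'w')" where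
  "comp_hom H g f = (compose (gcar H) (fst g) (fst f), compose (vcar H) (snd g) (snd f))"

lemma id_hom_apply [simp]: "g \<in> gcar H \<Longrightarrow> fst (id_hom H) g = g" "v \<in> vcar H \<Longrightarrow> snd (id_hom H) v = v"
  by (simp_all add: id_hom_def)

lemma comp_hom_apply [simp]:
  "x \<in> gcar H \<Longrightarrow> fst (comp_hom H g f) x = fst g (fst f x)"
  "v \<in> vcar H \<Longrightarrow> snd (comp_hom H g f) v = snd g (snd f v)"
  by (simp_all add: comp_hom_def compose_eq)

lemma obj_free_rep: "finite A \<Longrightarrow> finite B \<Longrightarrow> free_rep A B \<in> Theta0_objects"
  by (auto simp: Theta0_objects_def)

lemma obj_cases:
  assumes "H \<in> Theta0_objects"
  obtains A B where "finite A" "finite B" "H = free_rep A B"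
  using assms by (auto simp: Theta0_objects_def)

lemma obj_rep: "H \<in> Theta0_objects \<Longrightarrow> is_representation H"
  by (auto simp: Theta0_objects_def representation_free_rep)

lemma obj_group: "H \<in> Theta0_objects \<Longrightarrow> group (grp H)"
  and obj_module: "H \<in> Theta0_objects \<Longrightarrow> module field_ring (lin H)"
  by (auto dest: obj_rep simp: is_representation_def)

lemma free_rep_car:
  "gcar (free_rep A B) = carrier (free_grp A)"
  "v \<in> vcar (free_rep A B) \<longleftrightarrow> Poly_Mapping.keys v \<subseteq> carrier (free_grp A) \<times> B"
  by (auto simp: free_rep_def span_space_def)

lemma gen_car [simp]: "gen x \<in> gcar (free_rep A B) \<longleftrightarrow> x \<in> A"
  by (simp add: free_rep_car free_grp_simps reduced_def)

lemma bas_car [simp]: "bas y \<in> vcar (free_rep A B) \<longleftrightarrow> y \<in> B"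
  by (simp add: free_rep_car free_grp_simps)

lemma obj_ops:
  assumes "H \<in> Theta0_objects"
  shows "monoid.mult (grp H) = wmult" "one (grp H) = []" "ring.add (lin H) = (+)" "ring.zero (lin H) = 0"
    "smult (lin H) = smul" "act H = gact"
  using assms by (auto simp: Theta0_objects_def free_rep_def free_grp_def span_space_def)

lemma obj_closed:
  assumes "H \<in> Theta0_objects"
  shows "[] \<in> gcar H" "g \<in> gcar H \<Longrightarrow> h \<in> gcar H \<Longrightarrow> wmult g h \<in> gcar H"
    "0 \<in> vcar H" "u \<in> vcar H \<Longrightarrow> v \<in> vcar H \<Longrightarrow> u + v \<in> vcar H"
    "v \<in> vcar H \<Longrightarrow> smul c v \<in> vcar H" "g \<in> gcar H \<Longrightarrow> v \<in> vcar H \<Longrightarrow> gact g v \<in> vcar H"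
proof -
  interpret group "grp H" by (rule obj_group[OF assms])
  interpret V: module field_ring "lin H" by (rule obj_module[OF assms])
  show "[] \<in> gcar H" "g \<in> gcar H \<Longrightarrow> h \<in> gcar H \<Longrightarrow> wmult g h \<in> gcar H"
    using one_closed m_closed by (simp_all add: obj_ops[OF assms])
  show "0 \<in> vcar H" "u \<in> vcar H \<Longrightarrow> v \<in> vcar H \<Longrightarrow> u + v \<in> vcar H"
    using V.zero_closed V.a_closed by (simp_all add: obj_ops[OF assms])
  show "v \<in> vcar H \<Longrightarrow> smul c v \<in> vcar H"
    using V.smult_closed by (simp add: obj_ops[OF assms] field_ring_def)
  show "g \<in> gcar H \<Longrightarrow> v \<in> vcar H \<Longrightarrow> gact g v \<in> vcar H"
    using obj_rep[OF assms] by (auto simp: is_representation_def lin_hom_def obj_ops[OF assms])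
qed

lemma rep_hom_apply:
  assumes "h \<in> rep_hom H H'" "H \<in> Theta0_objects" "H' \<in> Theta0_objects"
  shows "x \<in> gcar H \<Longrightarrow> fst h x \<in> gcar H'" "x \<in> gcar H \<Longrightarrow> y \<in> gcar H \<Longrightarrow> fst h (wmult x y) = wmult (fst h x) (fst h y)"
    "v \<in> vcar H \<Longrightarrow> snd h v \<in> vcar H'" "u \<in> vcar H \<Longrightarrow> v \<in> vcar H \<Longrightarrow> snd h (u + v) = snd h u + snd h v"
    "v \<in> vcar H \<Longrightarrow> snd h (smul c v) = smul c (snd h v)"
    "x \<in> gcar H \<Longrightarrow> v \<in> vcar H \<Longrightarrow> snd h (gact x v) = gact (fst h x) (snd h v)"
  using assms by (auto simp: rep_hom_def hom_def lin_hom_def obj_ops)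

lemma rep_hom_zero:
  assumes "h \<in> rep_hom H H'" "H \<in> Theta0_objects" "H' \<in> Theta0_objects"
  shows "fst h [] = []" "snd h 0 = 0"
proof -
  interpret group_hom "grp H" "grp H'" "fst h"
    using assms by (auto simp: rep_hom_def obj_group intro!: group_hom.intro group_hom_axioms.intro)
  show "fst h [] = []" using hom_one by (simp add: obj_ops assms)
  have "snd h (0 + 0) = snd h 0 + snd h 0" by (rule rep_hom_apply(4)[OF assms]) (simp_all add: obj_closed assms)
  then show "snd h 0 = 0" by simp
qed

lemma rep_hom_group: "h \<in> rep_hom H H' \<Longrightarrow> fst h \<in> hom (grp H) (grp H')"
  by (auto simp: rep_hom_def)

lemma rep_homI:
  assumes H: "H \<in> Theta0_objects" "H' \<in> Theta0_objects"
    and "\<And>x. x \<in> gcar H \<Longrightarrow> \<phi> x \<in> gcar H'" "\<And>x y. x \<in> gcar H \<Longrightarrow> y \<in> gcar H \<Longrightarrow> \<phi> (wmult x y) = wmult (\<phi> x) (\<phi> y)"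
    "\<And>v. v \<in> vcar H \<Longrightarrow> \<psi> v \<in> vcar H'" "\<And>u v. u \<in> vcar H \<Longrightarrow> v \<in> vcar H \<Longrightarrow> \<psi> (u + v) = \<psi> u + \<psi> v"
    "\<And>c v. v \<in> vcar H \<Longrightarrow> \<psi> (smul c v) = smul c (\<psi> v)"
    "\<And>x v. x \<in> gcar H \<Longrightarrow> v \<in> vcar H \<Longrightarrow> \<psi> (gact x v) = gact (\<phi> x) (\<psi> v)"
  shows "(restrict \<phi> (gcar H), restrict \<psi> (vcar H)) \<in> rep_hom H H'"
  using assms by (auto simp: rep_hom_def hom_def lin_hom_def obj_ops obj_closed)

lemma rep_hom_eqI:
  assumes "h \<in> rep_hom H H'" "h' \<in> rep_hom H H'"
    "\<And>x. x \<in> gcar H \<Longrightarrow> fst h x = fst h' x" "\<And>v. v \<in> vcar H \<Longrightarrow> snd h v = snd h' v"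
  shows "h = h'"
  using assms by (auto simp: rep_hom_def intro!: prod_eqI extensionalityI[where A = "gcar H"] extensionalityI[where A = "vcar H"])

lemma id_hom_hom: "H \<in> Theta0_objects \<Longrightarrow> id_hom H \<in> rep_hom H H"
  unfolding id_hom_def by (rule rep_hom_id[OF obj_rep])

lemma comp_hom_hom: "H \<in> Theta0_objects \<Longrightarrow> f \<in> rep_hom H H' \<Longrightarrow> g \<in> rep_hom H' H'' \<Longrightarrow> comp_hom H g f \<in> rep_hom H H''"
  unfolding comp_hom_def by (rule rep_hom_compose[OF obj_rep]) auto

lemma free_hom_eqI:
  fixes A B :: "nat set"
  assumes "H \<in> Theta0_objects" "h \<in> rep_hom (free_rep A B) H" "h' \<in> rep_hom (free_rep A B) H"
    "\<And>x. x \<in> A \<Longrightarrow> fst h (gen x) = fst h' (gen x)" "\<And>y. y \<in> B \<Longrightarrow> snd h (bas y) = snd h' (bas y)"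
  shows "h = h'"
proof -
  have "(\<lambda>x. fst h (gen x)) \<in> A \<rightarrow> gcar H" "(\<lambda>y. snd h (bas y)) \<in> B \<rightarrow> vcar H"
    using assms(2) gen_car[of _ A B] bas_car[of _ A B] by (fastforce simp: rep_hom_def hom_def lin_hom_def)+
  from free_rep_universal[OF obj_rep[OF assms(1)] this] assms(2-) show ?thesis
    by (metis (no_types, lifting))
qed

lemma free_hom_wordval:
  assumes "H \<in> Theta0_objects" "h \<in> rep_hom (free_rep A B) H" "w \<in> carrier (free_grp A)"
  shows "fst h w = wordval (grp H) (\<lambda>x. fst h (gen x)) w"
proof (rule wordval_unique[OF obj_group[OF assms(1)] _ assms(3)])
  show "fst h \<in> hom (free_grp A) (grp H)" using rep_hom_group[OF assms(2)] by (simp add: free_rep_def)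
qed auto

lemma rep_hom_sum:
  assumes "h \<in> rep_hom H H'" "H \<in> Theta0_objects" "H' \<in> Theta0_objects" "\<And>i. i \<in> I \<Longrightarrow> f i \<in> vcar H"
  shows "sum f I \<in> vcar H \<and> snd h (sum f I) = (\<Sum>i\<in>I. snd h (f i))"
  using assms(4)
  by (induction I rule: infinite_finite_induct) (simp_all add: rep_hom_zero[OF assms(1-3)] obj_closed assms(2) rep_hom_apply[OF assms(1-3)])

lemma free_hom_single:
  fixes A B :: "nat set"
  assumes "h \<in> rep_hom (free_rep A B) H'" "finite A" "finite B" "H' \<in> Theta0_objects"
    "w \<in> carrier (free_grp A)" "y \<in> B"
  shows "snd h (Poly_Mapping.single (w, y) c) = smul c (gact (fst h w) (snd h (bas y)))"
proof -
  note fb = obj_free_rep[OF assms(2,3)]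
  have "Poly_Mapping.single (w, y) c = smul c (gact w (bas y))"
    using assms(5) by (simp add: pushforward_single map_times_single free_grp_simps wmult_Nil2)
  then show ?thesis using assms(5,6)
    by (simp only: rep_hom_apply[OF assms(1) fb assms(4)] free_rep_car(1) obj_closed[OF fb] bas_car)
qed

text \<open>A vector \<open>U\<close> of a free representation, read as an operation: its value at
  the images of the generators. Transported operations become explicit formulas this way.\<close>

lemma free_hom_apply:
  fixes A B :: "nat set"
  assumes "h \<in> rep_hom (free_rep A B) H'" "finite A" "finite B" "H' \<in> Theta0_objects"
    "U \<in> vcar (free_rep A B)"
  shows "snd h U = (\<Sum>x\<in>Poly_Mapping.keys U. smul (Poly_Mapping.lookup U x) (gact (fst h (fst x)) (snd h (bas (snd x)))))"
proof -
  note fb = obj_free_rep[OF assms(2,3)]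
  have k: "x \<in> Poly_Mapping.keys U \<Longrightarrow> fst x \<in> carrier (free_grp A) \<and> snd x \<in> B" for x
    using assms(5) by (auto simp: free_rep_car)
  have "snd h U = snd h (\<Sum>x\<in>Poly_Mapping.keys U. Poly_Mapping.single x (Poly_Mapping.lookup U x))"
    by (simp only: pm_decompose[symmetric])
  also have "\<dots> = (\<Sum>x\<in>Poly_Mapping.keys U. snd h (Poly_Mapping.single x (Poly_Mapping.lookup U x)))"
    using rep_hom_sum[OF assms(1) fb assms(4), of "Poly_Mapping.keys U" "\<lambda>x. Poly_Mapping.single x (Poly_Mapping.lookup U x)"] k
    by (force simp: free_rep_car)
  also have "\<dots> = (\<Sum>x\<in>Poly_Mapping.keys U. smul (Poly_Mapping.lookup U x) (gact (fst h (fst x)) (snd h (bas (snd x)))))"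
    by (rule sum.cong[OF refl]) (use k free_hom_single[OF assms(1-4)] in \<open>metis prod.collapse\<close>)
  finally show ?thesis .
qed

section \<open>The images of the representing objects\<close>

lemma free_hom_exists:
  assumes "H \<in> Theta0_objects" "\<forall>x\<in>A. a x \<in> gcar H" "\<forall>y\<in>B. b y \<in> vcar H"
  shows "\<exists>h. h \<in> rep_hom (free_rep A B) H \<and> (\<forall>x\<in>A. fst h (gen x) = a x) \<and> (\<forall>y\<in>B. snd h (bas y) = b y)"
  using free_rep_universal[OF obj_rep[OF assms(1)], of a A b B] assms(2,3) by blast

lemma free_hom_exists_grp:
  assumes "H \<in> Theta0_objects" "\<forall>x\<in>A. a x \<in> gcar H"
  shows "\<exists>h. h \<in> rep_hom (free_rep A {}) H \<and> (\<forall>x\<in>A. fst h (gen x) = a x)"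
proof -
  have "\<forall>y\<in>{}. (\<lambda>_. 0) y \<in> vcar H" by simp
  from free_hom_exists[OF assms this] show ?thesis by (elim exE conjE, intro exI conjI)
qed

lemma free_hom_exists_lin:
  assumes "H \<in> Theta0_objects" "\<forall>y\<in>B. b y \<in> vcar H"
  shows "\<exists>h. h \<in> rep_hom (free_rep {} B) H \<and> (\<forall>y\<in>B. snd h (bas y) = b y)"
proof -
  have "\<forall>x\<in>{}. (\<lambda>_. []) x \<in> gcar H" by simp
  from free_hom_exists[OF assms(1) this assms(2)] show ?thesis by (elim exE conjE, intro exI conjI)
qed

text \<open>A description of the zero maps in terms of composition only, hence invariant under automorphisms of
  the category.\<close>

definition const_hom :: "'k::field frep \<Rightarrow> 'k fpair \<Rightarrow> bool" where
  "const_hom H z \<longleftrightarrow> (\<forall>K\<in>Theta0_objects. \<forall>f\<in>rep_hom K H. \<forall>g\<in>rep_hom K H. comp_hom K z f = comp_hom K z g)"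

definition iso_end :: "'k::field frep \<Rightarrow> 'k fpair \<Rightarrow> bool" where
  "iso_end H f \<longleftrightarrow> (\<exists>g\<in>rep_hom H H. comp_hom H g f = id_hom H \<and> comp_hom H f g = id_hom H)"

definition trivial_hom :: "'k::field frep \<Rightarrow> 'k fpair" where
  "trivial_hom H = ((\<lambda>g\<in>gcar H. []), (\<lambda>v\<in>vcar H. 0))"

lemma trivial_hom_apply [simp]: "g \<in> gcar H \<Longrightarrow> fst (trivial_hom H) g = []" "v \<in> vcar H \<Longrightarrow> snd (trivial_hom H) v = 0"
  by (simp_all add: trivial_hom_def)

lemma trivial_hom_mem:
  assumes "H \<in> Theta0_objects" "H' \<in> Theta0_objects"
  shows "trivial_hom H \<in> rep_hom H H'"
  unfolding trivial_hom_def using assms by (intro rep_homI) (simp_all add: obj_closed)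

text \<open>Two test maps are enough, the identity and the trivial endomorphism: after the latter,
  \<open>z\<close> takes only the values \<open>[]\<close> and 0.\<close>

lemma const_hom_iff:
  assumes H: "H \<in> Theta0_objects" "H' \<in> Theta0_objects" and z: "z \<in> rep_hom H H'"
  shows "const_hom H z \<longleftrightarrow> (\<forall>g\<in>gcar H. fst z g = []) \<and> (\<forall>v\<in>vcar H. snd z v = 0)"
proof
  assume "const_hom H z"
  then have e: "comp_hom H z (id_hom H) = comp_hom H z (trivial_hom H)"
    unfolding const_hom_def using H(1) id_hom_hom[OF H(1)] trivial_hom_mem[OF H(1) H(1)] by blast
  have "fst z g = []" if "g \<in> gcar H" for g
    using arg_cong[OF e, of "\<lambda>h. fst h g"] that rep_hom_zero[OF z H] by simp
  moreover have "snd z v = 0" if "v \<in> vcar H" for v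
    using arg_cong[OF e, of "\<lambda>h. snd h v"] that rep_hom_zero[OF z H] by simp
  ultimately show "(\<forall>g\<in>gcar H. fst z g = []) \<and> (\<forall>v\<in>vcar H. snd z v = 0)" by blast
next
  assume *: "(\<forall>g\<in>gcar H. fst z g = []) \<and> (\<forall>v\<in>vcar H. snd z v = 0)"
  show "const_hom H z" unfolding const_hom_def
  proof (intro ballI)
    fix K f g assume K: "K \<in> Theta0_objects" "f \<in> rep_hom K H" "g \<in> rep_hom K H"
    show "comp_hom K z f = comp_hom K z g"
      by (rule rep_hom_eqI[OF comp_hom_hom[OF K(1,2) z] comp_hom_hom[OF K(1,3) z]])
        (simp_all add: * rep_hom_apply[OF K(2,1) H(1)] rep_hom_apply[OF K(3,1) H(1)])
  qed
qed

lemma vcar_line: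
  assumes "U \<in> vcar (free_rep {} {b})"
  shows "U = smul (Poly_Mapping.lookup U ([], b)) (bas b)"
proof -
  have "carrier (free_grp {}) = {[]}" by (auto simp: free_grp_simps)
  then have "Poly_Mapping.keys U \<subseteq> {([], b)}" using assms by (auto simp: free_rep_car)
  then show ?thesis
    by (intro poly_mapping_eqI) (auto simp: lookup_map_times lookup_single when_def in_keys_iff)
qed

lemma smul_smul: "smul c (smul d v) = smul (c * d) v" for c :: "'k::field"
  by (rule poly_mapping_eqI) (simp add: lookup_map_times algebra_simps)

lemma smul_one [simp]: "smul 1 v = v" for v :: "'b \<Rightarrow>\<^sub>0 'k::field"
  by (rule poly_mapping_eqI) (simp add: lookup_map_times)

lemma smul_zero [simp]: "smul 0 v = 0" for v :: "'b \<Rightarrow>\<^sub>0 'k::field"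
  by (rule poly_mapping_eqI) (simp add: lookup_map_times)

lemma smul_add_left: "smul (c + d) v = smul c v + smul d v" for c :: "'k::field"
  by (rule poly_mapping_eqI) (simp add: lookup_map_times lookup_add algebra_simps)

lemma smul_cancel: "v \<noteq> 0 \<Longrightarrow> smul c v = smul d v \<longleftrightarrow> c = d" for c :: "'k::field"
proof
  assume "v \<noteq> 0" "smul c v = smul d v"
  then obtain x where "Poly_Mapping.lookup v x \<noteq> 0" by (metis poly_mapping_eqI lookup_zero)
  then show "c = d" using arg_cong[OF \<open>smul c v = smul d v\<close>, of "\<lambda>u. Poly_Mapping.lookup u x"]
    by (simp add: lookup_map_times)
qed simp

lemma bas_nonzero [simp]: "bas y \<noteq> 0"
  by (metis lookup_single_eq lookup_zero one_neq_zero)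

section \<open>Recognising the two representing objects by their homomorphisms\<close>

abbreviation PP :: "'k::field frep" where "PP \<equiv> free_rep {0} {}"
abbreviation QQ :: "'k::field frep" where "QQ \<equiv> free_rep {} {0}"

lemma PQ_obj [simp]: "PP \<in> Theta0_objects" "QQ \<in> Theta0_objects"
  by (simp_all add: obj_free_rep)

lemma id_hom_not_const:
  assumes H: "H \<in> Theta0_objects" and x: "(g \<in> gcar H \<and> g \<noteq> []) \<or> (v \<in> vcar H \<and> v \<noteq> 0)"
  shows "\<not> const_hom H (id_hom H)"
  using x const_hom_iff[OF H H id_hom_hom[OF H]] by auto

text \<open>An endomorphism of a line is multiplication by a scalar, and nonzero scalars of a field
  are invertible.\<close>

lemma QQ_end:
  assumes f: "f \<in> rep_hom QQ QQ"
  shows "const_hom QQ f \<or> iso_end (QQ :: 'k::field frep) f"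
proof -
  have Q: "(QQ :: 'k frep) \<in> Theta0_objects" by (simp add: obj_free_rep)
  define c where "c = Poly_Mapping.lookup (snd f (bas 0)) ([], 0)"
  have c: "snd f (bas 0) = smul c (bas 0)"
    unfolding c_def by (rule vcar_line) (simp add: rep_hom_apply[OF f Q Q])
  show ?thesis
  proof (cases "c = 0")
    case True
    have "f = trivial_hom QQ"
      by (rule free_hom_eqI[OF Q f trivial_hom_mem[OF Q Q]]) (simp_all add: c True)
    then show ?thesis using const_hom_iff[OF Q Q f] by simp
  next
    case False
    obtain g where g: "g \<in> rep_hom QQ QQ" "snd g (bas 0) = smul (1/c) (bas 0)"
      using free_hom_exists[OF Q, of "{}" _ "{0}" "\<lambda>_. smul (1/c) (bas 0)"] obj_closed(5)[OF Q, of "bas 0" "1/c"] by auto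
    have "comp_hom QQ g f = id_hom QQ"
      by (rule free_hom_eqI[OF Q comp_hom_hom[OF Q f g(1)] id_hom_hom[OF Q]])
        (simp_all add: g c rep_hom_apply(5)[OF g(1) Q Q] smul_smul False del: map_single)
    moreover have "comp_hom QQ f g = id_hom QQ"
      by (rule free_hom_eqI[OF Q comp_hom_hom[OF Q g(1) f] id_hom_hom[OF Q]])
        (simp_all add: g c rep_hom_apply(5)[OF f Q Q] smul_smul False del: map_single)
    ultimately show ?thesis using g by (auto simp: iso_end_def)
  qed
qed

text \<open>Converse to \<open>QQ_end\<close>. A group generator, or a second basis vector in the
  absence of group generators, would allow a nonzero endomorphism that is not invertible.\<close>

lemma end_const_or_iso_imp_line:
  assumes fin: "finite A" "finite B"
    and ends: "\<And>f. f \<in> rep_hom (free_rep A B) (free_rep A B) \<Longrightarrow>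
      const_hom (free_rep A B) f \<or> iso_end (free_rep A B :: 'k::field frep) f"
    and nz: "\<not> const_hom (free_rep A B :: 'k frep) (id_hom (free_rep A B))"
  shows "\<exists>b. A = {} \<and> B = {b}"
proof -
  let ?H = "free_rep A B :: 'k frep"
  have H: "?H \<in> Theta0_objects" by (simp add: obj_free_rep fin)
  have A: "A = {}"
  proof (rule ccontr)
    assume "A \<noteq> {}"
    then obtain a where a: "a \<in> A" by blast
    \<comment> \<open>Sending all group generators to \<open>a\<^sup>2\<close> is nonzero but only reaches words of even length.\<close>
    have aa: "[(a, True), (a, True)] \<in> gcar ?H"
      using a by (simp add: free_rep_car free_grp_simps reduced_def inv_letter_def)
    obtain f where f: "f \<in> rep_hom ?H ?H" "\<And>x. x \<in> A \<Longrightarrow> fst f (gen x) = [(a, True), (a, True)]"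
      using free_hom_exists[OF H, of A "\<lambda>_. [(a, True), (a, True)]" B "\<lambda>_. 0"] aa obj_closed(3)[OF H] that
      by (auto simp del: One_nat_def)
    have "\<not> const_hom ?H f"
      using const_hom_iff[OF H H f(1)] f(2)[OF a] gen_car[of a A B] a by auto
    then obtain g where g: "g \<in> rep_hom ?H ?H" "comp_hom ?H f g = id_hom ?H"
      using ends[OF f(1)] by (auto simp: iso_end_def)
    have ga: "fst f (fst g (gen a)) = gen a"
      using arg_cong[OF g(2), of "\<lambda>h. fst h (gen a)"] a by simp
    have eval_word: "even (length (fst f w))" if w: "w \<in> carrier (free_grp A)" for w
      unfolding free_hom_wordval[OF H f(1) w] using w
    proof (induction w)
      case (Cons l w)
      moreover have "inv\<^bsub>free_grp A\<^esub> [(a, True), (a, True)] = [(a, False), (a, False)]"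
        using aa by (subst inv_free_grp) (auto simp: free_rep_car inv_letter_def)
      ultimately show ?case
        by (auto simp: free_grp_simps reduced_Cons free_rep_def f(2) even_length_wmult simp del: wmult_simps)
    qed (simp add: obj_ops[OF H])
    have "fst g (gen a) \<in> gcar ?H" by (rule rep_hom_apply(1)[OF g(1) H H]) (simp add: a)
    then have "fst g (gen a) \<in> carrier (free_grp A)" by (simp only: free_rep_car(1))
    with eval_word show False using ga by fastforce
  qed
  have "B \<noteq> {}"
  proof
    assume "B = {}"
    then have "id_hom ?H = trivial_hom ?H"
      using A by (intro free_hom_eqI[OF H id_hom_hom[OF H] trivial_hom_mem[OF H H]]) auto
    then show False using nz const_hom_iff[OF H H id_hom_hom[OF H]] by simp
  qed
  then obtain b where b: "b \<in> B" by blast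
  have "b' = b" if b': "b' \<in> B" for b'
  proof (rule ccontr)
    assume ne: "b' \<noteq> b"
    \<comment> \<open>The projection onto the line of \<open>bas b\<close> is nonzero but kills
      \<open>bas b'\<close>, so it has no left inverse.\<close>
    have "\<forall>y\<in>B. (if y = b then bas b else 0) \<in> vcar ?H"
      using b obj_closed(3)[OF H] by simp
    from free_hom_exists[OF H _ this, of A "\<lambda>_. []"]
    obtain f where f: "f \<in> rep_hom ?H ?H" "\<And>y. y \<in> B \<Longrightarrow> snd f (bas y) = (if y = b then bas b else 0)"
      using obj_closed(1)[OF H] by auto
    have "\<not> const_hom ?H f"
      using const_hom_iff[OF H H f(1)] f(2)[OF b] bas_car[of b A B] b by (auto simp del: bas_car)
    then obtain g where g: "g \<in> rep_hom ?H ?H" "comp_hom ?H g f = id_hom ?H"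
      using ends[OF f(1)] by (auto simp: iso_end_def)
    have "snd g (snd f (bas b')) = bas b'"
      using arg_cong[OF g(2), of "\<lambda>h. snd h (bas b')"] b' by simp
    then show False using f(2)[OF b'] ne rep_hom_zero[OF g(1) H H] by (metis bas_nonzero)
  qed
  then show ?thesis using A b by blast
qed

lemma PP_end_commute:
  assumes f: "f \<in> rep_hom PP PP" and g: "g \<in> rep_hom (PP :: 'k::field frep) PP"
  shows "comp_hom PP f g = comp_hom PP g f"
proof -
  have P: "(PP :: 'k frep) \<in> Theta0_objects" by (simp add: obj_free_rep)
  have "fst f \<in> hom (free_grp {0}) (free_grp {0})" "fst g \<in> hom (free_grp {0}) (free_grp {0})"
    using rep_hom_group[OF f] rep_hom_group[OF g] by (simp_all add: free_rep_def)
  then have "fst f (fst g (gen 0)) = fst g (fst f (gen 0))"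
    by (rule free_grp_singleton_end_commute) (use gen_car[of 0 "{0}"] in \<open>simp add: free_rep_car\<close>)
  then show ?thesis
    by (intro free_hom_eqI[OF P comp_hom_hom[OF P g f] comp_hom_hom[OF P f g]]) auto
qed

text \<open>The endomorphisms that collapse all generators to \<open>gen a\<close> and to
  \<open>gen a'\<close> send \<open>gen a\<close> to different places in the two orders of
  composition, unless the generators coincide.\<close>

lemma end_commute_imp_cyclic:
  assumes fin: "finite A" and a: "a \<in> A"
    and comm: "\<And>f g. f \<in> rep_hom (free_rep A {}) (free_rep A {}) \<Longrightarrow> g \<in> rep_hom (free_rep A {}) (free_rep A {}) \<Longrightarrow>
      comp_hom (free_rep A {} :: 'k::field frep) f g = comp_hom (free_rep A {}) g f"
  shows "A = {a}"
proof -
  let ?H = "free_rep A {} :: 'k frep"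
  have H: "?H \<in> Theta0_objects" by (simp add: obj_free_rep fin)
  have "a' = a" if a': "a' \<in> A" for a'
  proof -
    have "\<forall>x\<in>A. gen a \<in> gcar ?H" using a by simp
    from free_hom_exists_grp[OF H this]
    obtain f where f: "f \<in> rep_hom ?H ?H" "\<And>x. x \<in> A \<Longrightarrow> fst f (gen x) = gen a" by blast
    have "\<forall>x\<in>A. gen a' \<in> gcar ?H" using a' by simp
    from free_hom_exists_grp[OF H this]
    obtain g where g: "g \<in> rep_hom ?H ?H" "\<And>x. x \<in> A \<Longrightarrow> fst g (gen x) = gen a'" by blast
    show ?thesis
      using arg_cong[OF comm[OF f(1) g(1)], of "\<lambda>h. fst h (gen a)"] a a' f g by simp
  qed
  then show ?thesis using a by blast
qed

text \<open>A category automorphism seen on hom-sets, freed from the tags that an arrow of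
  \<open>Theta0\<close> carries. Surjectivity of \<open>F\<close> on objects is what later allows a
  given free object to be written as \<open>F K\<close>.\<close>

locale frep_auto =
  fixes F :: "'k::field frep \<Rightarrow> 'k frep"
    and T :: "'k frep \<Rightarrow> 'k frep \<Rightarrow> 'k fpair \<Rightarrow> 'k fpair"
  assumes bij_F: "bij_betw F Theta0_objects Theta0_objects"
    and bij_T: "\<And>H H'. H \<in> Theta0_objects \<Longrightarrow> H' \<in> Theta0_objects \<Longrightarrow>
      bij_betw (T H H') (rep_hom H H') (rep_hom (F H) (F H'))"
    and T_id: "\<And>H. H \<in> Theta0_objects \<Longrightarrow> T H H (id_hom H) = id_hom (F H)"
    and T_comp: "\<And>H H' H'' f g. H \<in> Theta0_objects \<Longrightarrow> H' \<in> Theta0_objects \<Longrightarrow> H'' \<in> Theta0_objects \<Longrightarrow>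
      f \<in> rep_hom H H' \<Longrightarrow> g \<in> rep_hom H' H'' \<Longrightarrow>
      T H H'' (comp_hom H g f) = comp_hom (F H) (T H' H'' g) (T H H' f)"
begin

lemma F_obj [simp]: "H \<in> Theta0_objects \<Longrightarrow> F H \<in> Theta0_objects"
  using bij_F by (auto simp: bij_betw_def)

lemma F_surj:
  assumes "K \<in> Theta0_objects" obtains H where "H \<in> Theta0_objects" "F H = K"
  using assms bij_F by (metis bij_betw_imp_surj_on imageE)

lemma T_hom: "H \<in> Theta0_objects \<Longrightarrow> H' \<in> Theta0_objects \<Longrightarrow> f \<in> rep_hom H H' \<Longrightarrow> T H H' f \<in> rep_hom (F H) (F H')"
  using bij_T by (auto simp: bij_betw_def)

lemma T_inj: "H \<in> Theta0_objects \<Longrightarrow> H' \<in> Theta0_objects \<Longrightarrow> f \<in> rep_hom H H' \<Longrightarrow> g \<in> rep_hom H H' \<Longrightarrow>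
    T H H' f = T H H' g \<Longrightarrow> f = g"
  using bij_T[of H H'] by (auto simp: bij_betw_def dest: inj_onD)

lemma T_surj:
  assumes "H \<in> Theta0_objects" "H' \<in> Theta0_objects" "k \<in> rep_hom (F H) (F H')"
  obtains f where "f \<in> rep_hom H H'" "T H H' f = k"
proof -
  have "k \<in> T H H' ` rep_hom H H'"
    using assms(3) bij_betw_imp_surj_on[OF bij_T[OF assms(1,2)]] by simp
  then obtain f where f: "k = T H H' f" "f \<in> rep_hom H H'" by (rule imageE)
  show thesis by (rule that[OF f(2) f(1)[symmetric]])
qed

text \<open>Surjectivity of \<open>F\<close> and \<open>T\<close> makes every test object and test
  map at \<open>F H\<close> the image of one at \<open>H\<close>; injectivity of \<open>T\<close>
  makes the outcomes of the tests agree.\<close>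

lemma T_const:
  assumes H: "H \<in> Theta0_objects" "H' \<in> Theta0_objects" and z: "z \<in> rep_hom H H'"
  shows "const_hom (F H) (T H H' z) \<longleftrightarrow> const_hom H z"
proof -
  have "(\<forall>f\<in>rep_hom (F K) (F H). \<forall>g\<in>rep_hom (F K) (F H). comp_hom (F K) (T H H' z) f = comp_hom (F K) (T H H' z) g) \<longleftrightarrow>
      (\<forall>f\<in>rep_hom K H. \<forall>g\<in>rep_hom K H. comp_hom K z f = comp_hom K z g)" (is "?P (F K) \<longleftrightarrow> ?Q K") if K: "K \<in> Theta0_objects" for K
  proof -
    have *: "comp_hom (F K) (T H H' z) (T K H f) = comp_hom (F K) (T H H' z) (T K H g) \<longleftrightarrow> comp_hom K z f = comp_hom K z g"
      if "f \<in> rep_hom K H" "g \<in> rep_hom K H" for f g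
      unfolding T_comp[OF K H that(1) z, symmetric] T_comp[OF K H that(2) z, symmetric]
      by (rule iffI[OF T_inj[OF K H(2) comp_hom_hom[OF K that(1) z] comp_hom_hom[OF K that(2) z]]]) simp_all
    have im: "rep_hom (F K) (F H) = T K H ` rep_hom K H"
      using bij_T[OF K H(1)] by (simp add: bij_betw_def)
    show ?thesis unfolding im using * by blast
  qed
  moreover have "(\<forall>K\<in>Theta0_objects. ?P K) \<longleftrightarrow> (\<forall>K\<in>F ` Theta0_objects. ?P K)"
    using bij_betw_imp_surj_on[OF bij_F] by simp
  ultimately show ?thesis unfolding const_hom_def by (simp only: ball_simps cong: ball_cong)
qed

lemma T_iso_end:
  assumes H: "H \<in> Theta0_objects" and f: "f \<in> rep_hom H H" and i: "iso_end H f"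
  shows "iso_end (F H) (T H H f)"
proof -
  from i obtain g where g: "g \<in> rep_hom H H" "comp_hom H g f = id_hom H" "comp_hom H f g = id_hom H"
    by (auto simp: iso_end_def)
  then show ?thesis unfolding iso_end_def
    using T_comp[OF H H H f g(1)] T_comp[OF H H H g(1) f] T_id[OF H] T_hom[OF H H g(1)] by metis
qed

lemma F_QQ: "\<exists>b. F QQ = free_rep {} {b}"
proof -
  obtain A B where AB: "finite A" "finite B" "F QQ = free_rep A B"
    by (rule obj_cases[OF F_obj[OF PQ_obj(2)]])
  have "\<not> const_hom QQ (id_hom (QQ :: 'k frep))"
    by (rule id_hom_not_const[OF PQ_obj(2), of _ "bas 0"]) simp
  then have nc: "\<not> const_hom (F QQ) (id_hom (F QQ))"
    using T_const[OF PQ_obj(2) PQ_obj(2) id_hom_hom[OF PQ_obj(2)]] T_id[OF PQ_obj(2)] by simp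
  have en: "const_hom (F QQ) k \<or> iso_end (F QQ) k" if k: "k \<in> rep_hom (F QQ) (F QQ)" for k
  proof -
    obtain f where "f \<in> rep_hom QQ QQ" "T QQ QQ f = k" using T_surj[OF PQ_obj(2,2) k] .
    then show ?thesis using QQ_end[of f] T_const[OF PQ_obj(2,2), of f] T_iso_end[OF PQ_obj(2), of f] by blast
  qed
  have "\<exists>b. A = {} \<and> B = {b}"
    by (rule end_const_or_iso_imp_line[OF AB(1,2) en[unfolded AB(3)] nc[unfolded AB(3)]])
  then show ?thesis using AB(3) by auto
qed

lemma F_PP: "\<exists>a. F PP = free_rep {a} {}"
proof -
  obtain A B where AB: "finite A" "finite B" "F PP = free_rep A B"
    by (rule obj_cases[OF F_obj[OF PQ_obj(1)]])
  obtain c where c: "F QQ = free_rep {} {c}" using F_QQ by blast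
  \<comment> \<open>A basis vector of \<open>F PP\<close> would give a nonzero map from
    \<open>F QQ\<close>. Its preimage is a map from \<open>QQ\<close> to \<open>PP\<close>, which
    must vanish because \<open>PP\<close> has no nonzero vector.\<close>
  have B: "B = {}"
  proof (rule ccontr)
    assume "B \<noteq> {}"
    then obtain b where b: "b \<in> B" by blast
    obtain k where k: "k \<in> rep_hom (F QQ) (F PP)" "snd k (bas c) = bas b"
      unfolding c AB(3)
      using free_hom_exists[of "free_rep A B" "{}" _ "{c}" "\<lambda>_. bas b"] b AB by (auto simp: obj_free_rep)
    obtain f where f: "f \<in> rep_hom QQ PP" "T QQ PP f = k" using T_surj[OF PQ_obj(2,1) k(1)] .
    have "snd f (bas 0) \<in> vcar PP"
      by (rule rep_hom_apply(3)[OF f(1) PQ_obj(2,1)]) simp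
    then have f0: "snd f (bas 0) = 0" by (simp add: free_rep_car(2))
    have "f = trivial_hom QQ"
    proof (rule free_hom_eqI[OF PQ_obj(1) f(1) trivial_hom_mem[OF PQ_obj(2,1)]])
      show "snd f (bas y) = snd (trivial_hom QQ) (bas y)" if "y \<in> {0}" for y
        using that f0 by simp
    qed simp
    then have "const_hom QQ f" using const_hom_iff[OF PQ_obj(2,1) f(1)] by simp
    then have "const_hom (F QQ) k" using T_const[OF PQ_obj(2,1) f(1)] f(2) by simp
    then have "snd k (bas c) = 0"
      using const_hom_iff[OF F_obj[OF PQ_obj(2)] F_obj[OF PQ_obj(1)] k(1)] by (simp add: c)
    then show False using k(2) by simp
  qed
  have "A \<noteq> {}"
  proof
    assume "A = {}"
    then have "id_hom (F PP) = trivial_hom (F PP)"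
      using B AB id_hom_hom[OF F_obj[OF PQ_obj(1)]] trivial_hom_mem[OF F_obj[OF PQ_obj(1)] F_obj[OF PQ_obj(1)]]
      unfolding AB(3) by (intro free_hom_eqI[where A="A" and B="B" and H = "free_rep A B"]) (auto simp: obj_free_rep)
    then have "const_hom (F PP) (id_hom (F PP))"
      using const_hom_iff[OF F_obj[OF PQ_obj(1)] F_obj[OF PQ_obj(1)] id_hom_hom[OF F_obj[OF PQ_obj(1)]]] by simp
    then have "const_hom PP (id_hom (PP :: 'k frep))"
      using T_const[OF PQ_obj(1,1) id_hom_hom[OF PQ_obj(1)]] T_id[OF PQ_obj(1)] by simp
    moreover have "\<not> const_hom PP (id_hom (PP :: 'k frep))"
      by (rule id_hom_not_const[OF PQ_obj(1), of "gen 0"]) simp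
    ultimately show False by simp
  qed
  then obtain a where a: "a \<in> A" by blast
  have "A = {a}"
  proof (rule end_commute_imp_cyclic[OF AB(1) a])
    fix k l :: "'k fpair" assume "k \<in> rep_hom (free_rep A {}) (free_rep A {})" "l \<in> rep_hom (free_rep A {}) (free_rep A {} :: 'k frep)"
    then have kl: "k \<in> rep_hom (F PP) (F PP)" "l \<in> rep_hom (F PP) (F PP)" using AB(3) B by auto
    obtain f where f: "f \<in> rep_hom PP PP" "T PP PP f = k" using T_surj[OF PQ_obj(1,1) kl(1)] .
    obtain g where g: "g \<in> rep_hom PP PP" "T PP PP g = l" using T_surj[OF PQ_obj(1,1) kl(2)] .
    have "comp_hom (F PP) k l = comp_hom (F PP) l k"
      using T_comp[OF PQ_obj(1,1,1) f(1) g(1)] T_comp[OF PQ_obj(1,1,1) g(1) f(1)] f(2) g(2) PP_end_commute[OF f(1) g(1)] by simp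
    then show "comp_hom (free_rep A {} :: 'k frep) k l = comp_hom (free_rep A {}) l k" using AB(3) B by simp
  qed
  then show ?thesis using AB B by blast
qed

end

section \<open>The induced natural bijections\<close>

context frep_auto
begin

text \<open>Free objects on different variables are different objects, so \<open>F PP\<close> need
  not be \<open>PP\<close>: its generator may have another name than 0.\<close>

definition pgen :: nat where "pgen = (SOME a. F PP = free_rep {a} {})"
definition qgen :: nat where "qgen = (SOME b. F QQ = free_rep {} {b})"

lemma F_PP': "F PP = free_rep {pgen} {}"
  unfolding pgen_def by (rule someI_ex[OF F_PP])

lemma F_QQ': "F QQ = free_rep {} {qgen}"
  unfolding qgen_def by (rule someI_ex[OF F_QQ])

text \<open>The homomorphism that represents an element. It identifies each sort of \<open>H\<close>
  with the homomorphisms from \<open>PP\<close> or \<open>QQ\<close> to \<open>H\<close>.\<close>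

definition grp_point :: "'k frep \<Rightarrow> nat word \<Rightarrow> 'k fpair" where
  "grp_point H g = (SOME h. h \<in> rep_hom PP H \<and> fst h (gen 0) = g)"
definition lin_point :: "'k frep \<Rightarrow> ((nat word \<times> nat) \<Rightarrow>\<^sub>0 'k) \<Rightarrow> 'k fpair" where
  "lin_point H v = (SOME h. h \<in> rep_hom QQ H \<and> snd h (bas 0) = v)"

lemma grp_point:
  assumes "H \<in> Theta0_objects" "g \<in> gcar H"
  shows "grp_point H g \<in> rep_hom PP H" "fst (grp_point H g) (gen 0) = g"
proof -
  have "\<exists>h. h \<in> rep_hom PP H \<and> fst h (gen 0) = g"
    using free_hom_exists_grp[OF assms(1), of "{0}" "\<lambda>_. g"] assms(2) by simp
  from someI_ex[OF this] show "grp_point H g \<in> rep_hom PP H" "fst (grp_point H g) (gen 0) = g"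
    unfolding grp_point_def by blast+
qed

lemma lin_point:
  assumes "H \<in> Theta0_objects" "v \<in> vcar H"
  shows "lin_point H v \<in> rep_hom QQ H" "snd (lin_point H v) (bas 0) = v"
proof -
  have "\<exists>h. h \<in> rep_hom QQ H \<and> snd h (bas 0) = v"
    using free_hom_exists_lin[OF assms(1), of "{0}" "\<lambda>_. v"] assms(2) by simp
  from someI_ex[OF this] show "lin_point H v \<in> rep_hom QQ H" "snd (lin_point H v) (bas 0) = v"
    unfolding lin_point_def by blast+
qed

lemma grp_point_eq:
  assumes "H \<in> Theta0_objects" "h \<in> rep_hom PP H"
  shows "grp_point H (fst h (gen 0)) = h"
proof -
  have "fst h (gen 0) \<in> gcar H" by (rule rep_hom_apply(1)[OF assms(2) PQ_obj(1) assms(1)]) simp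
  from grp_point[OF assms(1) this] show ?thesis
    by (intro free_hom_eqI[OF assms(1) _ assms(2)]) simp_all
qed

lemma lin_point_eq:
  assumes "H \<in> Theta0_objects" "h \<in> rep_hom QQ H"
  shows "lin_point H (snd h (bas 0)) = h"
proof -
  have "snd h (bas 0) \<in> vcar H" by (rule rep_hom_apply(3)[OF assms(2) PQ_obj(2) assms(1)]) simp
  from lin_point[OF assms(1) this] show ?thesis
    by (intro free_hom_eqI[OF assms(1) _ assms(2)]) simp_all
qed

text \<open>The composite of three bijections: elements of \<open>H\<close> to Hom(PP, H), this to
  Hom(F PP, F H) by \<open>T\<close>, and back to elements of \<open>F H\<close> by evaluation at
  the generator. It is natural in \<open>H\<close>, but nothing so far relates it to the algebraic
  operations.\<close>

definition s :: "'k frep \<Rightarrow> nat word \<Rightarrow> nat word" where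
  "s H g = fst (T PP H (grp_point H g)) (gen pgen)"
definition t :: "'k frep \<Rightarrow> ((nat word \<times> nat) \<Rightarrow>\<^sub>0 'k) \<Rightarrow> ((nat word \<times> nat) \<Rightarrow>\<^sub>0 'k)" where
  "t H v = snd (T QQ H (lin_point H v)) (bas qgen)"

lemma s_closed: "H \<in> Theta0_objects \<Longrightarrow> g \<in> gcar H \<Longrightarrow> s H g \<in> gcar (F H)"
  unfolding s_def by (rule rep_hom_apply(1)[OF T_hom[OF PQ_obj(1) _ grp_point(1)]]) (simp_all add: F_PP' obj_free_rep)

lemma t_closed: "H \<in> Theta0_objects \<Longrightarrow> v \<in> vcar H \<Longrightarrow> t H v \<in> vcar (F H)"
  unfolding t_def by (rule rep_hom_apply(3)[OF T_hom[OF PQ_obj(2) _ lin_point(1)]]) (simp_all add: F_QQ' obj_free_rep)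

lemma s_inj:
  assumes H: "H \<in> Theta0_objects" and g: "g \<in> gcar H" "g' \<in> gcar H" and e: "s H g = s H g'"
  shows "g = g'"
proof -
  have "T PP H (grp_point H g) = T PP H (grp_point H g')"
    by (rule free_hom_eqI[OF F_obj[OF H] T_hom[OF PQ_obj(1) H grp_point(1)[OF H g(1)], unfolded F_PP']
      T_hom[OF PQ_obj(1) H grp_point(1)[OF H g(2)], unfolded F_PP']]) (use e in \<open>simp_all add: s_def\<close>)
  then have "grp_point H g = grp_point H g'" by (rule T_inj[OF PQ_obj(1) H grp_point(1)[OF H g(1)] grp_point(1)[OF H g(2)]])
  then show ?thesis using grp_point(2)[OF H] g by metis
qed

lemma t_inj:
  assumes H: "H \<in> Theta0_objects" and v: "v \<in> vcar H" "v' \<in> vcar H" and e: "t H v = t H v'"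
  shows "v = v'"
proof -
  have "T QQ H (lin_point H v) = T QQ H (lin_point H v')"
    by (rule free_hom_eqI[OF F_obj[OF H] T_hom[OF PQ_obj(2) H lin_point(1)[OF H v(1)], unfolded F_QQ']
      T_hom[OF PQ_obj(2) H lin_point(1)[OF H v(2)], unfolded F_QQ']]) (use e in \<open>simp_all add: t_def\<close>)
  then have "lin_point H v = lin_point H v'" by (rule T_inj[OF PQ_obj(2) H lin_point(1)[OF H v(1)] lin_point(1)[OF H v(2)]])
  then show ?thesis using lin_point(2)[OF H] v by metis
qed

lemma s_surj:
  assumes H: "H \<in> Theta0_objects" and k: "k \<in> gcar (F H)"
  shows "\<exists>g\<in>gcar H. s H g = k"
proof -
  have "\<exists>h. h \<in> rep_hom (F PP) (F H) \<and> fst h (gen pgen) = k"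
    using free_hom_exists_grp[OF F_obj[OF H], of "{pgen}" "\<lambda>_. k"] k by (simp add: F_PP')
  then obtain h where h: "h \<in> rep_hom (F PP) (F H)" "fst h (gen pgen) = k" by (elim exE conjE)
  obtain f where f: "f \<in> rep_hom PP H" "T PP H f = h" by (rule T_surj[OF PQ_obj(1) H h(1)])
  have "fst f (gen 0) \<in> gcar H" by (rule rep_hom_apply(1)[OF f(1) PQ_obj(1) H]) simp
  moreover have "s H (fst f (gen 0)) = k" by (simp add: s_def grp_point_eq[OF H f(1)] f h)
  ultimately show ?thesis by (rule bexI[rotated])
qed

lemma t_surj:
  assumes H: "H \<in> Theta0_objects" and k: "k \<in> vcar (F H)"
  shows "\<exists>v\<in>vcar H. t H v = k"
proof -
  have "\<exists>h. h \<in> rep_hom (F QQ) (F H) \<and> snd h (bas qgen) = k"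
    using free_hom_exists_lin[OF F_obj[OF H], of "{qgen}" "\<lambda>_. k"] k by (simp add: F_QQ')
  then obtain h where h: "h \<in> rep_hom (F QQ) (F H)" "snd h (bas qgen) = k" by (elim exE conjE)
  obtain f where f: "f \<in> rep_hom QQ H" "T QQ H f = h" by (rule T_surj[OF PQ_obj(2) H h(1)])
  have "snd f (bas 0) \<in> vcar H" by (rule rep_hom_apply(3)[OF f(1) PQ_obj(2) H]) simp
  moreover have "t H (snd f (bas 0)) = k" by (simp add: t_def lin_point_eq[OF H f(1)] f h)
  ultimately show ?thesis by (rule bexI[rotated])
qed

lemma s_nat:
  assumes H: "H \<in> Theta0_objects" "H' \<in> Theta0_objects" and m: "m \<in> rep_hom H H'" and g: "g \<in> gcar H"
  shows "s H' (fst m g) = fst (T H H' m) (s H g)"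
proof -
  have "grp_point H' (fst (comp_hom PP m (grp_point H g)) (gen 0)) = comp_hom PP m (grp_point H g)"
    by (rule grp_point_eq[OF H(2) comp_hom_hom[OF PQ_obj(1) grp_point(1)[OF H(1) g] m]])
  then have "grp_point H' (fst m g) = comp_hom PP m (grp_point H g)" by (simp add: grp_point(2)[OF H(1) g])
  moreover have "gen pgen \<in> gcar (F PP)" by (simp add: F_PP')
  ultimately show ?thesis
    by (simp add: s_def T_comp[OF PQ_obj(1) H grp_point(1)[OF H(1) g] m])
qed

lemma t_nat:
  assumes H: "H \<in> Theta0_objects" "H' \<in> Theta0_objects" and m: "m \<in> rep_hom H H'" and v: "v \<in> vcar H"
  shows "t H' (snd m v) = snd (T H H' m) (t H v)"
proof -
  have "lin_point H' (snd (comp_hom QQ m (lin_point H v)) (bas 0)) = comp_hom QQ m (lin_point H v)"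
    by (rule lin_point_eq[OF H(2) comp_hom_hom[OF PQ_obj(2) lin_point(1)[OF H(1) v] m]])
  then have "lin_point H' (snd m v) = comp_hom QQ m (lin_point H v)" by (simp add: lin_point(2)[OF H(1) v])
  moreover have "bas qgen \<in> vcar (F QQ)" by (simp add: F_QQ')
  ultimately show ?thesis
    by (simp add: t_def T_comp[OF PQ_obj(2) H lin_point(1)[OF H(1) v] m])
qed

text \<open>\<open>n\<close> is the homomorphism to \<open>F H\<close> whose values on the generators are those of \<open>m\<close> transported along
  \<open>s\<close> and \<open>t\<close>.\<close>

definition linked :: "nat set \<Rightarrow> nat set \<Rightarrow> 'k frep \<Rightarrow> 'k fpair \<Rightarrow> 'k fpair \<Rightarrow> bool" where
  "linked A B H m n \<longleftrightarrow> H \<in> Theta0_objects \<and> m \<in> rep_hom (free_rep A B) H \<and> n \<in> rep_hom (free_rep A B) (F H) \<and>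
    (\<forall>x\<in>A. fst n (gen x) = s H (fst m (gen x))) \<and> (\<forall>y\<in>B. snd n (bas y) = t H (snd m (bas y)))"

text \<open>The image of a free representation under the automorphism is again free, on the transported
  generators; \<open>z\<close> sends these to the generators of \<open>free_rep A B\<close>.\<close>

lemma comparison_hom:
  assumes fin: "finite A" "finite B"
  shows "\<exists>z\<in>rep_hom (F (free_rep A B)) (free_rep A B).
    (\<forall>H m n. linked A B H m n \<longrightarrow> T (free_rep A B) H m = comp_hom (F (free_rep A B)) n z) \<and>
    (\<forall>U\<in>vcar (free_rep A B). \<exists>V\<in>vcar (free_rep A B). snd z (t (free_rep A B) V) = U)"
proof -
  let ?T = "free_rep A B :: 'k frep"
  have O: "?T \<in> Theta0_objects" by (rule obj_free_rep[OF fin])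
  obtain K where K: "K \<in> Theta0_objects" "F K = ?T" by (rule F_surj[OF O])
  have "\<forall>x\<in>A. \<exists>g. g \<in> gcar K \<and> s K g = gen x"
  proof
    fix x assume "x \<in> A"
    then have "gen x \<in> gcar (F K)" by (simp add: K)
    from s_surj[OF K(1) this] show "\<exists>g. g \<in> gcar K \<and> s K g = gen x" by blast
  qed
  from bchoice[OF this] obtain a where a: "\<forall>x\<in>A. a x \<in> gcar K \<and> s K (a x) = gen x" ..
  have "\<forall>y\<in>B. \<exists>v. v \<in> vcar K \<and> t K v = bas y"
  proof
    fix y assume "y \<in> B"
    then have "bas y \<in> vcar (F K)" by (simp add: K)
    from t_surj[OF K(1) this] show "\<exists>v. v \<in> vcar K \<and> t K v = bas y" by blast
  qed
  from bchoice[OF this] obtain b where b: "\<forall>y\<in>B. b y \<in> vcar K \<and> t K (b y) = bas y" ..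
  have "\<forall>x\<in>A. a x \<in> gcar K" "\<forall>y\<in>B. b y \<in> vcar K" using a b by simp_all
  from free_hom_exists[OF K(1) this] obtain m0 where m0: "m0 \<in> rep_hom ?T K"
    "\<forall>x\<in>A. fst m0 (gen x) = a x" "\<forall>y\<in>B. snd m0 (bas y) = b y" by (elim exE conjE)
  define z where "z = T ?T K m0"
  have z: "z \<in> rep_hom (F ?T) ?T" unfolding z_def using T_hom[OF O K(1) m0(1)] by (simp add: K)
  have 1: "T ?T H m = comp_hom (F ?T) n z" if l: "linked A B H m n" for H m n
  proof -
    have H: "H \<in> Theta0_objects" and m: "m \<in> rep_hom ?T H" and n: "n \<in> rep_hom (F K) (F H)"
      and nm: "\<And>x. x \<in> A \<Longrightarrow> fst n (gen x) = s H (fst m (gen x))" "\<And>y. y \<in> B \<Longrightarrow> snd n (bas y) = t H (snd m (bas y))"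
      using l by (simp_all add: linked_def K)
    \<comment> \<open>Since \<open>n\<close> starts at \<open>F K\<close>, it comes from some
      \<open>n0\<close> on \<open>K\<close>. The composite of \<open>n0\<close> with
      \<open>m0\<close> equals \<open>m\<close> because \<open>s\<close> and \<open>t\<close> are
      injective and the two agree on generators after transport.\<close>
    obtain n0 where n0: "n0 \<in> rep_hom K H" "T K H n0 = n" by (rule T_surj[OF K(1) H n])
    have "comp_hom ?T n0 m0 = m"
    proof (rule free_hom_eqI[OF H comp_hom_hom[OF O m0(1) n0(1)] m])
      fix x assume x: "x \<in> A"
      have "s H (fst n0 (a x)) = s H (fst m (gen x))"
        using s_nat[OF K(1) H n0(1), of "a x"] a x nm n0 by simp
      then have "fst n0 (a x) = fst m (gen x)"
        by (rule s_inj[OF H, rotated 2])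
          (use a x in \<open>simp_all add: rep_hom_apply(1)[OF n0(1) K(1) H] rep_hom_apply(1)[OF m O H]\<close>)
      then show "fst (comp_hom ?T n0 m0) (gen x) = fst m (gen x)" using x m0 by simp
    next
      fix y assume y: "y \<in> B"
      have "t H (snd n0 (b y)) = t H (snd m (bas y))"
        using t_nat[OF K(1) H n0(1), of "b y"] b y nm n0 by simp
      then have "snd n0 (b y) = snd m (bas y)"
        by (rule t_inj[OF H, rotated 2])
          (use b y in \<open>simp_all add: rep_hom_apply(3)[OF n0(1) K(1) H] rep_hom_apply(3)[OF m O H]\<close>)
      then show "snd (comp_hom ?T n0 m0) (bas y) = snd m (bas y)" using y m0 by simp
    qed
    then show ?thesis using T_comp[OF O K(1) H m0(1) n0(1)] by (simp add: n0 z_def)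
  qed
  \<comment> \<open>For the second claim a right inverse \<open>th\<close> of \<open>z\<close> is
    built, sending each generator to its transport.\<close>
  have "\<forall>x\<in>A. s ?T (gen x) \<in> gcar (F ?T)" "\<forall>y\<in>B. t ?T (bas y) \<in> vcar (F ?T)"
    using s_closed[OF O] t_closed[OF O] by simp_all
  from free_hom_exists[OF F_obj[OF O] this] obtain th where th: "th \<in> rep_hom (F K) (F ?T)"
    "\<forall>x\<in>A. fst th (gen x) = s ?T (gen x)" "\<forall>y\<in>B. snd th (bas y) = t ?T (bas y)" unfolding K by (elim exE conjE)
  obtain et where et: "et \<in> rep_hom K ?T" "T K ?T et = th" by (rule T_surj[OF K(1) O th(1)])
  have "comp_hom ?T z th = id_hom ?T"
  proof (rule free_hom_eqI[OF O comp_hom_hom[OF O th(1)[unfolded K] z] id_hom_hom[OF O]])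
    fix x assume x: "x \<in> A"
    have "fst z (s ?T (gen x)) = s K (fst m0 (gen x))"
      using s_nat[OF O K(1) m0(1), of "gen x"] x by (simp add: z_def)
    then show "fst (comp_hom ?T z th) (gen x) = fst (id_hom ?T) (gen x)" using x m0 a th by simp
  next
    fix y assume y: "y \<in> B"
    have "snd z (t ?T (bas y)) = t K (snd m0 (bas y))"
      using t_nat[OF O K(1) m0(1), of "bas y"] y by (simp add: z_def)
    then show "snd (comp_hom ?T z th) (bas y) = snd (id_hom ?T) (bas y)" using y m0 b th by simp
  qed
  \<comment> \<open>Injectivity of \<open>T\<close> turns this into an identity on \<open>K\<close>;
    the preimage of U is then \<open>snd et W\<close> for the \<open>W\<close> with
    \<open>t K W = U\<close>.\<close>
  then have "T K K (comp_hom K m0 et) = T K K (id_hom K)"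
    using T_comp[OF K(1) O K(1) et(1) m0(1)] T_id[OF K(1)] by (simp add: et K z_def[symmetric])
  then have me: "comp_hom K m0 et = id_hom K"
    by (rule T_inj[OF K(1) K(1) comp_hom_hom[OF K(1) et(1) m0(1)] id_hom_hom[OF K(1)]])
  have 2: "\<exists>V\<in>vcar ?T. snd z (t ?T V) = U" if U: "U \<in> vcar ?T" for U
  proof -
    have "U \<in> vcar (F K)" using U by (simp only: K)
    from t_surj[OF K(1) this] obtain W where W: "W \<in> vcar K" "t K W = U" ..
    have V: "snd et W \<in> vcar ?T" by (rule rep_hom_apply(3)[OF et(1) K(1) O W(1)])
    have "snd z (t ?T (snd et W)) = t K (snd m0 (snd et W))"
      using t_nat[OF O K(1) m0(1) V] by (simp add: z_def)
    also have "snd m0 (snd et W) = snd (comp_hom K m0 et) W" using W by simp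
    also have "\<dots> = W" using W by (simp add: me)
    finally show ?thesis using V W by auto
  qed
  show ?thesis using z 1 2 by blast
qed

text \<open>The Yoneda step. An element \<open>w\<close> of a free representation is an operation in
  its generators; along \<open>s\<close> and \<open>t\<close> it becomes the operation of one
  element \<open>w'\<close>, the same for all \<open>H\<close>. Here \<open>w'\<close> is the image
  under \<open>z\<close> of the transport of \<open>w\<close>.\<close>

lemma transport_grp:
  assumes fin: "finite A" "finite B" and w: "w \<in> gcar (free_rep A B :: 'k frep)"
  shows "\<exists>w'\<in>gcar (free_rep A B :: 'k frep). \<forall>H m n. linked A B H m n \<longrightarrow> s H (fst m w) = fst n w'"
proof -
  let ?T = "free_rep A B :: 'k frep"
  have O: "?T \<in> Theta0_objects" by (rule obj_free_rep[OF fin])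
  from comparison_hom[OF fin] obtain z where z: "z \<in> rep_hom (F ?T) ?T"
    "\<And>H m n. linked A B H m n \<Longrightarrow> T ?T H m = comp_hom (F ?T) n z" by blast
  have "s H (fst m w) = fst n (fst z (s ?T w))" if l: "linked A B H m n" for H m n
    using s_nat[OF O _ _ w, of H m] z(2)[OF l] l s_closed[OF O w] by (simp add: linked_def)
  moreover have "fst z (s ?T w) \<in> gcar ?T"
    by (rule rep_hom_apply(1)[OF z(1) F_obj[OF O] O s_closed[OF O w]])
  ultimately show ?thesis by blast
qed

text \<open>The first claim transports operations from \<open>H\<close> to \<open>F H\<close>. The
  second goes backwards: every operation on the side of \<open>F H\<close> arises from one on the
  side of \<open>H\<close>, which yields the inverse of the action word.\<close>

lemma transport_lin:
  assumes fin: "finite A" "finite B" and U: "U \<in> vcar (free_rep A B :: 'k frep)"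
  shows "\<exists>V\<in>vcar (free_rep A B :: 'k frep). \<forall>H m n. linked A B H m n \<longrightarrow> t H (snd m U) = snd n V"
    and "\<exists>V\<in>vcar (free_rep A B :: 'k frep). \<forall>H m n. linked A B H m n \<longrightarrow> t H (snd m V) = snd n U"
proof -
  let ?T = "free_rep A B :: 'k frep"
  have O: "?T \<in> Theta0_objects" by (rule obj_free_rep[OF fin])
  from comparison_hom[OF fin] obtain z where z: "z \<in> rep_hom (F ?T) ?T"
    "\<And>H m n. linked A B H m n \<Longrightarrow> T ?T H m = comp_hom (F ?T) n z"
    and zs: "\<forall>U\<in>vcar ?T. \<exists>V\<in>vcar ?T. snd z (t ?T V) = U" by blast
  have *: "t H (snd m U) = snd n (snd z (t ?T U))" if l: "linked A B H m n" and U: "U \<in> vcar ?T" for H m n U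
    using t_nat[OF O _ _ U, of H m] z(2)[OF l] l t_closed[OF O U] by (simp add: linked_def)
  have "snd z (t ?T U) \<in> vcar ?T"
    by (rule rep_hom_apply(3)[OF z(1) F_obj[OF O] O t_closed[OF O U]])
  with *[OF _ U] show "\<exists>V\<in>vcar ?T. \<forall>H m n. linked A B H m n \<longrightarrow> t H (snd m U) = snd n V" by blast
  from zs U obtain V where V: "V \<in> vcar ?T" "snd z (t ?T V) = U" by blast
  have "\<forall>H m n. linked A B H m n \<longrightarrow> t H (snd m V) = snd n U" using *[OF _ V(1)] V(2) by simp
  with V(1) show "\<exists>V\<in>vcar ?T. \<forall>H m n. linked A B H m n \<longrightarrow> t H (snd m V) = snd n U" by (rule bexI[rotated])
qed

end

section \<open>Semilinearity\<close>

lemma smul_sum: "smul c (sum f I) = (\<Sum>i\<in>I. smul c (f i))" for c :: "'k::field"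
  by (rule map_times_sum)

lemma vcar_plane:
  assumes "U \<in> vcar (free_rep {} {0, 1::nat})"
  shows "U = smul (Poly_Mapping.lookup U ([], 0)) (bas 0) + smul (Poly_Mapping.lookup U ([], 1)) (bas 1)"
proof -
  have "carrier (free_grp {}) = {[]}" by (auto simp: free_grp_simps)
  then have "Poly_Mapping.keys U \<subseteq> {([], 0), ([], 1)}" using assms by (auto simp: free_rep_car)
  then show ?thesis
    by (intro poly_mapping_eqI) (auto simp: lookup_map_times lookup_add lookup_single when_def in_keys_iff)
qed

text \<open>All letters receive the value \<open>k\<close>; the words of interest have the single
  letter 0 and act as unary operations on the group.\<close>

abbreviation eval_word :: "'k::field frep \<Rightarrow> nat word \<Rightarrow> nat word \<Rightarrow> nat word" where
  "eval_word K k r \<equiv> wordval (grp K) (\<lambda>_. k) r"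

lemma eval_word_closed: "K \<in> Theta0_objects \<Longrightarrow> k \<in> gcar K \<Longrightarrow> eval_word K k r \<in> gcar K"
  by (rule group.wordval_closed[OF obj_group, where A = UNIV]) auto

lemma eval_word_hom:
  assumes "h \<in> rep_hom K K'" "K \<in> Theta0_objects" "K' \<in> Theta0_objects" "k \<in> gcar K"
  shows "fst h (eval_word K k r) = eval_word K' (fst h k) r"
  by (rule hom_wordval[OF obj_group obj_group rep_hom_group, where A = UNIV]) (use assms in auto)

lemma eval_word_one:
  assumes K: "K \<in> Theta0_objects"
  shows "eval_word K [] r = []"
proof -
  interpret group "grp K" by (rule obj_group[OF K])
  have "inv\<^bsub>grp K\<^esub> [] = []" using inv_one by (simp add: obj_ops[OF K])
  then show ?thesis by (induction r) (simp_all add: obj_ops[OF K])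
qed

context frep_auto
begin

text \<open>The unit is an operation without arguments, so its transport is evaluated by a
  homomorphism from the free representation on no generators, which takes only trivial
  values.\<close>

lemma s_one: "H \<in> Theta0_objects \<Longrightarrow> s H [] = []"
proof -
  assume H: "H \<in> Theta0_objects"
  have O: "(free_rep {} {} :: 'k frep) \<in> Theta0_objects" by (simp add: obj_free_rep)
  have "linked {} {} H (trivial_hom (free_rep {} {})) (trivial_hom (free_rep {} {}))"
    by (simp add: linked_def H O trivial_hom_mem)
  with transport_grp[of "{}" "{}" "[]"] obj_closed(1)[OF O] show ?thesis by fastforce
qed

lemma t_zero: "H \<in> Theta0_objects \<Longrightarrow> t H 0 = 0"
proof -
  assume H: "H \<in> Theta0_objects"
  have O: "(free_rep {} {} :: 'k frep) \<in> Theta0_objects" by (simp add: obj_free_rep)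
  have "linked {} {} H (trivial_hom (free_rep {} {})) (trivial_hom (free_rep {} {}))"
    by (simp add: linked_def H O trivial_hom_mem)
  with transport_lin(1)[of "{}" "{}" 0] obj_closed(3)[OF O] show ?thesis by fastforce
qed

lemma linked_exists:
  assumes fin: "finite A" "finite B" and H: "H \<in> Theta0_objects"
    and a: "\<forall>x\<in>A. a x \<in> gcar H" and b: "\<forall>y\<in>B. b y \<in> vcar H"
  shows "\<exists>m n. linked A B H m n \<and> (\<forall>x\<in>A. fst m (gen x) = a x) \<and> (\<forall>y\<in>B. snd m (bas y) = b y) \<and>
    (\<forall>x\<in>A. fst n (gen x) = s H (a x)) \<and> (\<forall>y\<in>B. snd n (bas y) = t H (b y))"
proof -
  have a': "\<forall>x\<in>A. s H (a x) \<in> gcar (F H)" and b': "\<forall>y\<in>B. t H (b y) \<in> vcar (F H)"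
    using a b s_closed[OF H] t_closed[OF H] by simp_all
  from free_hom_exists[OF H a b] obtain m where m: "m \<in> rep_hom (free_rep A B) H"
    "\<forall>x\<in>A. fst m (gen x) = a x" "\<forall>y\<in>B. snd m (bas y) = b y" by (elim exE conjE)
  from free_hom_exists[OF F_obj[OF H] a' b'] obtain n where n: "n \<in> rep_hom (free_rep A B) (F H)"
    "\<forall>x\<in>A. fst n (gen x) = s H (a x)" "\<forall>y\<in>B. snd n (bas y) = t H (b y)" by (elim exE conjE)
  show ?thesis
    by (intro exI[of _ m] exI[of _ n]) (simp add: linked_def H m n)
qed

lemma t_add:
  assumes H: "H \<in> Theta0_objects" and u: "u \<in> vcar H" and v: "v \<in> vcar H"
  shows "t H (u + v) = t H u + t H v"
proof -
  let ?T = "free_rep {} {0, 1} :: 'k frep"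
  have O: "?T \<in> Theta0_objects" by (simp add: obj_free_rep)
  have "bas 0 + bas 1 \<in> vcar ?T" by (intro obj_closed(4)[OF O]) simp_all
  from transport_lin(1)[OF _ _ this] obtain V where V: "V \<in> vcar ?T"
    "\<And>H m n. linked {} {0, 1} H m n \<Longrightarrow> t H (snd m (bas 0 + bas 1)) = snd n V" by auto
  define c d where "c = Poly_Mapping.lookup V ([], 0)" and "d = Poly_Mapping.lookup V ([], 1)"
  have V': "V = smul c (bas 0) + smul d (bas 1)" unfolding c_def d_def by (rule vcar_plane[OF V(1)])
  have *: "t H (u + v) = smul c (t H u) + smul d (t H v)" if u: "u \<in> vcar H" and v: "v \<in> vcar H" for u v
  proof -
    have "\<forall>y\<in>{0, 1::nat}. (if y = 0 then u else v) \<in> vcar H" using u v by simp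
    from linked_exists[OF _ _ H _ this, of "{}"] obtain m n where mn: "linked {} {0, 1} H m n"
      "snd m (bas 0) = u" "snd m (bas 1) = v" "snd n (bas 0) = t H u" "snd n (bas 1) = t H v" by auto
    have m: "m \<in> rep_hom ?T H" and n: "n \<in> rep_hom ?T (F H)" using mn(1) by (simp_all add: linked_def)
    have "snd m (bas 0 + bas 1) = u + v"
      using rep_hom_apply(4)[OF m O H, of "bas 0" "bas 1"] mn by simp
    moreover have "snd n V = smul c (t H u) + smul d (t H v)"
      unfolding V' using rep_hom_apply(4)[OF n O F_obj[OF H], of "smul c (bas 0)" "smul d (bas 1)"]
        rep_hom_apply(5)[OF n O F_obj[OF H], of "bas 0"] rep_hom_apply(5)[OF n O F_obj[OF H], of "bas 1"]
        obj_closed(5)[OF O, of "bas 0" c] obj_closed(5)[OF O, of "bas 1" d] mn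
      by (simp del: map_single)
    ultimately show ?thesis using V(2)[OF mn(1)] by simp
  qed
  \<comment> \<open>Putting 0 for one argument shows that each coefficient fixes the vector it
    multiplies, so neither \<open>c\<close> nor \<open>d\<close> has to be determined.\<close>
  have "t H u = smul c (t H u)" "t H v = smul d (t H v)"
    using *[OF u obj_closed(3)[OF H]] *[OF obj_closed(3)[OF H] v] by (simp_all add: t_zero[OF H])
  then show ?thesis using *[OF u v] by simp
qed

lemma t_scale_exists: "\<exists>c. \<forall>H\<in>Theta0_objects. \<forall>v\<in>vcar H. t H (smul a v) = smul c (t H v)"
proof -
  let ?T = "QQ :: 'k frep"
  have O: "?T \<in> Theta0_objects" by (rule PQ_obj)
  have "smul a (bas 0) \<in> vcar ?T" by (intro obj_closed(5)[OF O]) simp_all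
  from transport_lin(1)[OF _ _ this] obtain V where V: "V \<in> vcar ?T"
    "\<And>H m n. linked {} {0} H m n \<Longrightarrow> t H (snd m (smul a (bas 0))) = snd n V" by auto
  define c where "c = Poly_Mapping.lookup V ([], 0)"
  have V': "V = smul c (bas 0)" unfolding c_def by (rule vcar_line[OF V(1)])
  have "t H (smul a v) = smul c (t H v)" if H: "H \<in> Theta0_objects" and v: "v \<in> vcar H" for H v
  proof -
    from linked_exists[OF _ _ H, of "{}" "{0}" _ "\<lambda>_. v"] v obtain m n where mn: "linked {} {0} H m n"
      "snd m (bas 0) = v" "snd n (bas 0) = t H v" by auto
    have m: "m \<in> rep_hom ?T H" and n: "n \<in> rep_hom ?T (F H)" using mn(1) by (simp_all add: linked_def)
    have "snd m (smul a (bas 0)) = smul a v" "snd n V = smul c (t H v)"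
      unfolding V' using rep_hom_apply(5)[OF m O H, of "bas 0"] rep_hom_apply(5)[OF n O F_obj[OF H], of "bas 0"] mn
      by (simp_all del: map_single)
    then show ?thesis using V(2)[OF mn(1)] by simp
  qed
  then show ?thesis by blast
qed

definition twist :: "'k \<Rightarrow> 'k" where
  "twist a = (SOME c. \<forall>H\<in>Theta0_objects. \<forall>v\<in>vcar H. t H (smul a v) = smul c (t H v))"

lemma t_scale: "H \<in> Theta0_objects \<Longrightarrow> v \<in> vcar H \<Longrightarrow> t H (smul a v) = smul (twist a) (t H v)"
  using someI_ex[OF t_scale_exists[of a]] unfolding twist_def by blast

lemma t_bas_nonzero: "t QQ (bas 0) \<noteq> 0"
proof
  assume "t QQ (bas 0) = 0"
  then have "t QQ (bas 0) = t QQ 0" by (simp add: t_zero)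
  then have "bas 0 = (0 :: (nat word \<times> nat) \<Rightarrow>\<^sub>0 'k)"
    by (rule t_inj[OF PQ_obj(2), rotated 2]) (simp_all add: obj_closed(3)[OF PQ_obj(2)])
  then show False by simp
qed

lemma twist_eqI: "smul (twist a) (t QQ (bas 0)) = smul c (t QQ (bas 0)) \<Longrightarrow> twist a = c"
  using smul_cancel[OF t_bas_nonzero] by blast

lemma smul_bas_car: "smul a (bas 0) \<in> vcar (QQ :: 'k frep)"
  by (intro obj_closed(5)[OF PQ_obj(2)]) simp_all

lemma t_smul_bas: "t QQ (smul a (bas 0)) = smul (twist a) (t QQ (bas 0))"
  by (rule t_scale[OF PQ_obj(2)]) simp

lemma twist_mult: "twist (a * b) = twist a * twist b"
proof (rule twist_eqI)
  have "t QQ (smul a (smul b (bas 0))) = smul (twist a) (smul (twist b) (t QQ (bas 0)))"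
    by (simp only: t_scale[OF PQ_obj(2) smul_bas_car] t_smul_bas)
  then show "smul (twist (a * b)) (t QQ (bas 0)) = smul (twist a * twist b) (t QQ (bas 0))"
    by (simp only: smul_smul t_smul_bas)
qed

lemma twist_add: "twist (a + b) = twist a + twist b"
proof (rule twist_eqI)
  have "t QQ (smul a (bas 0) + smul b (bas 0)) = smul (twist a) (t QQ (bas 0)) + smul (twist b) (t QQ (bas 0))"
    by (simp only: t_add[OF PQ_obj(2) smul_bas_car smul_bas_car] t_smul_bas)
  then show "smul (twist (a + b)) (t QQ (bas 0)) = smul (twist a + twist b) (t QQ (bas 0))"
    by (simp only: smul_add_left[symmetric] t_smul_bas)
qed

lemma twist_one: "twist 1 = 1"
  by (rule twist_eqI) (simp only: t_smul_bas[symmetric] smul_one)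

lemma bij_twist: "bij twist"
proof (rule bijI)
  show "inj twist"
  proof (rule injI)
    fix a b assume "twist a = twist b"
    then have "t QQ (smul a (bas 0)) = t QQ (smul b (bas 0))" by (simp only: t_smul_bas)
    then have "smul a (bas 0 :: (nat word \<times> nat) \<Rightarrow>\<^sub>0 'k) = smul b (bas 0)" by (rule t_inj[OF PQ_obj(2) smul_bas_car smul_bas_car])
    then show "a = b" by (simp only: smul_cancel[OF bas_nonzero])
  qed
  show "surj twist"
  proof (rule surjI)
    fix c
    \<comment> \<open>Every vector of \<open>F QQ\<close> is transported from a vector of
      \<open>QQ\<close>, hence from a multiple of \<open>bas 0\<close>; the scalar of that multiple
      is a preimage of \<open>c\<close>.\<close>
    have "smul c (t QQ (bas 0)) \<in> vcar (F QQ)"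
      by (intro obj_closed(5) F_obj t_closed PQ_obj) simp_all
    from t_surj[OF PQ_obj(2) this] obtain v where v: "v \<in> vcar QQ" "t QQ v = smul c (t QQ (bas 0))" ..
    let ?a = "Poly_Mapping.lookup v ([], 0)"
    have "t QQ v = smul (twist ?a) (t QQ (bas 0))"
      by (subst vcar_line[OF v(1)]) (simp only: t_smul_bas)
    then have "twist ?a = c" using v(2) by (intro twist_eqI) simp
    then show "twist (SOME a. twist a = c) = c" by (rule someI)
  qed
qed

end

section \<open>The transported action\<close>

lemma eval_word_gen:
  assumes "w \<in> carrier (free_grp {0::nat})" "a \<in> A"
  shows "eval_word (free_rep A B) (gen a) w = map (\<lambda>l. (a, snd l)) w"
  using wordval_gen[OF assms] by (simp add: free_rep_def)

text \<open>The letters that meet at the junction have different names, so nothing cancels.\<close>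

lemma wmult_two_gens:
  assumes "p \<in> carrier (free_grp {0::nat})" "q \<in> carrier (free_grp {0::nat})"
  shows "wmult (map (\<lambda>l. (0::nat, snd l)) p) (map (\<lambda>l. (1, snd l)) q) =
    map (\<lambda>l. (0, snd l)) p @ map (\<lambda>l. (1, snd l)) q"
proof (rule wmult_eq_append)
  have "reduced (map (\<lambda>l. (0::nat, snd l)) p)" "reduced (map (\<lambda>l. (1::nat, snd l)) q)"
    using assms reduced_relabel[of p 0] reduced_relabel[of q 0] by (simp_all add: free_grp_simps)
  then show "reduced (map (\<lambda>l. (0::nat, snd l)) p @ map (\<lambda>l. (1, snd l)) q)"
    unfolding reduced_def by (cases p rule: rev_cases; cases q) (auto simp: successively_append_iff inv_letter_def)
qed

lemma relabel_inj:
  assumes "p \<in> carrier (free_grp {0::nat})" "p' \<in> carrier (free_grp {0::nat})"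
    and "map (\<lambda>l. (a, snd l)) p = map (\<lambda>l. (a, snd l)) p'"
  shows "p = p'"
proof -
  have "map snd p = map snd p'" using arg_cong[OF assms(3), of "map snd"] by (simp add: comp_def)
  moreover have "r = map (Pair 0) (map snd r)" if "r \<in> carrier (free_grp {0::nat})" for r
    using that by (intro nth_equalityI) (auto simp: free_grp_simps image_subset_iff prod_eq_iff)
  ultimately show ?thesis using assms by metis
qed

text \<open>Filtering by the name of the letter recovers each factor.\<close>

lemma two_gens_inj:
  assumes "p \<in> carrier (free_grp {0::nat})" "p' \<in> carrier (free_grp {0::nat})"
    "q \<in> carrier (free_grp {0::nat})" "q' \<in> carrier (free_grp {0::nat})"
    and e: "map (\<lambda>l. (0::nat, snd l)) p @ map (\<lambda>l. (1, snd l)) q = map (\<lambda>l. (0, snd l)) p' @ map (\<lambda>l. (1, snd l)) q'"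
  shows "p = p' \<and> q = q'"
proof -
  have "filter (\<lambda>l. fst l = 0) (map (\<lambda>l. (0::nat, snd l)) r @ map (\<lambda>l. (1, snd l)) r') = map (\<lambda>l. (0, snd l)) r"
    "filter (\<lambda>l. fst l = 1) (map (\<lambda>l. (0::nat, snd l)) r @ map (\<lambda>l. (1, snd l)) r') = map (\<lambda>l. (1, snd l)) r'"
    for r r' :: "nat word" by (simp_all add: filter_map comp_def)
  with e have "map (\<lambda>l. (0::nat, snd l)) p = map (\<lambda>l. (0, snd l)) p'" "map (\<lambda>l. (1::nat, snd l)) q = map (\<lambda>l. (1, snd l)) q'"
    by metis+
  then show ?thesis using relabel_inj assms by metis
qed

lemma keys_sum_single_subset:
  "Poly_Mapping.keys (\<Sum>i\<in>I. Poly_Mapping.single (f i) (c i)) \<subseteq> f ` I"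
  by (rule keys_sum_subset) auto

lemma keys_sum_single_inj:
  assumes "finite I" "inj_on f I" "\<And>i. i \<in> I \<Longrightarrow> c i \<noteq> (0::'k::field)"
  shows "Poly_Mapping.keys (\<Sum>i\<in>I. Poly_Mapping.single (f i) (c i)) = f ` I"
proof
  show "f ` I \<subseteq> Poly_Mapping.keys (\<Sum>i\<in>I. Poly_Mapping.single (f i) (c i))"
  proof
    fix x assume "x \<in> f ` I"
    then obtain j where j: "j \<in> I" "x = f j" by blast
    have "Poly_Mapping.lookup (\<Sum>i\<in>I. Poly_Mapping.single (f i) (c i)) x = (\<Sum>i\<in>I. if i = j then c i else 0)"
      unfolding lookup_sum using j assms(2) by (intro sum.cong) (auto simp: lookup_single when_def dest: inj_onD)
    then show "x \<in> Poly_Mapping.keys (\<Sum>i\<in>I. Poly_Mapping.single (f i) (c i))"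
      using j assms by (simp add: in_keys_iff)
  qed
qed (rule keys_sum_single_subset)

text \<open>Words in \<open>x\<^sub>0\<close> and words in \<open>x\<^sub>1\<close> do not cancel, so the right-hand side has exactly \<open>(card S)\<^sup>2\<close> terms,
  while the left-hand side has at most \<open>card S\<close>.\<close>

lemma multiplicative_imp_monomial:
  fixes c :: "nat word \<Rightarrow> 'k::field"
  assumes S: "finite S" "S \<subseteq> carrier (free_grp {0})" and c: "\<And>r. r \<in> S \<Longrightarrow> c r \<noteq> 0"
    and eq: "(\<Sum>r\<in>S. Poly_Mapping.single (f r) (c r)) =
      (\<Sum>(p, q)\<in>S \<times> S. Poly_Mapping.single (wmult (map (\<lambda>l. (0::nat, snd l)) p) (map (\<lambda>l. (1, snd l)) q), 0::nat) (c p * c q))"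
  shows "card S \<le> 1"
proof -
  let ?g = "\<lambda>(p, q). (wmult (map (\<lambda>l. (0::nat, snd l)) p) (map (\<lambda>l. (1, snd l)) q), 0::nat)"
  have inj: "inj_on ?g (S \<times> S)"
  proof (rule inj_onI)
    fix x y assume x: "x \<in> S \<times> S" and y: "y \<in> S \<times> S" and e: "?g x = ?g y"
    obtain p q p' q' where xy: "x = (p, q)" "y = (p', q')" by (metis surj_pair)
    have m: "p \<in> carrier (free_grp {0})" "q \<in> carrier (free_grp {0})"
      "p' \<in> carrier (free_grp {0})" "q' \<in> carrier (free_grp {0})"
      using x y S(2) unfolding xy by blast+
    show "x = y"
      using two_gens_inj[OF m(1,3,2,4)] e unfolding xy wmult_two_gens[OF m(1,2)] wmult_two_gens[OF m(3,4)] prod.case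
        wmult_two_gens[OF m(1,2)] wmult_two_gens[OF m(3,4)] by (simp add: wmult_two_gens m)
  qed
  have "?g ` (S \<times> S) = Poly_Mapping.keys (\<Sum>x\<in>S \<times> S. Poly_Mapping.single (?g x) (case x of (p, q) \<Rightarrow> c p * c q))"
    by (rule keys_sum_single_inj[symmetric, OF _ inj]) (use S c in auto)
  also have "\<dots> = Poly_Mapping.keys (\<Sum>r\<in>S. Poly_Mapping.single (f r) (c r))"
    unfolding eq by (simp add: case_prod_unfold)
  also have "\<dots> \<subseteq> f ` S" by (rule keys_sum_single_subset)
  finally have "card (?g ` (S \<times> S)) \<le> card (f ` S)" using S by (intro card_mono) simp_all
  then have "card (S \<times> S) \<le> card S" using card_image_le[OF S(1), of f] card_image[OF inj] by simp
  then have "card S * card S \<le> card S * 1" by (simp add: card_cartesian_product)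
  then show ?thesis unfolding mult_le_cancel1 by linarith
qed

context frep_auto
begin

text \<open>The action is the operation given by the element x \<circ> y of the free representation
  on one generator of each sort. Its transport is some u \<circ> y with u in the group algebra of
  the cyclic group on x; \<open>S\<close> is the support of u and \<open>c\<close> its
  coefficients.\<close>

lemma act_transport:
  "\<exists>S c. finite S \<and> S \<subseteq> carrier (free_grp {0}) \<and> (\<forall>r\<in>S. c r \<noteq> 0) \<and>
    (\<forall>H\<in>Theta0_objects. \<forall>g\<in>gcar H. \<forall>v\<in>vcar H.
      t H (gact g v) = (\<Sum>r\<in>S. smul (c r) (gact (eval_word (F H) (s H g) r) (t H v))))"
proof -
  let ?T = "free_rep {0} {0} :: 'k frep"
  let ?U = "Poly_Mapping.single (gen 0, 0) 1 :: (nat word \<times> nat) \<Rightarrow>\<^sub>0 'k"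
  have O: "?T \<in> Theta0_objects" by (simp add: obj_free_rep)
  have g0: "gen 0 \<in> carrier (free_grp {0})" by (simp add: free_grp_simps reduced_def)
  have "?U \<in> vcar ?T" using g0 by (simp add: free_rep_car)
  from transport_lin(1)[OF _ _ this] obtain V where V: "V \<in> vcar ?T"
    "\<And>H m n. linked {0} {0} H m n \<Longrightarrow> t H (snd m ?U) = snd n V" by auto
  have k: "Poly_Mapping.keys V \<subseteq> carrier (free_grp {0}) \<times> {0}" using V(1) by (simp add: free_rep_car)
  define S where "S = fst ` Poly_Mapping.keys V"
  define c where "c r = Poly_Mapping.lookup V (r, 0)" for r
  have kS: "Poly_Mapping.keys V = (\<lambda>r. (r, 0)) ` S" using k by (force simp: S_def)
  have SF: "S \<subseteq> carrier (free_grp {0})" using k by (auto simp: S_def)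
  have "t H (gact g v) = (\<Sum>r\<in>S. smul (c r) (gact (eval_word (F H) (s H g) r) (t H v)))"
    if H: "H \<in> Theta0_objects" and g: "g \<in> gcar H" and v: "v \<in> vcar H" for H g v
  proof -
    have "\<forall>x\<in>{0::nat}. g \<in> gcar H" "\<forall>y\<in>{0::nat}. v \<in> vcar H" using g v by simp_all
    from linked_exists[OF _ _ H this] obtain m n where mn: "linked {0} {0} H m n"
      "fst m (gen 0) = g" "snd m (bas 0) = v" "fst n (gen 0) = s H g" "snd n (bas 0) = t H v" by auto
    have m: "m \<in> rep_hom ?T H" and n: "n \<in> rep_hom ?T (F H)" using mn(1) by (simp_all add: linked_def)
    have "snd m ?U = gact g v"
      using free_hom_single[OF m _ _ H g0, of 0 1] mn by simp
    moreover have "snd n V = (\<Sum>r\<in>S. smul (c r) (gact (fst n r) (t H v)))"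
      unfolding free_hom_apply[OF n _ _ F_obj[OF H] V(1), simplified] kS
      by (subst sum.reindex) (auto simp: inj_on_def c_def mn)
    moreover have "fst n r = eval_word (F H) (s H g) r" if "r \<in> S" for r
    proof -
      have r: "r \<in> carrier (free_grp {0})" using SF that by blast
      then have "\<And>x. x \<in> fst ` set r \<Longrightarrow> fst n (gen x) = s H g"
        using mn(4) by (auto simp: free_grp_simps)
      then show ?thesis
        unfolding free_hom_wordval[OF F_obj[OF H] n r] by (rule wordval_carrier_cong)
    qed
    ultimately show ?thesis using V(2)[OF mn(1)] by (simp cong: sum.cong)
  qed
  moreover have "\<forall>r\<in>S. c r \<noteq> 0"
  proof
    fix r assume "r \<in> S"
    then have "(r, 0) \<in> Poly_Mapping.keys V" unfolding kS by simp
    then show "c r \<noteq> 0" by (simp add: c_def in_keys_iff)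
  qed
  moreover have "finite S" by (simp add: S_def)
  ultimately show ?thesis using SF by blast
qed

lemma act_monomial:
  "\<exists>r\<in>carrier (free_grp {0}).
    (\<forall>H\<in>Theta0_objects. \<forall>g\<in>gcar H. \<forall>v\<in>vcar H. t H (gact g v) = gact (eval_word (F H) (s H g) r) (t H v)) \<and>
    (\<forall>H\<in>Theta0_objects. \<forall>g\<in>gcar H. \<forall>h\<in>gcar H.
      eval_word (F H) (s H (wmult g h)) r = wmult (eval_word (F H) (s H g) r) (eval_word (F H) (s H h) r))"
proof -
  note One_nat_def [simp del]
  from act_transport obtain S c where S: "finite S" "S \<subseteq> carrier (free_grp {0})" and c': "\<forall>r\<in>S. c r \<noteq> 0"
    and act': "\<forall>H\<in>Theta0_objects. \<forall>g\<in>gcar H. \<forall>v\<in>vcar H.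
      t H (gact g v) = (\<Sum>r\<in>S. smul (c r) (gact (eval_word (F H) (s H g) r) (t H v)))" by (elim exE conjE)
  note act = act'[rule_format] and c = c'[rule_format]
  \<comment> \<open>Two group generators and one vector suffice to test (gh)v = g(hv). The elements
    \<open>g0\<close>, \<open>g1\<close>, \<open>v\<close> of \<open>K\<close> are the preimages of
    the free generators of \<open>F K\<close>.\<close>
  let ?T = "free_rep {0, 1} {0} :: 'k frep"
  have O: "?T \<in> Theta0_objects" by (simp add: obj_free_rep)
  obtain K where K: "K \<in> Theta0_objects" "F K = ?T" by (rule F_surj[OF O])
  have gK: "gen 0 \<in> gcar (F K)" "gen 1 \<in> gcar (F K)" "bas 0 \<in> vcar (F K)" by (simp_all add: K)
  from s_surj[OF K(1) gK(1)] obtain g0 where g0: "g0 \<in> gcar K" "s K g0 = gen 0" by (elim bexE)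
  from s_surj[OF K(1) gK(2)] obtain g1 where g1: "g1 \<in> gcar K" "s K g1 = gen 1" by (elim bexE)
  from t_surj[OF K(1) gK(3)] obtain v where v: "v \<in> vcar K" "t K v = bas 0" by (elim bexE)
  \<comment> \<open>The transported product of the two generators, an unknown word in both letters.
    For the count of supports it matters only that \<open>L\<close> has at most
    \<open>card S\<close> terms, whatever \<open>w\<close> is.\<close>
  define w where "w = s K (wmult g0 g1)"
  have w: "w \<in> gcar ?T" unfolding w_def K(2)[symmetric] by (intro s_closed K obj_closed g0 g1)
  have ev0: "eval_word ?T (gen 0) r = map (\<lambda>l. (0, snd l)) r" and ev1: "eval_word ?T (gen 1) r = map (\<lambda>l. (1, snd l)) r"
    if "r \<in> carrier (free_grp {0})" for r
    using that by (simp_all add: eval_word_gen)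
  have gs: "smul a (gact h (Poly_Mapping.single (q, 0) b)) = Poly_Mapping.single (wmult h q, 0) (a * b)"
    for a b :: 'k and h q by (simp add: pushforward_single map_times_single)
  have red: "reduced h" if "h \<in> gcar ?T" for h using that by (simp add: free_rep_car free_grp_simps)
  have red_eval_word: "reduced (eval_word ?T h r)" if "h \<in> gcar ?T" for h r using red[OF eval_word_closed[OF O that]] .
  have L: "t K (gact (wmult g0 g1) v) = (\<Sum>r\<in>S. Poly_Mapping.single (eval_word ?T w r, 0) (c r))"
    using act[OF K(1) obj_closed(2)[OF K(1) g0(1) g1(1)] v(1)] red_eval_word[OF w]
    by (simp add: v K w_def[symmetric] gs wmult_Nil2)
  have g1v: "gact g1 v \<in> vcar K" by (intro obj_closed(6) K g1 v)
  have t1: "t K (gact g1 v) = (\<Sum>q\<in>S. Poly_Mapping.single (map (\<lambda>l. (1, snd l)) q, 0) (c q))"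
  proof -
    have "wmult (eval_word ?T (gen 1) q) [] = map (\<lambda>l. (1, snd l)) q" if "q \<in> S" for q
      using that S(2) red_eval_word[of "gen 1" q] by (simp add: wmult_Nil2 ev1 subset_iff)
    then show ?thesis using act[OF K(1) g1(1) v(1)] by (simp add: v K g1 gs cong: sum.cong)
  qed
  have R: "t K (gact g0 (gact g1 v)) = (\<Sum>(p, q)\<in>S \<times> S. Poly_Mapping.single
      (wmult (map (\<lambda>l. (0, snd l)) p) (map (\<lambda>l. (1, snd l)) q), 0) (c p * c q))"
  proof -
    have "t K (gact g0 (gact g1 v)) = (\<Sum>p\<in>S. smul (c p) (gact (map (\<lambda>l. (0, snd l)) p) (t K (gact g1 v))))"
      using act[OF K(1) g0(1) g1v] S(2) by (simp add: K g0 ev0 subset_iff cong: sum.cong)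
    also have "\<dots> = (\<Sum>p\<in>S. \<Sum>q\<in>S. Poly_Mapping.single (wmult (map (\<lambda>l. (0, snd l)) p) (map (\<lambda>l. (1, snd l)) q), 0) (c p * c q))"
      unfolding t1 pushforward_sum smul_sum gs ..
    finally show ?thesis unfolding sum.cartesian_product .
  qed
  have "gact (wmult g0 g1) v = gact g0 (gact g1 v)"
    using obj_rep[OF K(1)] g0(1) g1(1) v(1) unfolding is_representation_def obj_ops[OF K(1)] by blast
  then have eq: "(\<Sum>r\<in>S. Poly_Mapping.single (eval_word ?T w r, 0 :: nat) (c r)) = (\<Sum>(p, q)\<in>S \<times> S. Poly_Mapping.single
      (wmult (map (\<lambda>l. (0, snd l)) p) (map (\<lambda>l. (1, snd l)) q), 0) (c p * c q))"
    by (simp only: L[symmetric] R[symmetric])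
  have card: "card S \<le> 1"
    by (rule multiplicative_imp_monomial[OF S c eq])
  \<comment> \<open>The unit acts trivially and every word has value \<open>[]\<close> there, so the
    coefficients sum to 1. This excludes an empty support and makes the one surviving coefficient
    equal to 1.\<close>
  have unit: "t QQ (bas 0) = (\<Sum>r\<in>S. smul (c r) (t QQ (bas 0)))"
  proof -
    have i: "gact [] u = u" for u :: "(nat word \<times> nat) \<Rightarrow>\<^sub>0 'k" by (rule pushforward_id) auto
    have "t QQ (gact [] (bas 0)) = (\<Sum>r\<in>S. smul (c r) (gact (eval_word (F QQ) (s QQ []) r) (t QQ (bas 0))))"
      by (rule act[OF PQ_obj(2) obj_closed(1)[OF PQ_obj(2)]]) simp
    then show ?thesis
      by (simp only: i s_one[OF PQ_obj(2)] eval_word_one[OF F_obj[OF PQ_obj(2)]])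
  qed
  have "S \<noteq> {}" using unit t_bas_nonzero by auto
  with card S(1) have "card S = 1" by (metis One_nat_def card_0_eq le_antisym not_less_eq_eq le_zero_eq)
  then obtain r where r: "S = {r}" by (rule card_1_singletonE)
  have "smul (c r) (t QQ (bas 0)) = smul 1 (t QQ (bas 0))" using unit by (simp add: r)
  then have c1: "c r = 1" using smul_cancel[OF t_bas_nonzero] by blast
  have rF: "r \<in> carrier (free_grp {0})" using S(2) r by simp
  \<comment> \<open>Both expansions are single monomials with coefficient 1, so their words
    agree.\<close>
  have evw: "eval_word ?T w r = wmult (eval_word ?T (gen 0) r) (eval_word ?T (gen 1) r)"
  proof -
    have "Poly_Mapping.single (eval_word ?T w r, 0 :: nat) (1 :: 'k) =
        Poly_Mapping.single (wmult (eval_word ?T (gen 0) r) (eval_word ?T (gen 1) r), 0) 1"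
      using eq by (simp add: r c1 ev0[OF rF] ev1[OF rF])
    from arg_cong[OF this, of Poly_Mapping.keys] show ?thesis by simp
  qed
  have mult: "eval_word (F H) (s H (wmult g h)) r = wmult (eval_word (F H) (s H g) r) (eval_word (F H) (s H h) r)"
    if H: "H \<in> Theta0_objects" and g: "g \<in> gcar H" and h: "h \<in> gcar H" for H g h
  proof -
    \<comment> \<open>The identity \<open>evw\<close> concerns free generators, so it can be
      specialised: \<open>n\<close> sends them to \<open>s H g\<close> and \<open>s H h\<close>, and
      its preimage \<open>n0\<close> sends \<open>g0\<close> to \<open>g\<close> and
      \<open>g1\<close> to \<open>h\<close>. The value 0 of the vector generator is
      arbitrary.\<close>
    have "\<forall>x\<in>{0, 1::nat}. (if x = 0 then s H g else s H h) \<in> gcar (F H)" "\<forall>y\<in>{0::nat}. 0 \<in> vcar (F H)"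
      using s_closed[OF H] g h obj_closed(3)[OF F_obj[OF H]] by simp_all
    from free_hom_exists[OF F_obj[OF H] this] obtain n where n: "n \<in> rep_hom (F K) (F H)"
      "fst n (gen 0) = s H g" "fst n (gen 1) = s H h" unfolding K by auto
    obtain n0 where n0: "n0 \<in> rep_hom K H" "T K H n0 = n" by (rule T_surj[OF K(1) H n(1)])
    have n': "n \<in> rep_hom ?T (F H)" using n(1) by (simp only: K)
    have "s H (fst n0 g0) = s H g" "s H (fst n0 g1) = s H h"
      using s_nat[OF K(1) H n0(1)] g0 g1 n n0 by simp_all
    then have "fst n0 g0 = g" "fst n0 g1 = h"
      using s_inj[OF H] g h rep_hom_apply(1)[OF n0(1) K(1) H] g0(1) g1(1) by blast+
    then have "s H (wmult g h) = fst n w"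
      using s_nat[OF K(1) H n0(1) obj_closed(2)[OF K(1) g0(1) g1(1)]] rep_hom_apply(2)[OF n0(1) K(1) H g0(1) g1(1)] n0
      by (simp add: w_def)
    then have "eval_word (F H) (s H (wmult g h)) r = fst n (eval_word ?T w r)"
      using eval_word_hom[OF n' O F_obj[OF H] w] by simp
    also have "\<dots> = wmult (fst n (eval_word ?T (gen 0) r)) (fst n (eval_word ?T (gen 1) r))"
      unfolding evw by (intro rep_hom_apply(2)[OF n' O F_obj[OF H]] eval_word_closed[OF O]) simp_all
    also have "\<dots> = wmult (eval_word (F H) (s H g) r) (eval_word (F H) (s H h) r)"
      using eval_word_hom[OF n' O F_obj[OF H], of "gen 0"] eval_word_hom[OF n' O F_obj[OF H], of "gen 1"] n by simp
    finally show ?thesis .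
  qed
  have "t H (gact g v) = gact (eval_word (F H) (s H g) r) (t H v)"
    if "H \<in> Theta0_objects" "g \<in> gcar H" "v \<in> vcar H" for H g v
    using act[OF that] by (simp add: r c1)
  then show ?thesis using mult by (intro bexI[OF _ rF] conjI ballI) simp_all
qed

section \<open>The group component of the isomorphism\<close>

definition act_word :: "nat word" where
  "act_word = (SOME r. r \<in> carrier (free_grp {0}) \<and>
    (\<forall>H\<in>Theta0_objects. \<forall>g\<in>gcar H. \<forall>v\<in>vcar H. t H (gact g v) = gact (eval_word (F H) (s H g) r) (t H v)) \<and>
    (\<forall>H\<in>Theta0_objects. \<forall>g\<in>gcar H. \<forall>h\<in>gcar H.
      eval_word (F H) (s H (wmult g h)) r = wmult (eval_word (F H) (s H g) r) (eval_word (F H) (s H h) r)))"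

text \<open>\<open>s\<close> corrected by the action word, so that it is multiplicative and
  compatible with the action through \<open>t\<close>.\<close>

definition grp_map :: "'k frep \<Rightarrow> nat word \<Rightarrow> nat word" where
  "grp_map H g = eval_word (F H) (s H g) act_word"

lemma act_word:
  "(\<forall>H\<in>Theta0_objects. \<forall>g\<in>gcar H. \<forall>v\<in>vcar H. t H (gact g v) = gact (grp_map H g) (t H v)) \<and>
   (\<forall>H\<in>Theta0_objects. \<forall>g\<in>gcar H. \<forall>h\<in>gcar H. grp_map H (wmult g h) = wmult (grp_map H g) (grp_map H h))"
  unfolding grp_map_def using someI_ex[OF act_monomial[unfolded Bex_def]] unfolding act_word_def[symmetric] by (elim conjE) (intro conjI)

lemma t_act: "H \<in> Theta0_objects \<Longrightarrow> g \<in> gcar H \<Longrightarrow> v \<in> vcar H \<Longrightarrow> t H (gact g v) = gact (grp_map H g) (t H v)"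
  using act_word by (elim conjE) simp

lemma grp_map_mult: "H \<in> Theta0_objects \<Longrightarrow> g \<in> gcar H \<Longrightarrow> h \<in> gcar H \<Longrightarrow> grp_map H (wmult g h) = wmult (grp_map H g) (grp_map H h)"
  using act_word by (elim conjE) simp

lemma grp_map_closed: "H \<in> Theta0_objects \<Longrightarrow> g \<in> gcar H \<Longrightarrow> grp_map H g \<in> gcar (F H)"
  unfolding grp_map_def by (intro eval_word_closed F_obj s_closed)

lemma grp_map_hom: "H \<in> Theta0_objects \<Longrightarrow> grp_map H \<in> hom (grp H) (grp (F H))"
  by (auto simp: hom_def grp_map_closed obj_ops grp_map_mult)

lemma grp_map_nat:
  assumes "H \<in> Theta0_objects" "H' \<in> Theta0_objects" "m \<in> rep_hom H H'" "g \<in> gcar H"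
  shows "grp_map H' (fst m g) = fst (T H H' m) (grp_map H g)"
  unfolding grp_map_def s_nat[OF assms]
  by (rule eval_word_hom[symmetric, OF T_hom[OF assms(1-3)]]) (simp_all add: assms s_closed)

lemma t_sum:
  assumes "H \<in> Theta0_objects" "\<And>i. i \<in> I \<Longrightarrow> f i \<in> vcar H"
  shows "sum f I \<in> vcar H \<and> t H (sum f I) = (\<Sum>i\<in>I. t H (f i))"
  using assms(2)
  by (induction I rule: infinite_finite_induct) (simp_all add: t_zero obj_closed assms(1) t_add)

text \<open>Transporting the action in the opposite direction expresses the generator \<open>x\<close> as a value \<open>e(r(x))\<close>, which
  makes \<open>k \<mapsto> r(k)\<close> bijective.\<close>

lemma act_word_root: "\<exists>e. \<forall>H\<in>Theta0_objects. \<forall>k\<in>gcar (F H). eval_word (F H) (eval_word (F H) k act_word) e = k"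
proof -
  let ?T = "free_rep {0} {0} :: 'k frep"
  let ?U = "Poly_Mapping.single (gen 0, 0) 1 :: (nat word \<times> nat) \<Rightarrow>\<^sub>0 'k"
  have O: "?T \<in> Theta0_objects" by (simp add: obj_free_rep)
  have g0: "gen 0 \<in> carrier (free_grp {0})" by (simp add: free_grp_simps reduced_def)
  have "?U \<in> vcar ?T" using g0 by (simp add: free_rep_car)
  from transport_lin(2)[OF _ _ this] obtain V where V: "V \<in> vcar ?T"
    "\<And>H m n. linked {0} {0} H m n \<Longrightarrow> t H (snd m V) = snd n ?U" by auto
  have k: "Poly_Mapping.keys V \<subseteq> carrier (free_grp {0}) \<times> {0}" using V(1) by (simp add: free_rep_car)
  obtain K where K: "K \<in> Theta0_objects" "F K = ?T" by (rule F_surj[OF O])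
  have gK: "gen 0 \<in> gcar (F K)" "bas 0 \<in> vcar (F K)" by (simp_all add: K)
  from s_surj[OF K(1) gK(1)] obtain g where g: "g \<in> gcar K" "s K g = gen 0" by (elim bexE)
  from t_surj[OF K(1) gK(2)] obtain v where v: "v \<in> vcar K" "t K v = bas 0" by (elim bexE)
  have "\<forall>x\<in>{0::nat}. g \<in> gcar K" "\<forall>y\<in>{0::nat}. v \<in> vcar K" using g v by simp_all
  from linked_exists[OF _ _ K(1) this] obtain m n where mn: "linked {0} {0} K m n"
    "fst m (gen 0) = g" "snd m (bas 0) = v" "fst n (gen 0) = s K g" "snd n (bas 0) = t K v" by auto
  have m: "m \<in> rep_hom ?T K" and n: "n \<in> rep_hom ?T (F K)" using mn(1) by (simp_all add: linked_def)
  have U: "snd n ?U = ?U"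
    using free_hom_single[OF n _ _ F_obj[OF K(1)] g0, of 0 1] mn by (simp add: g v pushforward_single)
  let ?h = "\<lambda>x. fst m (fst x)"
  have h: "?h x \<in> gcar K" if "x \<in> Poly_Mapping.keys V" for x
  proof -
    have "fst x \<in> gcar ?T" using k that by (auto simp: free_rep_car(1))
    then show ?thesis by (rule rep_hom_apply(1)[OF m O K(1)])
  qed
  have "snd m V = (\<Sum>x\<in>Poly_Mapping.keys V. smul (Poly_Mapping.lookup V x) (gact (?h x) v))"
    unfolding free_hom_apply[OF m _ _ K(1) V(1), simplified]
    by (intro sum.cong refl) (use k mn in auto)
  then have "t K (snd m V) = (\<Sum>x\<in>Poly_Mapping.keys V. t K (smul (Poly_Mapping.lookup V x) (gact (?h x) v)))"
    using t_sum[OF K(1), of "Poly_Mapping.keys V" "\<lambda>x. smul (Poly_Mapping.lookup V x) (gact (?h x) v)"]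
      obj_closed(5,6)[OF K(1)] h v(1) by simp
  also have "\<dots> = (\<Sum>x\<in>Poly_Mapping.keys V. Poly_Mapping.single (grp_map K (?h x), 0) (twist (Poly_Mapping.lookup V x)))"
  proof (intro sum.cong refl)
    fix x assume x: "x \<in> Poly_Mapping.keys V"
    have "grp_map K (?h x) \<in> gcar ?T" using grp_map_closed[OF K(1) h[OF x]] by (simp only: K)
    then have "wmult (grp_map K (?h x)) [] = grp_map K (?h x)" by (simp add: free_rep_car free_grp_simps wmult_Nil2)
    then show "t K (smul (Poly_Mapping.lookup V x) (gact (?h x) v)) =
        Poly_Mapping.single (grp_map K (?h x), 0) (twist (Poly_Mapping.lookup V x))"
      using t_scale[OF K(1) obj_closed(6)[OF K(1) h[OF x] v(1)]] t_act[OF K(1) h[OF x] v(1)]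
      by (simp add: v pushforward_single map_times_single)
  qed
  finally have "?U = \<dots>" using V(2)[OF mn(1)] U by simp
  \<comment> \<open>Collecting terms can only shrink a support, so the one key
    \<open>(gen 0, 0)\<close> of \<open>?U\<close> must come from a key of \<open>V\<close>; its
    word is the desired \<open>e\<close>.\<close>
  then have "Poly_Mapping.keys ?U \<subseteq> (\<lambda>x. (grp_map K (?h x), 0)) ` Poly_Mapping.keys V"
    by (simp only: keys_sum_single_subset)
  then obtain x where x: "x \<in> Poly_Mapping.keys V" "gen 0 = grp_map K (?h x)" by auto
  define e where "e = fst x"
  have e: "e \<in> carrier (free_grp {0})" using x k by (auto simp: e_def)
  have "?h x = eval_word K g e"
    unfolding e_def[symmetric] free_hom_wordval[OF K(1) m e]
    by (rule wordval_carrier_cong) (use e mn(2) in \<open>auto simp: free_grp_simps\<close>)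
  moreover have "grp_map K (eval_word K g e) = eval_word (F K) (grp_map K g) e"
    by (rule hom_wordval[OF obj_group obj_group grp_map_hom, where A = UNIV]) (use g(1) K(1) in auto)
  ultimately have *: "gen 0 = eval_word ?T (eval_word ?T (gen 0) act_word) e"
    using x(2) by (simp add: grp_map_def[of K g] g K)
  \<comment> \<open>An identity for the free generator holds for every \<open>k\<close>, since some
    homomorphism sends the generator to \<open>k\<close>.\<close>
  have "eval_word (F H) (eval_word (F H) k act_word) e = k" if H: "H \<in> Theta0_objects" and k: "k \<in> gcar (F H)" for H k
  proof -
    have "\<forall>x\<in>{0::nat}. k \<in> gcar (F H)" "\<forall>y\<in>{0::nat}. 0 \<in> vcar (F H)"
      using k obj_closed(3)[OF F_obj[OF H]] by simp_all
    from free_hom_exists[OF F_obj[OF H] this] obtain l where l: "l \<in> rep_hom ?T (F H)" "fst l (gen 0) = k" by auto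
    have g0T: "gen 0 \<in> gcar ?T" by simp
    have "fst l (eval_word ?T (eval_word ?T (gen 0) act_word) e) = eval_word (F H) (eval_word (F H) k act_word) e"
      using eval_word_hom[OF l(1) O F_obj[OF H] eval_word_closed[OF O g0T]] eval_word_hom[OF l(1) O F_obj[OF H] g0T] l(2) by simp
    then show ?thesis using * l(2) by simp
  qed
  then show ?thesis by blast
qed

text \<open>The word \<open>e\<close> recovers \<open>s H g\<close> from \<open>grp_map H g\<close>,
  which gives injectivity. For surjectivity write k = \<open>s H g\<close>: as a homomorphism,
  \<open>grp_map H\<close> commutes with evaluating \<open>e\<close>, so it sends the value of
  \<open>e\<close> at \<open>g\<close> to \<open>k\<close>.\<close>

lemma bij_grp_map:
  assumes H: "H \<in> Theta0_objects"
  shows "bij_betw (grp_map H) (gcar H) (gcar (F H))"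
proof -
  obtain e where e: "\<And>k. k \<in> gcar (F H) \<Longrightarrow> eval_word (F H) (eval_word (F H) k act_word) e = k"
    using act_word_root H by blast
  show ?thesis
  proof (rule bij_betw_imageI)
    show "inj_on (grp_map H) (gcar H)"
    proof (rule inj_onI)
      fix a b assume ab: "a \<in> gcar H" "b \<in> gcar H" "grp_map H a = grp_map H b"
      have "s H a = eval_word (F H) (grp_map H a) e" "s H b = eval_word (F H) (grp_map H b) e"
        unfolding grp_map_def using e[OF s_closed[OF H ab(1)]] e[OF s_closed[OF H ab(2)]] by (simp_all only:)
      then have "s H a = s H b" by (simp only: ab(3))
      then show "a = b" by (rule s_inj[OF H ab(1,2)])
    qed
    show "grp_map H ` gcar H = gcar (F H)"
    proof
      show "grp_map H ` gcar H \<subseteq> gcar (F H)" using grp_map_closed[OF H] by auto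
      show "gcar (F H) \<subseteq> grp_map H ` gcar H"
      proof
        fix k assume k: "k \<in> gcar (F H)"
        from s_surj[OF H k] obtain g where g: "g \<in> gcar H" "s H g = k" by (elim bexE)
        have "grp_map H (eval_word H g e) = eval_word (F H) (grp_map H g) e"
          by (rule hom_wordval[OF obj_group obj_group grp_map_hom, where A = UNIV]) (use g H in auto)
        then have "grp_map H (eval_word H g e) = k" using e[OF k] by (simp add: grp_map_def[of H g] g)
        then show "k \<in> grp_map H ` gcar H" using eval_word_closed[OF H g(1)] by blast
      qed
    qed
  qed
qed

lemma bij_t:
  assumes H: "H \<in> Theta0_objects"
  shows "bij_betw (t H) (vcar H) (vcar (F H))"
proof (rule bij_betw_imageI)
  show "inj_on (t H) (vcar H)" by (rule inj_onI) (rule t_inj[OF H])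
  show "t H ` vcar H = vcar (F H)"
  proof (intro subset_antisym subsetI)
    fix k assume "k \<in> vcar (F H)"
    from t_surj[OF H this] obtain v where "v \<in> vcar H" "t H v = k" by (elim bexE)
    then show "k \<in> t H ` vcar H" by (rule rev_image_eqI[OF _ sym])
  next
    fix k assume "k \<in> t H ` vcar H"
    then obtain v where "k = t H v" "v \<in> vcar H" by (rule imageE)
    then show "k \<in> vcar (F H)" using t_closed[OF H] by simp
  qed
qed

text \<open>Naturality, together with surjectivity of \<open>s\<close> and \<open>t\<close>,
  determines the image of a scalar endomorphism. The map \<open>twist\<close> thus becomes visible
  in the category itself, apart from the chosen \<open>s\<close> and \<open>t\<close>.\<close>

lemma T_scalar:
  assumes H: "H \<in> Theta0_objects" and z: "z \<in> rep_hom H H" "\<And>g. g \<in> gcar H \<Longrightarrow> fst z g = g"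
    "\<And>v. v \<in> vcar H \<Longrightarrow> snd z v = smul c v"
  shows "k \<in> gcar (F H) \<Longrightarrow> fst (T H H z) k = k" "u \<in> vcar (F H) \<Longrightarrow> snd (T H H z) u = smul (twist c) u"
proof -
  assume "k \<in> gcar (F H)"
  from s_surj[OF H this] obtain g where g: "g \<in> gcar H" "s H g = k" by (elim bexE)
  show "fst (T H H z) k = k" using s_nat[OF H H z(1) g(1)] g z(2) by simp
next
  assume "u \<in> vcar (F H)"
  from t_surj[OF H this] obtain v where v: "v \<in> vcar H" "t H v = u" by (elim bexE)
  show "snd (T H H z) u = smul (twist c) u" using t_nat[OF H H z(1) v(1)] t_scale[OF H v(1)] v z(3) by simp
qed

end

section \<open>The field automorphism of a category automorphism\<close>

abbreviation Th :: "('k::field frep, 'k farr) category" where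
  "Th \<equiv> Theta0 TYPE('k)"

lemma Theta0_sel:
  "Ob Th = Theta0_objects"
  "(H, H', h) \<in> Arr Th \<longleftrightarrow> H \<in> Theta0_objects \<and> H' \<in> Theta0_objects \<and> h \<in> rep_hom H H'"
  "Dom Th (H, H', h) = H" "Cod Th (H, H', h) = H'" "Id Th H = (H, H, id_hom H)"
  "Comp Th (H1, H2, g) (H, H', f) = (H, H2, comp_hom H g f)"
  by (auto simp: Theta0_def id_hom_def comp_hom_def split: prod.splits)

text \<open>For fixed \<open>c\<close> these form a natural endomorphism of the identity functor, as
  \<open>scalar_hom_commute\<close> shows. Category automorphisms permute these families, and that
  permutation is the field automorphism.\<close>

definition scalar_hom :: "'k \<Rightarrow> 'k::field frep \<Rightarrow> 'k fpair" where
  "scalar_hom c H = ((\<lambda>g\<in>gcar H. g), (\<lambda>v\<in>vcar H. smul c v))"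

lemma scalar_hom_apply [simp]: "g \<in> gcar H \<Longrightarrow> fst (scalar_hom c H) g = g" "v \<in> vcar H \<Longrightarrow> snd (scalar_hom c H) v = smul c v"
  by (simp_all add: scalar_hom_def)

lemma smul_commute: "smul c (smul d v) = smul d (smul c v)" for c :: "'k::field"
  by (simp add: smul_smul mult.commute)

lemma scalar_hom_hom: "H \<in> Theta0_objects \<Longrightarrow> scalar_hom c H \<in> rep_hom H H"
  unfolding scalar_hom_def by (rule rep_homI)
    (simp_all add: obj_closed map_times_add pushforward_scale smul_commute[of c])

lemma scalar_hom_commute:
  assumes "H \<in> Theta0_objects" "H' \<in> Theta0_objects" "h \<in> rep_hom H H'"
  shows "comp_hom H (scalar_hom c H') h = comp_hom H h (scalar_hom c H)"
  by (rule rep_hom_eqI[OF comp_hom_hom[OF assms(1,3) scalar_hom_hom[OF assms(2)]] comp_hom_hom[OF assms(1) scalar_hom_hom[OF assms(1)] assms(3)]])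
    (simp_all add: rep_hom_apply[OF assms(3,1,2)])

lemma scalar_hom_inject:
  assumes "scalar_hom c QQ = scalar_hom d QQ"
  shows "c = d"
proof -
  have "snd (scalar_hom c QQ) (bas 0) = snd (scalar_hom d QQ) (bas 0)" by (simp only: assms)
  then have "smul c (bas 0 :: (nat word \<times> nat) \<Rightarrow>\<^sub>0 'a) = smul d (bas 0)"
    by (simp only: scalar_hom_apply(2) bas_car singletonI)
  then show ?thesis by (simp only: smul_cancel[OF bas_nonzero])
qed

lemma cat_auto_arrow:
  assumes a: "(F, \<Phi>) \<in> cat_auto Th" and f: "H \<in> Theta0_objects" "H' \<in> Theta0_objects" "h \<in> rep_hom H H'"
  obtains k where "\<Phi> (H, H', h) = (F H, F H', k)" "k \<in> rep_hom (F H) (F H')"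
proof -
  have arr: "(H, H', h) \<in> Arr Th" using f by (simp add: Theta0_sel)
  obtain K K' k where k: "\<Phi> (H, H', h) = (K, K', k)" by (rule prod_cases3)
  have "\<Phi> (H, H', h) \<in> Arr Th" using a arr by (auto simp: cat_auto_def dest: Bij_imp_funcset)
  moreover have "K = F H \<and> K' = F H'"
    using a arr unfolding cat_auto_def by (auto simp: k Theta0_sel dest!: bspec[OF _ arr])
  ultimately show thesis using that k by (simp add: Theta0_sel)
qed

lemma frep_auto_cat_auto:
  assumes a: "(F, \<Phi>) \<in> cat_auto Th"
  shows "frep_auto F (\<lambda>H H' h. snd (snd (\<Phi> (H, H', h))))"
proof -
  let ?T = "\<lambda>H H' h. snd (snd (\<Phi> (H, H', h)))"
  have bF: "bij_betw F Theta0_objects Theta0_objects" and bP: "bij_betw \<Phi> (Arr Th) (Arr Th)"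
    using a by (auto simp: cat_auto_def Bij_def Theta0_sel)
  have T: "\<Phi> (H, H', h) = (F H, F H', ?T H H' h)" "?T H H' h \<in> rep_hom (F H) (F H')"
    if h: "H \<in> Theta0_objects" "H' \<in> Theta0_objects" "h \<in> rep_hom H H'" for H H' h
    by (rule cat_auto_arrow[OF a h]; simp)+
  show ?thesis
  proof
    show "bij_betw F Theta0_objects Theta0_objects" by (rule bF)
  next
    fix H H' :: "'a frep" assume H: "H \<in> Theta0_objects" "H' \<in> Theta0_objects"
    show "bij_betw (?T H H') (rep_hom H H') (rep_hom (F H) (F H'))"
    proof (rule bij_betw_imageI)
      show "inj_on (?T H H') (rep_hom H H')"
      proof (rule inj_onI)
        fix h k assume hk: "h \<in> rep_hom H H'" "k \<in> rep_hom H H'" "?T H H' h = ?T H H' k"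
        then have "\<Phi> (H, H', h) = \<Phi> (H, H', k)" using T(1)[OF H hk(1)] T(1)[OF H hk(2)] by simp
        moreover have "(H, H', h) \<in> Arr Th" "(H, H', k) \<in> Arr Th" using H hk by (simp_all add: Theta0_sel)
        ultimately have "(H, H', h) = (H, H', k)" by (rule inj_onD[OF bij_betw_imp_inj_on[OF bP]])
        then show "h = k" by simp
      qed
      show "?T H H' ` rep_hom H H' = rep_hom (F H) (F H')"
      proof (intro subset_antisym subsetI)
        fix k assume "k \<in> ?T H H' ` rep_hom H H'"
        then obtain h where "k = ?T H H' h" "h \<in> rep_hom H H'" by (rule imageE)
        then show "k \<in> rep_hom (F H) (F H')" using T(2)[OF H] by simp
      next
        fix k assume k: "k \<in> rep_hom (F H) (F H')"
        have FO: "F H \<in> Theta0_objects" "F H' \<in> Theta0_objects" using bij_betwE[OF bF] H by blast+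
        have "(F H, F H', k) \<in> \<Phi> ` Arr Th"
          unfolding bij_betw_imp_surj_on[OF bP] using FO k by (simp add: Theta0_sel)
        then obtain f where f: "(F H, F H', k) = \<Phi> f" "f \<in> Arr Th" by (rule imageE)
        obtain G G' h where h: "f = (G, G', h)" by (rule prod_cases3)
        have G: "G \<in> Theta0_objects" "G' \<in> Theta0_objects" "h \<in> rep_hom G G'" using f(2) by (simp_all add: h Theta0_sel)
        have "(F H, F H', k) = (F G, F G', ?T G G' h)" by (rule trans[OF f(1)[unfolded h] T(1)[OF G]])
        then have e: "F H = F G" "F H' = F G'" "k = ?T G G' h" unfolding prod.inject by blast+
        \<comment> \<open>The preimage arrow has ends of its own; injectivity of \<open>F\<close> on
          objects identifies them with the given ones.\<close>
        have "H = G" "H' = G'"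
          using inj_onD[OF bij_betw_imp_inj_on[OF bF] e(1) H(1) G(1)] inj_onD[OF bij_betw_imp_inj_on[OF bF] e(2) H(2) G(2)] .
        then show "k \<in> ?T H H' ` rep_hom H H'" using G(3) e(3) by (simp add: image_eqI)
      qed
    qed
  next
    fix H :: "'a frep" assume H: "H \<in> Theta0_objects"
    have "\<Phi> (Id Th H) = Id Th (F H)" using a H by (auto simp: cat_auto_def Theta0_sel(1))
    then show "?T H H (id_hom H) = id_hom (F H)" by (simp add: Theta0_sel)
  next
    fix H H' H'' :: "'a frep" and f g
    assume H: "H \<in> Theta0_objects" "H' \<in> Theta0_objects" "H'' \<in> Theta0_objects"
      and f: "f \<in> rep_hom H H'" and g: "g \<in> rep_hom H' H''"
    have "(H, H', f) \<in> Arr Th" "(H', H'', g) \<in> Arr Th" "Cod Th (H, H', f) = Dom Th (H', H'', g)"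
      using H f g by (simp_all add: Theta0_sel)
    then have "\<Phi> (Comp Th (H', H'', g) (H, H', f)) = Comp Th (\<Phi> (H', H'', g)) (\<Phi> (H, H', f))"
      using a by (auto simp: cat_auto_def)
    then show "?T H H'' (comp_hom H g f) = comp_hom (F H) (?T H' H'' g) (?T H H' f)"
      by (subst (asm) (1 2) T(1)) (simp_all add: H f g Theta0_sel)
  qed
qed

lemma cat_auto_scalar:
  fixes F :: "'k::field frep \<Rightarrow> 'k frep"
  assumes a: "(F, \<Phi>) \<in> cat_auto Th" and H: "H \<in> Theta0_objects"
  shows "\<Phi> (H, H, scalar_hom c H) = (F H, F H, scalar_hom (frep_auto.twist F (\<lambda>H H' h. snd (snd (\<Phi> (H, H', h)))) c) (F H))"
proof -
  interpret T: frep_auto F "\<lambda>H H' h. snd (snd (\<Phi> (H, H', h)))" by (rule frep_auto_cat_auto[OF a])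
  show ?thesis
  proof (rule cat_auto_arrow[OF a H H scalar_hom_hom[OF H]])
    fix k assume k: "\<Phi> (H, H, scalar_hom c H) = (F H, F H, k)" "k \<in> rep_hom (F H) (F H)"
    have "k = scalar_hom (T.twist c) (F H)"
      by (rule rep_hom_eqI[OF k(2) scalar_hom_hom[OF T.F_obj[OF H]]])
        (use T.T_scalar[OF H scalar_hom_hom[OF H], of c c] k(1) in simp_all)
    then show ?thesis using k(1) by simp
  qed
qed

text \<open>Characterised by the effect on scalar endomorphisms instead of through
  \<open>twist\<close>, hence free of the choices behind \<open>t\<close>. This makes the behaviour
  under composition immediate.\<close>

definition field_twist :: "('k::field frep \<Rightarrow> 'k frep) \<times> ('k farr \<Rightarrow> 'k farr) \<Rightarrow> 'k \<Rightarrow> 'k" where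
  "field_twist a = (THE \<delta>. \<forall>c. \<forall>H\<in>Theta0_objects. snd a (H, H, scalar_hom c H) = (fst a H, fst a H, scalar_hom (\<delta> c) (fst a H)))"

lemma field_twist_eqI:
  assumes a: "(F, \<Phi>) \<in> cat_auto Th"
    and d: "\<And>c H. H \<in> Theta0_objects \<Longrightarrow> \<Phi> (H, H, scalar_hom c H) = (F H, F H, scalar_hom (\<delta> c) (F H))"
  shows "field_twist (F, \<Phi>) = \<delta>"
  unfolding field_twist_def fst_conv snd_conv
proof (rule the_equality)
  show "\<forall>c. \<forall>H\<in>Theta0_objects. \<Phi> (H, H, scalar_hom c H) = (F H, F H, scalar_hom (\<delta> c) (F H))" using d by blast
next
  fix \<epsilon> assume e: "\<forall>c. \<forall>H\<in>Theta0_objects. \<Phi> (H, H, scalar_hom c H) = (F H, F H, scalar_hom (\<epsilon> c) (F H))"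
  \<comment> \<open>To separate scalars, an object \<open>F H\<close> with a nonzero vector is
    needed; the preimage of \<open>QQ\<close> provides one.\<close>
  have "F ` Theta0_objects = Theta0_objects" using a by (auto simp: cat_auto_def Bij_def Theta0_sel bij_betw_def)
  then have "QQ \<in> F ` Theta0_objects" by simp
  then obtain H where H: "QQ = F H" "H \<in> Theta0_objects" by (rule imageE)
  show "\<epsilon> = \<delta>"
  proof
    fix c
    have "\<Phi> (H, H, scalar_hom c H) = (F H, F H, scalar_hom (\<epsilon> c) (F H))" using e H(2) by blast
    then show "\<epsilon> c = \<delta> c" using d[OF H(2)] by (intro scalar_hom_inject) (simp add: H(1)[symmetric])
  qed
qed

lemma field_twist:
  assumes a: "(F, \<Phi>) \<in> cat_auto Th"
  shows "field_twist (F, \<Phi>) \<in> carrier (Ring_Auto field_ring)"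
    and "H \<in> Theta0_objects \<Longrightarrow> \<Phi> (H, H, scalar_hom c H) = (F H, F H, scalar_hom (field_twist (F, \<Phi>) c) (F H))"
proof -
  interpret T: frep_auto F "\<lambda>H H' h. snd (snd (\<Phi> (H, H', h)))" by (rule frep_auto_cat_auto[OF a])
  have e: "field_twist (F, \<Phi>) = T.twist" by (rule field_twist_eqI[OF a cat_auto_scalar[OF a]])
  show "field_twist (F, \<Phi>) \<in> carrier (Ring_Auto field_ring)"
    using T.bij_twist T.twist_add T.twist_mult T.twist_one
    unfolding e by (simp add: Ring_Auto_def field_ring_def ring_hom_def Bij_def)
  show "H \<in> Theta0_objects \<Longrightarrow> \<Phi> (H, H, scalar_hom c H) = (F H, F H, scalar_hom (field_twist (F, \<Phi>) c) (F H))"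
    unfolding e by (rule cat_auto_scalar[OF a])
qed

section \<open>Inner automorphisms are those with trivial field automorphism\<close>

lemma cat_iso_cancel:
  assumes C: "is_category C" and f: "f \<in> cat_isos C A B"
    and x: "x \<in> Arr C" "Dom C x = B" and y: "y \<in> Arr C" "Dom C y = B" and eq: "Comp C x f = Comp C y f"
  shows "x = y"
proof -
  from f obtain g where g: "g \<in> Arr C" "Dom C g = B" "Cod C g = A" "Comp C f g = Id C B"
    and f': "f \<in> Arr C" "Dom C f = A" "Cod C f = B" by (auto simp: cat_isos_def)
  have *: "Comp C (Comp C z f) g = z" if "z \<in> Arr C" "Dom C z = B" for z
    using C g f' that unfolding is_category_def by metis
  have "x = Comp C (Comp C x f) g" by (rule *[OF x, symmetric])
  also have "\<dots> = Comp C (Comp C y f) g" by (simp only: eq)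
  also have "\<dots> = y" by (rule *[OF y])
  finally show ?thesis .
qed

text \<open>Scalar endomorphisms commute with every homomorphism, in particular with the isomorphism
  from \<open>H\<close> to \<open>F H\<close>. Conjugation by it therefore carries the scalar
  \<open>c\<close> on \<open>H\<close> to the same scalar on \<open>F H\<close>.\<close>

lemma inner_imp_field_twist_id:
  fixes F :: "'k::field frep \<Rightarrow> 'k frep"
  assumes a: "(F, \<Phi>) \<in> inner_autos Th"
  shows "field_twist (F, \<Phi>) = id"
proof (rule field_twist_eqI)
  from a show c: "(F, \<Phi>) \<in> cat_auto Th" by (auto simp: inner_autos_def)
  from a obtain s where s: "\<forall>H\<in>Ob Th. s H \<in> cat_isos Th H (F H)"
    and nat: "\<forall>\<mu>\<in>Arr Th. Comp Th (\<Phi> \<mu>) (s (Dom Th \<mu>)) = Comp Th (s (Cod Th \<mu>)) \<mu>"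
    by (auto simp: inner_autos_def)
  fix c and H :: "'k frep" assume H: "H \<in> Theta0_objects"
  have FH: "F H \<in> Theta0_objects" by (rule frep_auto.F_obj[OF frep_auto_cat_auto[OF c] H])
  have sH: "s H \<in> cat_isos Th H (F H)" using s H by (simp add: Theta0_sel(1))
  then have sA: "s H \<in> Arr Th" "Dom Th (s H) = H" "Cod Th (s H) = F H" by (simp_all add: cat_isos_def)
  obtain G K h where "s H = (G, K, h)" by (rule prod_cases3)
  with sA have sh: "s H = (H, F H, h)" "h \<in> rep_hom H (F H)" by (simp_all add: Theta0_sel)
  have arr: "(H, H, scalar_hom c H) \<in> Arr Th" "(F H, F H, scalar_hom c (F H)) \<in> Arr Th"
    using H FH scalar_hom_hom by (simp_all add: Theta0_sel)
  have "Comp Th (\<Phi> (H, H, scalar_hom c H)) (s H) = Comp Th (s H) (H, H, scalar_hom c H)"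
    using bspec[OF nat arr(1)] by (simp add: Theta0_sel)
  also have "\<dots> = Comp Th (F H, F H, scalar_hom c (F H)) (s H)"
    by (simp add: sh Theta0_sel scalar_hom_commute[OF H FH sh(2)])
  finally have eq: "Comp Th (\<Phi> (H, H, scalar_hom c H)) (s H) = Comp Th (F H, F H, scalar_hom c (F H)) (s H)" .
  obtain k where k: "\<Phi> (H, H, scalar_hom c H) = (F H, F H, k)" "k \<in> rep_hom (F H) (F H)"
    by (rule cat_auto_arrow[OF c H H scalar_hom_hom[OF H]])
  have "\<Phi> (H, H, scalar_hom c H) = (F H, F H, scalar_hom c (F H))"
    by (rule cat_iso_cancel[OF category_Theta0 sH _ _ arr(2) _ eq]) (simp_all add: k FH Theta0_sel)
  then show "\<Phi> (H, H, scalar_hom c H) = (F H, F H, scalar_hom (id c) (F H))" by simp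
qed

lemma rep_hom_inverse:
  assumes H: "H \<in> Theta0_objects" "K \<in> Theta0_objects" and h: "h \<in> rep_hom H K"
    and b: "bij_betw (fst h) (gcar H) (gcar K)" "bij_betw (snd h) (vcar H) (vcar K)"
  shows "(H, K, h) \<in> cat_isos Th H K"
proof -
  let ?f = "inv_into (gcar H) (fst h)" and ?g = "inv_into (vcar H) (snd h)"
  let ?k = "(restrict ?f (gcar K), restrict ?g (vcar K))"
  have f: "?f x \<in> gcar H" "fst h (?f x) = x" if "x \<in> gcar K" for x
    using that b(1) by (auto simp: bij_betw_def inv_into_into f_inv_into_f)
  have g: "?g x \<in> vcar H" "snd h (?g x) = x" if "x \<in> vcar K" for x
    using that b(2) by (auto simp: bij_betw_def inv_into_into f_inv_into_f)
  have fi: "?f y = x" if "x \<in> gcar H" "fst h x = y" for x y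
    using bij_betw_inv_into_left[OF b(1) that(1)] that(2) by simp
  have gi: "?g y = x" if "x \<in> vcar H" "snd h x = y" for x y
    using bij_betw_inv_into_left[OF b(2) that(1)] that(2) by simp
  note ha = rep_hom_apply[OF h H]
  have k: "?k \<in> rep_hom K H"
    by (rule rep_homI[OF H(2,1)])
      (simp_all add: f g ha obj_closed[OF H(1)] fi gi)
  have "comp_hom H ?k h = id_hom H"
    by (rule rep_hom_eqI[OF comp_hom_hom[OF H(1) h k] id_hom_hom[OF H(1)]]) (simp_all add: ha fi gi)
  moreover have "comp_hom K h ?k = id_hom K"
    by (rule rep_hom_eqI[OF comp_hom_hom[OF H(2) k h] id_hom_hom[OF H(2)]]) (simp_all add: f g)
  ultimately show ?thesis
    using H h k unfolding cat_isos_def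
    by (intro CollectI conjI bexI[of _ "(K, H, ?k)"]) (simp_all add: Theta0_sel)
qed

lemma field_twist_id_imp_inner:
  fixes F :: "'k::field frep \<Rightarrow> 'k frep"
  assumes a: "(F, \<Phi>) \<in> cat_auto Th" and id: "field_twist (F, \<Phi>) = (\<lambda>x. x)"
  shows "(F, \<Phi>) \<in> inner_autos Th"
proof -
  interpret T: frep_auto F "\<lambda>H H' h. snd (snd (\<Phi> (H, H', h)))" by (rule frep_auto_cat_auto[OF a])
  have d: "T.twist = (\<lambda>x. x)" using field_twist_eqI[OF a cat_auto_scalar[OF a]] id by simp
  \<comment> \<open>The group component must be \<open>grp_map\<close>, not \<open>s\<close>. A
    trivial twist makes the semilinear \<open>t\<close> linear, so the pair is a
    homomorphism.\<close>
  define h where "h H = (restrict (T.grp_map H) (gcar H), restrict (T.t H) (vcar H))" for H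
  have h: "h H \<in> rep_hom H (F H)" if H: "H \<in> Theta0_objects" for H
    unfolding h_def
    by (rule rep_homI[OF H T.F_obj[OF H]])
      (simp_all add: H T.grp_map_mult T.t_add T.t_scale T.t_act d T.grp_map_closed T.t_closed)
  have iso: "(H, F H, h H) \<in> cat_isos Th H (F H)" if H: "H \<in> Theta0_objects" for H
    by (rule rep_hom_inverse[OF H T.F_obj[OF H] h[OF H]])
      (use T.bij_grp_map[OF H] T.bij_t[OF H] in \<open>simp_all add: h_def cong: bij_betw_cong\<close>)
  have nat: "Comp Th (\<Phi> (H, H', l)) (H, F H, h H) = Comp Th (H', F H', h H') (H, H', l)"
    if H: "H \<in> Theta0_objects" "H' \<in> Theta0_objects" and l: "l \<in> rep_hom H H'" for H H' l
  proof -
    obtain k where k: "\<Phi> (H, H', l) = (F H, F H', k)" "k \<in> rep_hom (F H) (F H')"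
      by (rule cat_auto_arrow[OF a H l])
    have "comp_hom H k (h H) = comp_hom H (h H') l"
      by (rule rep_hom_eqI[OF comp_hom_hom[OF H(1) h[OF H(1)] k(2)] comp_hom_hom[OF H(1) l h[OF H(2)]]])
        (use T.grp_map_nat[OF H l] T.t_nat[OF H l] k in \<open>simp_all add: h_def rep_hom_apply[OF l H]\<close>)
    then show ?thesis by (simp add: k Theta0_sel)
  qed
  have "Comp Th (\<Phi> \<mu>) (Dom Th \<mu>, F (Dom Th \<mu>), h (Dom Th \<mu>)) =
      Comp Th (Cod Th \<mu>, F (Cod Th \<mu>), h (Cod Th \<mu>)) \<mu>" if mu: "\<mu> \<in> Arr Th" for \<mu> :: "'k farr"
  proof -
    obtain H H' l where l: "\<mu> = (H, H', l)" by (rule prod_cases3)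
    show ?thesis using nat[of H H' l] mu by (simp add: l Theta0_sel(2-4))
  qed
  then have "\<exists>s. (\<forall>A\<in>Ob Th. s A \<in> cat_isos Th A (F A)) \<and>
      (\<forall>\<mu>\<in>Arr Th. Comp Th (\<Phi> \<mu>) (s (Dom Th \<mu>)) = Comp Th (s (Cod Th \<mu>)) \<mu>)"
    by (intro exI[of _ "\<lambda>H. (H, F H, h H)"]) (simp add: Theta0_sel(1) iso)
  then show ?thesis using a by (simp add: inner_autos_def)
qed

section \<open>Twisting coefficients by a field automorphism\<close>

definition coeff_map :: "('k \<Rightarrow> 'k) \<Rightarrow> ('b \<Rightarrow>\<^sub>0 'k) \<Rightarrow> ('b \<Rightarrow>\<^sub>0 'k::field)" where
  "coeff_map = Poly_Mapping.map"

locale field_auto =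
  fixes \<delta> :: "'k::field \<Rightarrow> 'k"
  assumes bij: "bij \<delta>" and add: "\<delta> (a + b) = \<delta> a + \<delta> b" and mult: "\<delta> (a * b) = \<delta> a * \<delta> b" and one: "\<delta> 1 = 1"
begin

abbreviation \<delta>' :: "'k \<Rightarrow> 'k" where
  "\<delta>' \<equiv> inv_into UNIV \<delta>"

lemma zero [simp]: "\<delta> 0 = 0"
proof -
  have "\<delta> 0 + \<delta> 0 = \<delta> 0 + 0" using add[of 0 0] by (simp only: add_0_left add_0_right)
  then show ?thesis by (rule add_left_imp_eq)
qed

lemma lookup_coeff_map: "Poly_Mapping.lookup (coeff_map \<delta> v) x = \<delta> (Poly_Mapping.lookup v x)"
  by (simp add: coeff_map_def Poly_Mapping.map.rep_eq when_def)

lemma inverse: "field_auto \<delta>'"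
proof
  note s = surj_f_inv_f[OF bij_is_surj[OF bij]] and i = inv_f_f[OF bij_is_inj[OF bij]]
  show "bij \<delta>'" by (rule bij_imp_bij_inv[OF bij])
  show "\<delta>' (a + b) = \<delta>' a + \<delta>' b" for a b
    using i[of "\<delta>' a + \<delta>' b"] by (simp add: add s)
  show "\<delta>' (a * b) = \<delta>' a * \<delta>' b" for a b
    using i[of "\<delta>' a * \<delta>' b"] by (simp add: mult s)
  show "\<delta>' 1 = 1" using i[of 1] by (simp add: one)
qed

lemma coeff_map_add: "coeff_map \<delta> (u + v) = coeff_map \<delta> u + coeff_map \<delta> v"
  by (rule poly_mapping_eqI) (simp add: lookup_coeff_map lookup_add add)

lemma coeff_map_smul: "coeff_map \<delta> (smul c v) = smul (\<delta> c) (coeff_map \<delta> v)"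
  by (rule poly_mapping_eqI) (simp add: lookup_coeff_map lookup_map_times mult)

lemma keys_coeff_map: "Poly_Mapping.keys (coeff_map \<delta> v) \<subseteq> Poly_Mapping.keys v"
  by (auto simp: in_keys_iff lookup_coeff_map)

lemma coeff_map_single: "coeff_map \<delta> (Poly_Mapping.single x c) = Poly_Mapping.single x (\<delta> c)"
  by (rule poly_mapping_eqI) (simp add: lookup_coeff_map lookup_single when_def)

lemma coeff_map_zero [simp]: "coeff_map \<delta> 0 = 0"
  by (rule poly_mapping_eqI) (simp add: lookup_coeff_map)

lemma coeff_map_sum: "coeff_map \<delta> (sum f I) = (\<Sum>i\<in>I. coeff_map \<delta> (f i))"
  by (induction I rule: infinite_finite_induct) (simp_all add: coeff_map_add)

lemma coeff_map_pushforward: "coeff_map \<delta> (pushforward f v) = pushforward f (coeff_map \<delta> v)"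
  by (subst pushforward_superset[OF _ keys_coeff_map])
    (simp_all add: pushforward_def coeff_map_sum coeff_map_single lookup_coeff_map)

lemma coeff_map_inverse: "coeff_map \<delta> (coeff_map \<delta>' v) = v" "coeff_map \<delta>' (coeff_map \<delta> v) = v"
  by (rule poly_mapping_eqI; simp add: lookup_coeff_map field_auto.lookup_coeff_map[OF inverse]
    surj_f_inv_f[OF bij_is_surj[OF bij]] inv_f_f[OF bij_is_inj[OF bij]])+

lemma coeff_map_closed: "H \<in> Theta0_objects \<Longrightarrow> v \<in> vcar H \<Longrightarrow> coeff_map \<delta> v \<in> vcar H"
  using keys_coeff_map[of v] by (auto simp: Theta0_objects_def free_rep_car)

text \<open>Conjugation by a change of coefficients, which is only semilinear: the twists by
  \<open>\<delta>\<close> and its inverse cancel, so the result is linear again. Words are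
  untouched, so the group component stays.\<close>

definition conj_hom :: "'k frep \<Rightarrow> 'k fpair \<Rightarrow> 'k fpair" where
  "conj_hom H h = (restrict (fst h) (gcar H), \<lambda>v\<in>vcar H. coeff_map \<delta> (snd h (coeff_map \<delta>' v)))"

lemma conj_hom_apply:
  "g \<in> gcar H \<Longrightarrow> fst (conj_hom H h) g = fst h g"
  "v \<in> vcar H \<Longrightarrow> snd (conj_hom H h) v = coeff_map \<delta> (snd h (coeff_map \<delta>' v))"
  by (simp_all add: conj_hom_def)

lemma inv_coeff_map_closed: "H \<in> Theta0_objects \<Longrightarrow> v \<in> vcar H \<Longrightarrow> coeff_map \<delta>' v \<in> vcar H"
  by (rule field_auto.coeff_map_closed[OF inverse])

lemma conj_hom_hom:
  assumes H: "H \<in> Theta0_objects" "H' \<in> Theta0_objects" and h: "h \<in> rep_hom H H'"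
  shows "conj_hom H h \<in> rep_hom H H'"
  unfolding conj_hom_def
  by (rule rep_homI[OF H])
    (simp_all add: rep_hom_apply[OF h H] coeff_map_closed H inv_coeff_map_closed coeff_map_add coeff_map_smul
      coeff_map_pushforward field_auto.coeff_map_add[OF inverse] field_auto.coeff_map_smul[OF inverse]
      field_auto.coeff_map_pushforward[OF inverse] surj_f_inv_f[OF bij_is_surj[OF bij]])

lemma conj_hom_inverse:
  assumes H: "H \<in> Theta0_objects" "H' \<in> Theta0_objects" and h: "h \<in> rep_hom H H'"
  shows "conj_hom H (field_auto.conj_hom \<delta>' H h) = h" "field_auto.conj_hom \<delta>' H (conj_hom H h) = h"
proof -
  interpret i: field_auto "\<delta>'" by (rule inverse)
  have ii: "inv_into UNIV \<delta>' = \<delta>" by (rule inv_inv_eq[OF bij])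
  show "conj_hom H (i.conj_hom H h) = h"
    by (rule rep_hom_eqI[OF conj_hom_hom[OF H i.conj_hom_hom[OF H h]] h])
      (simp_all add: conj_hom_apply i.conj_hom_apply inv_coeff_map_closed H coeff_map_inverse ii)
  show "i.conj_hom H (conj_hom H h) = h"
    by (rule rep_hom_eqI[OF i.conj_hom_hom[OF H conj_hom_hom[OF H h]] h])
      (simp_all add: conj_hom_apply i.conj_hom_apply coeff_map_closed H coeff_map_inverse ii)
qed

lemma conj_hom_id: "H \<in> Theta0_objects \<Longrightarrow> conj_hom H (id_hom H) = id_hom H"
  by (rule rep_hom_eqI[OF conj_hom_hom[OF _ _ id_hom_hom] id_hom_hom])
    (simp_all add: conj_hom_apply inv_coeff_map_closed coeff_map_inverse)

lemma conj_hom_comp: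
  assumes H: "H \<in> Theta0_objects" "H' \<in> Theta0_objects" "H'' \<in> Theta0_objects"
    and f: "f \<in> rep_hom H H'" and g: "g \<in> rep_hom H' H''"
  shows "conj_hom H (comp_hom H g f) = comp_hom H (conj_hom H' g) (conj_hom H f)"
  by (rule rep_hom_eqI[OF conj_hom_hom[OF H(1,3) comp_hom_hom[OF H(1) f g]]
      comp_hom_hom[OF H(1) conj_hom_hom[OF H(1,2) f] conj_hom_hom[OF H(2,3) g]]])
    (simp_all add: conj_hom_apply inv_coeff_map_closed coeff_map_closed H coeff_map_inverse rep_hom_apply[OF f H(1,2)])

text \<open>Undoing the coefficients, scaling by \<open>c\<close> and applying
  \<open>\<delta>\<close> multiplies by \<open>\<delta> c\<close>. This is why every field
  automorphism is realised.\<close>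

lemma conj_hom_scalar_hom: "H \<in> Theta0_objects \<Longrightarrow> conj_hom H (scalar_hom c H) = scalar_hom (\<delta> c) H"
  by (rule rep_hom_eqI[OF conj_hom_hom[OF _ _ scalar_hom_hom] scalar_hom_hom])
    (simp_all add: conj_hom_apply inv_coeff_map_closed coeff_map_inverse coeff_map_smul)

definition conj_arr :: "'k farr \<Rightarrow> 'k farr" where
  "conj_arr = (\<lambda>(H, H', h)\<in>Arr Th. (H, H', conj_hom H h))"

lemma conj_arr_apply: "H \<in> Theta0_objects \<Longrightarrow> H' \<in> Theta0_objects \<Longrightarrow> h \<in> rep_hom H H' \<Longrightarrow>
    conj_arr (H, H', h) = (H, H', conj_hom H h)"
  by (simp add: conj_arr_def Theta0_sel)

lemma conj_arr_closed: "f \<in> Arr Th \<Longrightarrow> conj_arr f \<in> Arr Th"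
  by (cases f rule: prod_cases3) (simp add: Theta0_sel conj_arr_apply conj_hom_hom)

lemma conj_arr_inverse:
  assumes "f \<in> Arr Th"
  shows "conj_arr (field_auto.conj_arr \<delta>' f) = f" "field_auto.conj_arr \<delta>' (conj_arr f) = f"
proof -
  interpret i: field_auto "\<delta>'" by (rule inverse)
  obtain H H' h where f: "f = (H, H', h)" by (rule prod_cases3)
  have H: "H \<in> Theta0_objects" "H' \<in> Theta0_objects" and h: "h \<in> rep_hom H H'"
    using assms by (simp_all add: f Theta0_sel)
  show "conj_arr (i.conj_arr f) = f"
    by (simp only: f i.conj_arr_apply[OF H h] conj_arr_apply[OF H i.conj_hom_hom[OF H h]] conj_hom_inverse[OF H h])
  show "i.conj_arr (conj_arr f) = f"
    by (simp only: f conj_arr_apply[OF H h] i.conj_arr_apply[OF H conj_hom_hom[OF H h]] conj_hom_inverse[OF H h])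
qed

text \<open>A change of coefficients maps each free representation onto itself, so the functor can
  be the identity on objects; conjugating back by the inverse field automorphism inverts it on
  arrows.\<close>

lemma conj_arr_auto: "((\<lambda>H\<in>Theta0_objects. H), conj_arr) \<in> cat_auto Th"
proof -
  have "bij_betw conj_arr (Arr Th) (Arr Th)"
    by (rule bij_betw_byWitness[where f' = "field_auto.conj_arr \<delta>'"])
      (auto simp: conj_arr_inverse conj_arr_closed field_auto.conj_arr_closed[OF inverse])
  then have "conj_arr \<in> Bij (Arr Th)" by (simp add: Bij_def conj_arr_def)
  moreover have "(\<lambda>H\<in>Theta0_objects. H) \<in> Bij (Theta0_objects :: 'k frep set)" by (rule id_Bij)
  moreover have "Dom Th (conj_arr f) = Dom Th f \<and> Cod Th (conj_arr f) = Cod Th f \<and>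
      Dom Th f \<in> Theta0_objects \<and> Cod Th f \<in> Theta0_objects" if "f \<in> Arr Th" for f :: "'k farr"
    using that by (cases f rule: prod_cases3) (simp add: Theta0_sel conj_arr_apply)
  moreover have "conj_arr (Id Th H) = Id Th H" if "H \<in> Theta0_objects" for H :: "'k frep"
    using that by (simp add: Theta0_sel conj_arr_apply id_hom_hom conj_hom_id)
  moreover have "conj_arr (Comp Th g f) = Comp Th (conj_arr g) (conj_arr f)"
    if "f \<in> Arr Th" "g \<in> Arr Th" "Cod Th f = Dom Th g" for f g :: "'k farr"
  proof -
    obtain H H' h where f: "f = (H, H', h)" by (rule prod_cases3)
    obtain K H'' k where g: "g = (K, H'', k)" by (rule prod_cases3)
    have H: "H \<in> Theta0_objects" "H' \<in> Theta0_objects" "H'' \<in> Theta0_objects" "K = H'"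
      and h: "h \<in> rep_hom H H'" and k: "k \<in> rep_hom H' H''"
      using that by (simp_all add: f g Theta0_sel)
    show ?thesis
      by (simp add: f g Theta0_sel conj_arr_apply H h k comp_hom_hom[OF H(1) h k] conj_hom_comp[OF H(1-3) h k])
  qed
  ultimately show ?thesis by (simp add: cat_auto_def Theta0_sel(1))
qed

lemma field_twist_conj_arr: "field_twist ((\<lambda>H\<in>Theta0_objects. H), conj_arr) = \<delta>"
  by (rule field_twist_eqI[OF conj_arr_auto]) (simp add: conj_arr_apply scalar_hom_hom conj_hom_scalar_hom)

end

text \<open>Applying two automorphisms in turn to a scalar endomorphism changes its scalar twice,
  and the uniqueness in \<open>field_twist_eqI\<close> identifies the composite map with the twist
  of the product.\<close>

lemma group_hom_field_twist:
  "group_hom (Cat_Auto (Th :: ('k::field frep, 'k farr) category)) (Ring_Auto field_ring) field_twist"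
proof (intro group_hom.intro group_hom_axioms.intro homI)
  show "group (Cat_Auto (Th :: ('k frep, 'k farr) category))" by (rule group_Cat_Auto[OF category_Theta0])
  interpret field "field_ring :: 'k ring" by (rule field_field_ring)
  show "group (Ring_Auto (field_ring :: 'k ring))" by (rule group_Ring_Auto[OF is_ring])
next
  fix a assume "a \<in> carrier (Cat_Auto (Th :: ('k frep, 'k farr) category))"
  then show "field_twist a \<in> carrier (Ring_Auto field_ring)"
    using field_twist(1) by (cases a) (auto simp: Cat_Auto_def)
next
  fix a b assume "a \<in> carrier (Cat_Auto (Th :: ('k frep, 'k farr) category))" "b \<in> carrier (Cat_Auto (Th :: ('k frep, 'k farr) category))"
  then obtain F \<Phi> G \<Psi> where a: "a = (F, \<Phi>)" "(F, \<Phi>) \<in> cat_auto (Th :: ('k frep, 'k farr) category)"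
    and b: "b = (G, \<Psi>)" "(G, \<Psi>) \<in> cat_auto (Th :: ('k frep, 'k farr) category)"
    by (cases a; cases b) (auto simp: Cat_Auto_def)
  have B: "F \<in> Bij (Ob Th)" "\<Phi> \<in> Bij (Arr Th)" "G \<in> Bij (Ob Th)" "\<Psi> \<in> Bij (Arr Th)"
    using a b by (auto simp: cat_auto_def)
  have m: "a \<otimes>\<^bsub>Cat_Auto Th\<^esub> b = (compose (Ob Th) F G, compose (Arr Th) \<Phi> \<Psi>)"
    by (simp add: a b Cat_Auto_def mult_BijGroup B)
  interpret C: group "Cat_Auto (Th :: ('k frep, 'k farr) category)" by (rule group_Cat_Auto[OF category_Theta0])
  have mc: "(compose (Ob Th) F G, compose (Arr Th) \<Phi> \<Psi>) \<in> cat_auto Th"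
    using C.m_closed[of a b] a b unfolding m by (simp add: Cat_Auto_def)
  have "field_twist (compose (Ob Th) F G, compose (Arr Th) \<Phi> \<Psi>) = (\<lambda>c. field_twist a (field_twist b c))"
  proof (rule field_twist_eqI[OF mc])
    fix c and H :: "'k frep" assume H: "H \<in> Theta0_objects"
    have G: "G H \<in> Theta0_objects" by (rule frep_auto.F_obj[OF frep_auto_cat_auto[OF b(2)] H])
    have "(H, H, scalar_hom c H) \<in> Arr Th" using H by (simp add: Theta0_sel scalar_hom_hom)
    then show "compose (Arr Th) \<Phi> \<Psi> (H, H, scalar_hom c H) =
        (compose (Ob Th) F G H, compose (Ob Th) F G H, scalar_hom (field_twist a (field_twist b c)) (compose (Ob Th) F G H))"
      using H by (simp add: compose_eq Theta0_sel(1) field_twist(2)[OF b(2) H] field_twist(2)[OF a(2) G] a(1) b(1))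
  qed
  moreover have "field_twist a \<in> Bij UNIV" "field_twist b \<in> Bij UNIV"
    using field_twist(1)[OF a(2)] field_twist(1)[OF b(2)] by (simp_all add: a b Ring_Auto_def field_ring_def)
  ultimately show "field_twist (a \<otimes>\<^bsub>Cat_Auto Th\<^esub> b) = field_twist a \<otimes>\<^bsub>Ring_Auto field_ring\<^esub> field_twist b"
    unfolding m by (simp add: Ring_Auto_def mult_BijGroup field_ring_def compose_def fun_eq_iff)
qed

lemma one_Ring_Auto: "\<one>\<^bsub>Ring_Auto field_ring\<^esub> = (\<lambda>x. x)"
  by (simp add: Ring_Auto_def BijGroup_def field_ring_def fun_eq_iff)

lemma kernel_field_twist:
  "kernel (Cat_Auto Th) (Ring_Auto field_ring) field_twist = inner_autos (Th :: ('k::field frep, 'k farr) category)"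
proof (intro subset_antisym subsetI)
  fix a assume a: "a \<in> kernel (Cat_Auto Th) (Ring_Auto field_ring) (field_twist :: ('k frep \<Rightarrow> 'k frep) \<times> _ \<Rightarrow> _)"
  obtain F \<Phi> where F: "a = (F, \<Phi>)" by (rule prod.exhaust)
  have "(F, \<Phi>) \<in> cat_auto Th" "field_twist (F, \<Phi>) = (\<lambda>x. x)"
    using a by (simp_all add: F kernel_def Cat_Auto_def one_Ring_Auto)
  then show "a \<in> inner_autos Th" unfolding F by (rule field_twist_id_imp_inner)
next
  fix a assume a: "a \<in> inner_autos (Th :: ('k frep, 'k farr) category)"
  obtain F \<Phi> where F: "a = (F, \<Phi>)" by (rule prod.exhaust)
  have "a \<in> cat_auto Th" using a by (auto simp: inner_autos_def)
  moreover have "field_twist a = id" using a unfolding F by (rule inner_imp_field_twist_id)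
  ultimately show "a \<in> kernel (Cat_Auto Th) (Ring_Auto field_ring) field_twist"
    by (simp add: kernel_def Cat_Auto_def one_Ring_Auto id_def)
qed

lemma field_twist_surj:
  "field_twist ` carrier (Cat_Auto Th) = carrier (Ring_Auto (field_ring :: 'k::field ring))"
proof (intro subset_antisym subsetI)
  fix d assume "d \<in> field_twist ` carrier (Cat_Auto (Th :: ('k frep, 'k farr) category))"
  then show "d \<in> carrier (Ring_Auto field_ring)"
    using group_hom.hom_closed[OF group_hom_field_twist] by blast
next
  fix d assume d: "d \<in> carrier (Ring_Auto (field_ring :: 'k ring))"
  interpret field_auto d
    by unfold_locales (use d in \<open>auto simp: Ring_Auto_def ring_hom_def field_ring_def Bij_def\<close>)
  show "d \<in> field_twist ` carrier (Cat_Auto Th)"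
    using conj_arr_auto field_twist_conj_arr by (intro image_eqI) (auto simp: Cat_Auto_def)
qed

theorem theorem5p3:
  shows "inner_autos (Theta0 TYPE('k::field_char_0)) \<lhd> Cat_Auto (Theta0 TYPE('k)) \<and>
    Cat_Auto (Theta0 TYPE('k)) Mod inner_autos (Theta0 TYPE('k)) \<cong>
      Ring_Auto (field_ring :: 'k ring)"
proof -
  interpret group_hom "Cat_Auto (Theta0 TYPE('k))" "Ring_Auto (field_ring :: 'k ring)" field_twist
    by (rule group_hom_field_twist)
  show ?thesis
    using normal_kernel FactGroup_iso[OF field_twist_surj] unfolding kernel_field_twist by blast
qed

end
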